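(* Let $(R,\mathfrak m)$ be a one-dimensional Cohen-Macaulay local ring that is almost Gorenstein, and let $I$ be a regular ideal of $R$ with $S=\mathrm{End}_R(I)$. (1) If $S$ is reflexive as an $R$-module and strictly larger than $R$, then every module in $\mathrm{CM}(S)$ is reflexive as an $R$-module. Thus $IM$ is a reflexive $R$-module for any maximal Cohen-Macaulay $R$-module $M$. In particular all powers of $I$ are reflexive. (2) If $I$ is a proper trace ideal, then $IM$ is reflexive for any maximal Cohen-Macaulay $R$-module $M$. In particular $I$ and all of its powers are reflexive.
   Context: All rings are commutative Noetherian with unity and modules are finitely generated. $Q(R)$ is the total ring of fractions of $R$. A canonical ideal $\omega_R$ is an ideal of $R$ isomorphic to a canonical module; a principal reduction of an ideal $J$ is an element $a\in J$ with $J^{n+1}=aJ^n$ for some $n\ge 0$. $R$ is almost Gorenstein if it has a canonical ideal $\omega_R$ with $(a):_R\omega_R=\{r\in R: r\omega_R\subseteq aR\}\supseteq\mathfrak m$ for some principal reduction $a$ of $\omega_R$. An ideal is regular if it contains a nonzerodivisor. $\mathrm{End}_R(I)$ is identified with $I:I=\{a\in Q(R): aI\subseteq I\}\supseteq R$. $\mathrm{CM}(S)$ denotes the finitely generated $S$-modules that are maximal Cohen-Macaulay over $R$. $M$ is reflexive if the natural map $M\to M^{**}$ is an isomorphism, with $M^*=\mathrm{Hom}_R(M,R)$. An ideal $J$ is a trace ideal if for some $R$-module $M$ it equals $\mathrm{tr}(M)$, the image of $M^*\otimes_RM\to R$, $\phi\otimes x\mapsto\phi(x)$. *)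

theory Defs
  imports "HOL-Algebra.Module" "HOL-Algebra.Ring_Divisibility" "HOL-Algebra.Ideal_Product" "HOL-Library.Extended_Nat"
begin

section \<open>Modules\<close>

text \<open>The \<open>mult\<close> and \<open>one\<close> fields of a module record play no role in \<^locale>\<open>module\<close>; they are left
  \<open>undefined\<close> in the constructions below.\<close>

definition self_mod :: "'a ring \<Rightarrow> ('a, 'a) module" where
  "self_mod R = \<lparr>carrier = carrier R, mult = mult R, one = one R, zero = zero R,
     add = add R, smult = mult R\<rparr>"

definition sub_mod :: "('a, 'b) module \<Rightarrow> 'b set \<Rightarrow> ('a, 'b) module" where
  "sub_mod M N = M\<lparr>carrier := N\<rparr>"

definition ideal_mod :: "'a ring \<Rightarrow> 'a set \<Rightarrow> ('a, 'a) module" where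
  "ideal_mod R I = sub_mod (self_mod R) I"

definition restrict_scalars :: "('a \<Rightarrow> 's) \<Rightarrow> ('s, 'b) module \<Rightarrow> ('a, 'b) module" where
  "restrict_scalars f M = \<lparr>carrier = carrier M, mult = mult M, one = one M, zero = zero M,
     add = add M, smult = (\<lambda>r x. smult M (f r) x)\<rparr>"

definition mod_span :: "'a ring \<Rightarrow> ('a, 'b) module \<Rightarrow> 'b set \<Rightarrow> 'b set" where
  "mod_span R M X = \<Inter>{N. submodule N R M \<and> X \<subseteq> N}"

definition fg_module :: "'a ring \<Rightarrow> ('a, 'b) module \<Rightarrow> bool" where
  "fg_module R M \<longleftrightarrow>
     module R M \<and> (\<exists>X. finite X \<and> X \<subseteq> carrier M \<and> mod_span R M X = carrier M)"

definition ideal_times :: "'a ring \<Rightarrow> 'a set \<Rightarrow> ('a, 'b) module \<Rightarrow> 'b set" where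
  "ideal_times R I M = mod_span R M {a \<odot>\<^bsub>M\<^esub> x | a x. a \<in> I \<and> x \<in> carrier M}"

definition quot_mod :: "'a ring \<Rightarrow> ('a, 'b) module \<Rightarrow> 'b set \<Rightarrow> ('a, 'b set) module" where
  "quot_mod R M N = \<lparr>carrier = {N +>\<^bsub>M\<^esub> x | x. x \<in> carrier M}, mult = undefined, one = undefined,
     zero = N, add = set_add M, smult = (\<lambda>a X. \<Union>x\<in>X. N +>\<^bsub>M\<^esub> (a \<odot>\<^bsub>M\<^esub> x))\<rparr>"

definition mod_hom :: "'a ring \<Rightarrow> ('a, 'b) module \<Rightarrow> ('a, 'c) module \<Rightarrow> ('b \<Rightarrow> 'c) set" where
  "mod_hom R M N = {f \<in> carrier M \<rightarrow> carrier N.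
     (\<forall>x\<in>carrier M. \<forall>y\<in>carrier M. f (x \<oplus>\<^bsub>M\<^esub> y) = f x \<oplus>\<^bsub>N\<^esub> f y) \<and>
     (\<forall>a\<in>carrier R. \<forall>x\<in>carrier M. f (a \<odot>\<^bsub>M\<^esub> x) = a \<odot>\<^bsub>N\<^esub> f x)}"

definition mod_iso :: "'a ring \<Rightarrow> ('a, 'b) module \<Rightarrow> ('a, 'c) module \<Rightarrow> ('b \<Rightarrow> 'c) set" where
  "mod_iso R M N = {f \<in> mod_hom R M N. bij_betw f (carrier M) (carrier N)}"

text \<open>Homomorphisms are taken to be extensional, so that two of them agree as HOL functions
  exactly when they agree on the carrier.\<close>

definition Hom_mod :: "'a ring \<Rightarrow> ('a, 'b) module \<Rightarrow> ('a, 'c) module \<Rightarrow> ('a, 'b \<Rightarrow> 'c) module" where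
  "Hom_mod R M N = \<lparr>carrier = mod_hom R M N \<inter> extensional (carrier M),
     mult = undefined, one = undefined,
     zero = (\<lambda>x\<in>carrier M. \<zero>\<^bsub>N\<^esub>),
     add = (\<lambda>f g. \<lambda>x\<in>carrier M. f x \<oplus>\<^bsub>N\<^esub> g x),
     smult = (\<lambda>a f. \<lambda>x\<in>carrier M. a \<odot>\<^bsub>N\<^esub> f x)\<rparr>"

definition dual_mod :: "'a ring \<Rightarrow> ('a, 'b) module \<Rightarrow> ('a, 'b \<Rightarrow> 'a) module" where
  "dual_mod R M = Hom_mod R M (self_mod R)"

definition bidual_map :: "'a ring \<Rightarrow> ('a, 'b) module \<Rightarrow> 'b \<Rightarrow> ('b \<Rightarrow> 'a) \<Rightarrow> 'a" where
  "bidual_map R M = (\<lambda>x\<in>carrier M. \<lambda>\<phi>\<in>carrier (dual_mod R M). \<phi> x)"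

definition reflexive_mod :: "'a ring \<Rightarrow> ('a, 'b) module \<Rightarrow> bool" where
  "reflexive_mod R M \<longleftrightarrow>
     module R M \<and> bidual_map R M \<in> mod_iso R M (dual_mod R (dual_mod R M))"

text \<open>The image of \<open>M\<^sup>* \<otimes> M \<rightarrow> R\<close>, i.e. all finite sums of values \<open>\<phi> x\<close>.\<close>

definition trace_of :: "'a ring \<Rightarrow> ('a, 'b) module \<Rightarrow> 'a set" where
  "trace_of R M = {(\<Oplus>\<^bsub>R\<^esub>i\<in>{..<n}. \<phi> i (x i)) | (n::nat) \<phi> x.
     (\<forall>i<n. \<phi> i \<in> carrier (dual_mod R M) \<and> x i \<in> carrier M)}"

text \<open>The type argument supplies the carrier type of the module whose trace is taken.\<close>

definition trace_ideal :: "'n itself \<Rightarrow> 'a ring \<Rightarrow> 'a set \<Rightarrow> bool" where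
  "trace_ideal _ R J \<longleftrightarrow> (\<exists>M :: ('a, 'n) module. fg_module R M \<and> J = trace_of R M)"


section \<open>Dimension, depth and Cohen-Macaulay modules\<close>

definition noetherian_local :: "'a ring \<Rightarrow> 'a set \<Rightarrow> bool" where
  "noetherian_local R m \<longleftrightarrow>
     cring R \<and> noetherian_ring R \<and> maximalideal m R \<and> (\<forall>n. maximalideal n R \<longrightarrow> n = m)"

definition krull_dim :: "'a ring \<Rightarrow> enat" where
  "krull_dim R = (SUP n \<in> {n. \<exists>P :: nat \<Rightarrow> 'a set.
     (\<forall>i\<le>n. primeideal (P i) R) \<and> (\<forall>i<n. P i \<subset> P (Suc i))}. enat n)"

definition regular_sequence :: "'a ring \<Rightarrow> ('a, 'b) module \<Rightarrow> 'a list \<Rightarrow> bool" where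
  "regular_sequence R M xs \<longleftrightarrow> set xs \<subseteq> carrier R \<and>
     (\<forall>i<length xs. \<forall>y\<in>carrier M.
        xs ! i \<odot>\<^bsub>M\<^esub> y \<in> ideal_times R (Idl\<^bsub>R\<^esub> (set (take i xs))) M \<longrightarrow>
        y \<in> ideal_times R (Idl\<^bsub>R\<^esub> (set (take i xs))) M) \<and>
     ideal_times R (Idl\<^bsub>R\<^esub> (set xs)) M \<noteq> carrier M"

text \<open>This gives the zero module depth \<open>0\<close>.\<close>

definition depth :: "'a ring \<Rightarrow> 'a set \<Rightarrow> ('a, 'b) module \<Rightarrow> enat" where
  "depth R m M = (SUP xs \<in> {xs. set xs \<subseteq> m \<and> regular_sequence R M xs}. enat (length xs))"

definition CM_local :: "'a ring \<Rightarrow> 'a set \<Rightarrow> bool" where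
  "CM_local R m \<longleftrightarrow> noetherian_local R m \<and> depth R m (self_mod R) = krull_dim R"

text \<open>The zero module counts as maximal Cohen-Macaulay, as usual for the category \<open>CM(R)\<close>.\<close>

definition MCM :: "'a ring \<Rightarrow> 'a set \<Rightarrow> ('a, 'b) module \<Rightarrow> bool" where
  "MCM R m M \<longleftrightarrow>
     fg_module R M \<and> (carrier M = {\<zero>\<^bsub>M\<^esub>} \<or> depth R m M = krull_dim R)"


section \<open>Canonical modules\<close>

text \<open>Testing against modules whose carrier lives in the type of \<open>R\<close> is no restriction: this
  includes all inclusions \<open>J \<subseteq> R\<close> of ideals, which suffice by Baer's criterion.\<close>

definition injective_mod :: "'a ring \<Rightarrow> ('a, 'e) module \<Rightarrow> bool" where
  "injective_mod R E \<longleftrightarrow> module R E \<and>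
     (\<forall>(A :: ('a, 'a) module) (B :: ('a, 'a) module) f g.
        module R A \<and> module R B \<and> f \<in> mod_hom R A B \<and> inj_on f (carrier A) \<and> g \<in> mod_hom R A E \<longrightarrow>
        (\<exists>h\<in>mod_hom R B E. \<forall>x\<in>carrier A. h (f x) = g x))"

definition injective_resolution ::
  "'a ring \<Rightarrow> ('a, 'b) module \<Rightarrow> ('b \<Rightarrow> 'e) \<Rightarrow> (nat \<Rightarrow> ('a, 'e) module) \<Rightarrow> (nat \<Rightarrow> 'e \<Rightarrow> 'e) \<Rightarrow> bool" where
  "injective_resolution R C \<epsilon> E d \<longleftrightarrow>
     (\<forall>i. injective_mod R (E i)) \<and>
     \<epsilon> \<in> mod_hom R C (E 0) \<and> (\<forall>i. d i \<in> mod_hom R (E i) (E (Suc i))) \<and>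
     inj_on \<epsilon> (carrier C) \<and>
     \<epsilon> ` carrier C = {x \<in> carrier (E 0). d 0 x = \<zero>\<^bsub>E 1\<^esub>} \<and>
     (\<forall>i. d i ` carrier (E i) = {x \<in> carrier (E (Suc i)). d (Suc i) x = \<zero>\<^bsub>E (Suc (Suc i))\<^esub>})"

text \<open>\<open>Ext\<^sup>i(N, C)\<close>, computed as the \<open>i\<close>-th cohomology of \<open>Hom(N, E)\<close> for an injective resolution
  \<open>(E, d)\<close> of \<open>C\<close>.\<close>

definition Ext_via ::
  "'a ring \<Rightarrow> ('a, 'n) module \<Rightarrow> (nat \<Rightarrow> ('a, 'e) module) \<Rightarrow> (nat \<Rightarrow> 'e \<Rightarrow> 'e) \<Rightarrow> nat \<Rightarrow>
   ('a, ('n \<Rightarrow> 'e) set) module" where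
  "Ext_via R N E d i = quot_mod R
     (sub_mod (Hom_mod R N (E i))
        {f \<in> carrier (Hom_mod R N (E i)). \<forall>x\<in>carrier N. d i (f x) = \<zero>\<^bsub>E (Suc i)\<^esub>})
     (case i of 0 \<Rightarrow> {\<zero>\<^bsub>Hom_mod R N (E 0)\<^esub>}
      | Suc j \<Rightarrow> (\<lambda>f. \<lambda>x\<in>carrier N. d j (f x)) ` carrier (Hom_mod R N (E j)))"

definition residue_mod :: "'a ring \<Rightarrow> 'a set \<Rightarrow> ('a, 'a set) module" where
  "residue_mod R m = quot_mod R (self_mod R) m"

text \<open>A canonical module is a maximal Cohen-Macaulay module \<open>C\<close> of finite injective dimension and
  of type \<open>dim\<^sub>k Ext\<^sup>t(k, C) = 1\<close>, where \<open>k = R/m\<close> and \<open>t = depth C\<close>.  As \<open>Ext\<^sup>t(k, C)\<close> is a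
  \<open>k\<close>-vector space, the latter says that it is isomorphic to \<open>k\<close>; it does not depend on the
  resolution used.  The type argument supplies the carrier type of the injective modules.\<close>

definition canonical_module :: "'e itself \<Rightarrow> 'a ring \<Rightarrow> 'a set \<Rightarrow> ('a, 'b) module \<Rightarrow> bool" where
  "canonical_module _ R m C \<longleftrightarrow> MCM R m C \<and>
     (\<exists>(\<epsilon> :: 'b \<Rightarrow> 'e) E d.
        injective_resolution R C \<epsilon> E d \<and>
        (\<exists>n. \<forall>i>n. carrier (E i) = {\<zero>\<^bsub>E i\<^esub>}) \<and>
        (\<exists>f. f \<in> mod_iso R (Ext_via R (residue_mod R m) E d (the_enat (depth R m C)))
               (residue_mod R m)))"

definition canonical_ideal :: "'e itself \<Rightarrow> 'a ring \<Rightarrow> 'a set \<Rightarrow> 'a set \<Rightarrow> bool" where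
  "canonical_ideal T R m W \<longleftrightarrow> ideal W R \<and> canonical_module T R m (ideal_mod R W)"

abbreviation ideal_power :: "'a ring \<Rightarrow> 'a set \<Rightarrow> nat \<Rightarrow> 'a set" where
  "ideal_power R J n \<equiv> J [^]\<^bsub>ideals_set R\<^esub> n"

definition principal_reduction :: "'a ring \<Rightarrow> 'a set \<Rightarrow> 'a \<Rightarrow> bool" where
  "principal_reduction R J a \<longleftrightarrow>
     a \<in> J \<and> (\<exists>n. ideal_power R J (Suc n) = (\<lambda>x. a \<otimes>\<^bsub>R\<^esub> x) ` ideal_power R J n)"

definition almost_Gorenstein :: "'e itself \<Rightarrow> 'a ring \<Rightarrow> 'a set \<Rightarrow> bool" where
  "almost_Gorenstein T R m \<longleftrightarrow>
     (\<exists>W a. canonical_ideal T R m W \<and> principal_reduction R W a \<and>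
        m \<subseteq> {r \<in> carrier R. \<forall>w\<in>W. r \<otimes>\<^bsub>R\<^esub> w \<in> PIdl\<^bsub>R\<^esub> a})"


section \<open>The total ring of fractions and endomorphism rings of ideals\<close>

definition nonzerodivisors :: "'a ring \<Rightarrow> 'a set" where
  "nonzerodivisors R = {s \<in> carrier R. \<forall>x\<in>carrier R. s \<otimes>\<^bsub>R\<^esub> x = \<zero>\<^bsub>R\<^esub> \<longrightarrow> x = \<zero>\<^bsub>R\<^esub>}"

definition regular_ideal :: "'a ring \<Rightarrow> 'a set \<Rightarrow> bool" where
  "regular_ideal R I \<longleftrightarrow> ideal I R \<and> I \<inter> nonzerodivisors R \<noteq> {}"

definition frac :: "'a ring \<Rightarrow> 'a \<Rightarrow> 'a \<Rightarrow> ('a \<times> 'a) set" where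
  "frac R a s = {(b, t). b \<in> carrier R \<and> t \<in> nonzerodivisors R \<and> a \<otimes>\<^bsub>R\<^esub> t = b \<otimes>\<^bsub>R\<^esub> s}"

definition total_fractions :: "'a ring \<Rightarrow> ('a \<times> 'a) set ring" where
  "total_fractions R = \<lparr>
     carrier = {frac R a s | a s. a \<in> carrier R \<and> s \<in> nonzerodivisors R},
     mult = (\<lambda>X Y. \<Union>(a, s)\<in>X. \<Union>(b, t)\<in>Y. frac R (a \<otimes>\<^bsub>R\<^esub> b) (s \<otimes>\<^bsub>R\<^esub> t)),
     one = frac R \<one>\<^bsub>R\<^esub> \<one>\<^bsub>R\<^esub>,
     zero = frac R \<zero>\<^bsub>R\<^esub> \<one>\<^bsub>R\<^esub>,
     add = (\<lambda>X Y. \<Union>(a, s)\<in>X. \<Union>(b, t)\<in>Y.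
              frac R ((a \<otimes>\<^bsub>R\<^esub> t) \<oplus>\<^bsub>R\<^esub> (b \<otimes>\<^bsub>R\<^esub> s)) (s \<otimes>\<^bsub>R\<^esub> t))\<rparr>"

definition to_frac :: "'a ring \<Rightarrow> 'a \<Rightarrow> ('a \<times> 'a) set" where
  "to_frac R a = frac R a \<one>\<^bsub>R\<^esub>"

text \<open>\<open>End\<^sub>R(I) = I : I\<close> inside the total ring of fractions; \<open>R\<close> is embedded by \<^const>\<open>to_frac\<close>.\<close>

definition End_ideal :: "'a ring \<Rightarrow> 'a set \<Rightarrow> ('a \<times> 'a) set ring" where
  "End_ideal R I = (total_fractions R)\<lparr>carrier :=
     {q \<in> carrier (total_fractions R).
        \<forall>x\<in>I. q \<otimes>\<^bsub>total_fractions R\<^esub> to_frac R x \<in> to_frac R ` I}\<rparr>"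

definition CM_over :: "'a ring \<Rightarrow> 'a set \<Rightarrow> ('a \<times> 'a) set ring \<Rightarrow> (('a \<times> 'a) set, 'b) module \<Rightarrow> bool" where
  "CM_over R m S M \<longleftrightarrow> fg_module S M \<and> MCM R m (restrict_scalars (to_frac R) M)"

end

theory Submission
  imports Defs
begin

text \<open>
  Let \<open>W\<close> be the canonical ideal, \<open>a \<in> W\<close> with \<open>m W \<subseteq> a R\<close>, and \<open>x \<in> m\<close> a nonzerodivisor; being
  torsion-free means that \<open>x\<close> acts injectively.  A finite injective resolution of \<open>W\<close> forces
  \<open>Ext\<^sup>i(R/J, W) = 0\<close> for \<open>i \<ge> 2\<close> and \<open>x \<in> J\<close>; hence \<open>x\<close> acts surjectively on \<open>Ext\<^sup>1(P, W)\<close> for every finitely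
  generated torsion-free \<open>P\<close>, and this group vanishes by Nakayama.  With \<open>Ext\<^sup>1(R/m, W) \<noteq> 0\<close> it follows
  that \<open>Hom(-, W)\<close> is a duality on finitely generated torsion-free modules, that \<open>W\<close> is faithful
  (so \<open>a\<close> is a nonzerodivisor), and that \<open>Hom(W, W) = R\<close>.

  If moreover \<open>W P \<subseteq> a P\<close>, then every \<open>f : P \<rightarrow> W\<close> satisfies \<open>f(z) W \<subseteq> a W\<close>, so \<open>f\<close> has image in \<open>a R\<close>;
  thus \<open>Hom(P, R)\<close> and \<open>Hom(P, W)\<close> agree up to the factor \<open>a\<close>, and \<open>P\<close> is reflexive.  The condition
  \<open>W I \<subseteq> a I\<close> (which passes to \<open>I M\<close> and to the powers of \<open>I\<close>) holds in both situations of the theorem: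
  a reflexive \<open>S \<noteq> R\<close> contains \<open>w/a\<close> for all \<open>w \<in> W\<close>, and for a proper trace ideal \<open>I\<close> of \<open>M\<close> the map
  \<open>(w/a)\<phi>\<close> is in \<open>M\<^sup>*\<close> whenever \<open>\<phi>\<close> is.
\<close>

section \<open>Submodules and linear maps\<close>

text \<open>The obstacle is that Ext is available only through one resolution, whose injectives live
  over the type \<open>'e\<close> and are tested against modules over the type of R. No long exact
  sequences are set up. Vanishing of Ext^i is stated as solvability of equations between elements of
  the resolution, a quotient P/Z is replaced by maps on P that are zero on Z, and torsion-freeness
  of P/Z by the purity condition that xp in Z forces p in Z. Then Ext^1(P/Z, W) = 0 reads: every
  linear map Z -> W extends to P. The nonvanishing of Ext^1(R/m, W) likewise becomes one map \<phi>
  : m -> W that is not multiplication by an element of W. The two basic facts of the duality are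
  proved by contradiction from it: \<phi> is glued to a relation module, extended by purity, and the
  extension yields a multiplier for \<phi> unless the claim holds. Multiplication by w/a on modules
  over R is cleared of denominators in the form wz = az'; fractions are formed only for the ring
  S.\<close>

lemma self_mod_simps [simp]:
  "carrier (self_mod R) = carrier R" "zero (self_mod R) = zero R"
  "add (self_mod R) = add R" "smult (self_mod R) = mult R"
  by (simp_all add: self_mod_def)

lemma sub_mod_simps [simp]:
  "carrier (sub_mod P A) = A" "zero (sub_mod P A) = zero P"
  "add (sub_mod P A) = add P" "smult (sub_mod P A) = smult P"
  by (simp_all add: sub_mod_def)

lemma a_inv_self_mod [simp]: "a_inv (self_mod R) = a_inv R"
  by (rule ext) (simp add: a_inv_def m_inv_def)

lemma a_minus_self_mod [simp]: "a_minus (self_mod R) = a_minus R"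
  by (intro ext) (simp add: a_minus_def)

text \<open>The record types of \<^locale>\<open>cring\<close> and \<^locale>\<open>module\<close> are extensible, those of the definitions are not.\<close>

locale plain_cring = cring R for R :: "'a ring" (structure)

locale plain_module = module R M for R :: "'a ring" (structure) and M :: "('a, 'b) module" (structure)

sublocale plain_module \<subseteq> R?: plain_cring R
  by unfold_locales

lemma plain_moduleI: "module R M \<Longrightarrow> plain_module R M"
  by (rule plain_module.intro)

lemma (in plain_cring) module_self_mod: "module R (self_mod R)"
proof (rule moduleI)
  show "abelian_group (self_mod R)"
    by (rule abelian_groupI) (auto intro: a_assoc a_comm bexI[of _ "\<ominus> x" for x] simp: l_neg)
qed (auto simp: l_distr r_distr m_assoc cring_axioms)

lemma (in plain_module) sub_mod_module: "submodule A R M \<Longrightarrow> module R (sub_mod M A)"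
  unfolding sub_mod_def by (rule submodule.submodule_is_module) (auto intro: module_axioms)

lemma (in plain_module) submodule_zero: "submodule A R M \<Longrightarrow> \<zero>\<^bsub>M\<^esub> \<in> A"
  using submoduleE(2,4)[of A] submoduleE(1)[of A] by (metis R.zero_closed all_not_in_conv smult_l_null subsetD)

lemma (in plain_module) submodule_minus: "submodule A R M \<Longrightarrow> a \<in> A \<Longrightarrow> b \<in> A \<Longrightarrow> a \<ominus>\<^bsub>M\<^esub> b \<in> A"
  unfolding a_minus_def by (intro submoduleE(5) submoduleE(3))

lemma (in plain_module) submoduleI':
  assumes "A \<subseteq> carrier M" "\<zero>\<^bsub>M\<^esub> \<in> A" "\<And>a b. a \<in> A \<Longrightarrow> b \<in> A \<Longrightarrow> a \<oplus>\<^bsub>M\<^esub> b \<in> A"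
    and "\<And>r a. r \<in> carrier R \<Longrightarrow> a \<in> A \<Longrightarrow> r \<odot>\<^bsub>M\<^esub> a \<in> A"
  shows "submodule A R M"
proof (rule submoduleI)
  fix a assume a: "a \<in> A"
  have "(\<ominus> \<one>) \<odot>\<^bsub>M\<^esub> a \<in> A" using a assms(4) by simp
  then show "\<ominus>\<^bsub>M\<^esub> a \<in> A" using a assms(1) by (simp add: smult_l_minus subsetD)
qed (use assms in auto)

text \<open>Ideals are treated as submodules of \<open>self_mod R\<close>, so that
  \<open>adjoin\<close>, \<open>colon\<close> and the extension lemmas for modules apply to them
  without a second version.\<close>

lemma (in plain_cring) submodule_self_mod_iff: "submodule J R (self_mod R) \<longleftrightarrow> ideal J R"
proof -
  interpret S: plain_module R "self_mod R" by (rule plain_moduleI, rule module_self_mod)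
  show ?thesis
  proof
    assume J: "submodule J R (self_mod R)"
    show "ideal J R"
    proof (rule idealI)
      show "ring R" by (rule ring_axioms)
      show "subgroup J (add_monoid R)"
        by (rule add.subgroupI) (use S.submoduleE[OF J] S.submodule_zero[OF J] in auto)
      show "\<And>a x. a \<in> J \<Longrightarrow> x \<in> carrier R \<Longrightarrow> x \<otimes> a \<in> J"
        using submodule.smult_closed[OF J] by simp
      show "\<And>a x. a \<in> J \<Longrightarrow> x \<in> carrier R \<Longrightarrow> a \<otimes> x \<in> J"
        using submodule.smult_closed[OF J] S.submoduleE(1)[OF J] by (metis m_comm self_mod_simps(1,4) subsetD)
    qed
  next
    assume J: "ideal J R"
    interpret ideal J R by (rule J)
    show "submodule J R (self_mod R)"
      by (rule S.submoduleI) (auto intro: I_l_closed a_subset[THEN subsetD])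
  qed
qed

lemma (in plain_module) submodule_Int:
  "submodule A R M \<Longrightarrow> submodule B R M \<Longrightarrow> submodule (A \<inter> B) R M"
  by (rule submoduleI') (auto dest: submoduleE submodule_zero intro: submoduleE(4,5))

lemma (in plain_module) submodule_trans:
  assumes "submodule A R M"
  shows "submodule B R (sub_mod M A) \<longleftrightarrow> submodule B R M \<and> B \<subseteq> A"
proof -
  interpret A: plain_module R "sub_mod M A" by (rule plain_moduleI, rule sub_mod_module, rule assms)
  show ?thesis
  proof
    assume B: "submodule B R (sub_mod M A)"
    show "submodule B R M \<and> B \<subseteq> A"
      using A.submoduleE[OF B] A.submodule_zero[OF B] submoduleE(1)[OF assms]
      by (auto intro!: submoduleI')
  next
    assume "submodule B R M \<and> B \<subseteq> A"
    then show "submodule B R (sub_mod M A)"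
      using submoduleE[of B] submodule_zero[of B] by (auto intro!: A.submoduleI')
  qed
qed

lemma (in plain_module) mod_span_submodule:
  assumes "X \<subseteq> carrier M" shows "submodule (mod_span R M X) R M"
  unfolding mod_span_def
  by (rule submoduleI')
    (use assms carrier_is_submodule in \<open>auto dest: submodule_zero intro: submoduleE(4,5)\<close>)

lemma mod_span_superset: "X \<subseteq> mod_span R M X"
  unfolding mod_span_def by blast

lemma mod_span_minimal: "submodule N R M \<Longrightarrow> X \<subseteq> N \<Longrightarrow> mod_span R M X \<subseteq> N"
  unfolding mod_span_def by blast

text \<open>The submodule A + Rp, in the normal form a + rp from which maps out of it are
  defined.\<close>

definition adjoin :: "'a ring \<Rightarrow> ('a, 'b) module \<Rightarrow> 'b set \<Rightarrow> 'b \<Rightarrow> 'b set" where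
  "adjoin R M A p = {a \<oplus>\<^bsub>M\<^esub> r \<odot>\<^bsub>M\<^esub> p | a r. a \<in> A \<and> r \<in> carrier R}"

text \<open>The ideal A : p, the annihilator of p modulo A. As (A + Rp)/A is isomorphic to R/(A :
  p), this ideal stands in for the cyclic quotient throughout.\<close>

definition colon :: "'a ring \<Rightarrow> ('a, 'b) module \<Rightarrow> 'b set \<Rightarrow> 'b \<Rightarrow> 'a set" where
  "colon R M A p = {r \<in> carrier R. r \<odot>\<^bsub>M\<^esub> p \<in> A}"

lemma (in plain_module) adjoin_submodule:
  assumes A: "submodule A R M" and p: "p \<in> carrier M"
  shows "submodule (adjoin R M A p) R M"
proof (rule submoduleI')
  note Ac = submoduleE(1)[OF A, THEN subsetD]
  show "adjoin R M A p \<subseteq> carrier M" unfolding adjoin_def using p Ac by auto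
  have "\<zero>\<^bsub>M\<^esub> = \<zero>\<^bsub>M\<^esub> \<oplus>\<^bsub>M\<^esub> \<zero> \<odot>\<^bsub>M\<^esub> p" using p by simp
  then show "\<zero>\<^bsub>M\<^esub> \<in> adjoin R M A p" unfolding adjoin_def using submodule_zero[OF A] by blast
  show "u \<oplus>\<^bsub>M\<^esub> v \<in> adjoin R M A p" if uv: "u \<in> adjoin R M A p" "v \<in> adjoin R M A p" for u v
  proof -
    obtain a r b s where *: "u = a \<oplus>\<^bsub>M\<^esub> r \<odot>\<^bsub>M\<^esub> p" "v = b \<oplus>\<^bsub>M\<^esub> s \<odot>\<^bsub>M\<^esub> p" "a \<in> A" "b \<in> A"
      "r \<in> carrier R" "s \<in> carrier R"
      using uv unfolding adjoin_def by blast
    then have "u \<oplus>\<^bsub>M\<^esub> v = (a \<oplus>\<^bsub>M\<^esub> b) \<oplus>\<^bsub>M\<^esub> (r \<oplus> s) \<odot>\<^bsub>M\<^esub> p"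
      using p Ac by (simp add: smult_l_distr M.a_ac)
    then show ?thesis unfolding adjoin_def using * submoduleE(5)[OF A] by blast
  qed
  show "c \<odot>\<^bsub>M\<^esub> u \<in> adjoin R M A p" if u: "u \<in> adjoin R M A p" "c \<in> carrier R" for u c
  proof -
    obtain a r where *: "u = a \<oplus>\<^bsub>M\<^esub> r \<odot>\<^bsub>M\<^esub> p" "a \<in> A" "r \<in> carrier R"
      using u unfolding adjoin_def by blast
    then have "c \<odot>\<^bsub>M\<^esub> u = c \<odot>\<^bsub>M\<^esub> a \<oplus>\<^bsub>M\<^esub> (c \<otimes> r) \<odot>\<^bsub>M\<^esub> p"
      using p Ac that by (simp add: smult_r_distr smult_assoc1)
    then show ?thesis unfolding adjoin_def using * that submoduleE(4)[OF A] by blast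
  qed
qed

lemma (in plain_module) adjoin_superset:
  assumes A: "submodule A R M" and p: "p \<in> carrier M"
  shows "insert p A \<subseteq> adjoin R M A p"
proof -
  have "u \<in> adjoin R M A p" if "u \<in> A" for u
  proof -
    have "u = u \<oplus>\<^bsub>M\<^esub> \<zero> \<odot>\<^bsub>M\<^esub> p" using p that submoduleE(1)[OF A] by auto
    then show ?thesis unfolding adjoin_def using that by blast
  qed
  moreover have "p = \<zero>\<^bsub>M\<^esub> \<oplus>\<^bsub>M\<^esub> \<one> \<odot>\<^bsub>M\<^esub> p" using p by simp
  then have "p \<in> adjoin R M A p" unfolding adjoin_def using submodule_zero[OF A] by blast
  ultimately show ?thesis by blast
qed

lemma (in plain_module) colon_ideal:
  assumes A: "submodule A R M" and p: "p \<in> carrier M"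
  shows "ideal (colon R M A p) R"
proof -
  interpret S: plain_module R "self_mod R" by (rule plain_moduleI, rule R.module_self_mod)
  have "submodule (colon R M A p) R (self_mod R)"
    by (rule S.submoduleI')
      (use p in \<open>auto simp: colon_def smult_l_distr smult_assoc1 intro: submodule_zero[OF A] submoduleE(4,5)[OF A]\<close>)
  then show ?thesis using R.submodule_self_mod_iff by simp
qed

text \<open>Linear maps on a submodule, not required to be extensional.\<close>

definition lin :: "'a ring \<Rightarrow> ('a, 'b) module \<Rightarrow> 'b set \<Rightarrow> ('a, 'c) module \<Rightarrow> ('b \<Rightarrow> 'c) \<Rightarrow> bool" where
  "lin R P A E f \<longleftrightarrow> f \<in> mod_hom R (sub_mod P A) E"

lemma lin_iff:
  "lin R P A E f \<longleftrightarrow> (\<forall>u\<in>A. f u \<in> carrier E) \<and>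
     (\<forall>u\<in>A. \<forall>v\<in>A. f (u \<oplus>\<^bsub>P\<^esub> v) = f u \<oplus>\<^bsub>E\<^esub> f v) \<and>
     (\<forall>r\<in>carrier R. \<forall>u\<in>A. f (r \<odot>\<^bsub>P\<^esub> u) = r \<odot>\<^bsub>E\<^esub> f u)"
  unfolding lin_def mod_hom_def by auto

lemma mod_hom_iff_lin: "f \<in> mod_hom R P E \<longleftrightarrow> lin R P (carrier P) E f"
  unfolding lin_def by (simp add: sub_mod_def)

lemma linI:
  assumes "\<And>u. u \<in> A \<Longrightarrow> f u \<in> carrier E"
    and "\<And>u v. u \<in> A \<Longrightarrow> v \<in> A \<Longrightarrow> f (u \<oplus>\<^bsub>P\<^esub> v) = f u \<oplus>\<^bsub>E\<^esub> f v"
    and "\<And>r u. r \<in> carrier R \<Longrightarrow> u \<in> A \<Longrightarrow> f (r \<odot>\<^bsub>P\<^esub> u) = r \<odot>\<^bsub>E\<^esub> f u"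
  shows "lin R P A E f"
  using assms by (simp add: lin_iff)

lemma lin_closed: "lin R P A E f \<Longrightarrow> u \<in> A \<Longrightarrow> f u \<in> carrier E"
  and lin_add: "lin R P A E f \<Longrightarrow> u \<in> A \<Longrightarrow> v \<in> A \<Longrightarrow> f (u \<oplus>\<^bsub>P\<^esub> v) = f u \<oplus>\<^bsub>E\<^esub> f v"
  and lin_smult: "lin R P A E f \<Longrightarrow> r \<in> carrier R \<Longrightarrow> u \<in> A \<Longrightarrow> f (r \<odot>\<^bsub>P\<^esub> u) = r \<odot>\<^bsub>E\<^esub> f u"
  by (simp_all add: lin_iff)

lemma lin_subset: "lin R P A E f \<Longrightarrow> B \<subseteq> A \<Longrightarrow> lin R P B E f"
  unfolding lin_iff by (meson subsetD)

lemma lin_comp: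
  "lin R P A E f \<Longrightarrow> lin R E B G g \<Longrightarrow> (\<And>u. u \<in> A \<Longrightarrow> f u \<in> B) \<Longrightarrow> lin R P A G (\<lambda>u. g (f u))"
  by (auto simp: lin_iff)

lemma lin_cong: "lin R P A E f \<Longrightarrow> submodule A R P \<Longrightarrow> module R P \<Longrightarrow> (\<And>u. u \<in> A \<Longrightarrow> g u = f u) \<Longrightarrow> lin R P A E g"
  by (auto simp: lin_iff module.submoduleE(4,5))

locale module_pair = P?: plain_module R P + E?: plain_module R E for R :: "'a ring" and P :: "('a, 'b) module" and E :: "('a, 'c) module"

lemma module_pairI: "module R P \<Longrightarrow> module R E \<Longrightarrow> module_pair R P E"
  by (rule module_pair.intro; rule plain_moduleI)

section \<open>Linear maps between two modules: graphs, cyclic extensions, Baer's criterion\<close>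

context module_pair
begin

lemma lin_zero: "lin R P A E f \<Longrightarrow> submodule A R P \<Longrightarrow> f \<zero>\<^bsub>P\<^esub> = \<zero>\<^bsub>E\<^esub>"
  using lin_smult[of R P A E f "\<zero>\<^bsub>R\<^esub>" "\<zero>\<^bsub>P\<^esub>"] P.submodule_zero[of A] by (simp add: lin_closed)

lemma lin_minus:
  assumes f: "lin R P A E f" and A: "submodule A R P" and uv: "u \<in> A" "v \<in> A"
  shows "f (u \<ominus>\<^bsub>P\<^esub> v) = f u \<ominus>\<^bsub>E\<^esub> f v"
proof -
  have v': "v \<in> carrier P" "\<ominus>\<^bsub>P\<^esub> v \<in> A" using uv P.submoduleE[OF A] by auto
  have "f (\<ominus>\<^bsub>P\<^esub> v) = f ((\<ominus>\<^bsub>R\<^esub> \<one>\<^bsub>R\<^esub>) \<odot>\<^bsub>P\<^esub> v)"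
    using v' by (simp add: P.smult_l_minus)
  also have "\<dots> = \<ominus>\<^bsub>E\<^esub> f v"
    using lin_smult[OF f _ uv(2)] lin_closed[OF f uv(2)] by (simp add: E.smult_l_minus)
  finally show ?thesis
    using lin_add[OF f uv(1) v'(2)] by (simp add: a_minus_def)
qed

lemma lin_add_fun:
  assumes f: "lin R P A E f" and g: "lin R P A E g" shows "lin R P A E (\<lambda>u. f u \<oplus>\<^bsub>E\<^esub> g u)"
  by (rule linI) (simp_all add: lin_closed[OF f] lin_closed[OF g] lin_add[OF f] lin_add[OF g]
      lin_smult[OF f] lin_smult[OF g] E.M.a_ac E.smult_r_distr)

lemma lin_smult_fun:
  assumes f: "lin R P A E f" and c: "c \<in> carrier R" shows "lin R P A E (\<lambda>u. c \<odot>\<^bsub>E\<^esub> f u)"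
  by (rule linI) (simp_all add: c lin_closed[OF f] lin_add[OF f] lin_smult[OF f]
      E.smult_r_distr E.smult_assoc1[symmetric] P.R.m_comm)

lemma lin_minus_fun:
  assumes f: "lin R P A E f" and g: "lin R P A E g" shows "lin R P A E (\<lambda>u. f u \<ominus>\<^bsub>E\<^esub> g u)"
  by (rule linI) (simp_all add: lin_closed[OF f] lin_closed[OF g] lin_add[OF f] lin_add[OF g]
      lin_smult[OF f] lin_smult[OF g] a_minus_def E.M.minus_add E.M.a_ac E.smult_r_distr E.smult_r_minus)

lemma lin_zero_fun: "lin R P A E (\<lambda>u. \<zero>\<^bsub>E\<^esub>)"
  by (simp add: lin_iff)

lemma lin_vimage_submodule:
  assumes f: "lin R P A E f" and A: "submodule A R P" and B: "submodule B R E"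
  shows "submodule {u \<in> A. f u \<in> B} R P"
  by (rule P.submoduleI')
    (use P.submoduleE[OF A] E.submoduleE[OF B] P.submodule_zero[OF A] E.submodule_zero[OF B] in
      \<open>auto simp: lin_zero[OF f A] lin_add[OF f] lin_smult[OF f]\<close>)

text \<open>Two values over the same u differ by a value over zero, so an additive and homogeneous
  relation is single-valued once zero is related to zero only. Maps on sums and on presented modules
  are built this way, and their well-definedness always takes the form of the last
  hypothesis.\<close>

lemma lin_of_graph:
  assumes A: "submodule A R P"
    and ex: "\<And>u. u \<in> A \<Longrightarrow> \<exists>v. G u v"
    and car: "\<And>u v. u \<in> A \<Longrightarrow> G u v \<Longrightarrow> v \<in> carrier E"
    and add: "\<And>u v u' v'. u \<in> A \<Longrightarrow> u' \<in> A \<Longrightarrow> G u v \<Longrightarrow> G u' v' \<Longrightarrow> G (u \<oplus>\<^bsub>P\<^esub> u') (v \<oplus>\<^bsub>E\<^esub> v')"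
    and smult: "\<And>r u v. r \<in> carrier R \<Longrightarrow> u \<in> A \<Longrightarrow> G u v \<Longrightarrow> G (r \<odot>\<^bsub>P\<^esub> u) (r \<odot>\<^bsub>E\<^esub> v)"
    and zero: "\<And>v. G \<zero>\<^bsub>P\<^esub> v \<Longrightarrow> v = \<zero>\<^bsub>E\<^esub>"
  obtains f where "lin R P A E f" "\<And>u v. u \<in> A \<Longrightarrow> G u v \<longleftrightarrow> f u = v"
proof -
  have uniq: "v = v'" if u: "u \<in> A" and G: "G u v" "G u v'" for u v v'
  proof -
    have c: "u \<in> carrier P" "v \<in> carrier E" "v' \<in> carrier E"
      using u P.submoduleE(1)[OF A] car[OF u G(1)] car[OF u G(2)] by auto
    have m: "\<ominus>\<^bsub>P\<^esub> u \<in> A" by (rule P.submoduleE(3)[OF A u])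
    have "G ((\<ominus>\<^bsub>R\<^esub> \<one>\<^bsub>R\<^esub>) \<odot>\<^bsub>P\<^esub> u) ((\<ominus>\<^bsub>R\<^esub> \<one>\<^bsub>R\<^esub>) \<odot>\<^bsub>E\<^esub> v')"
      by (rule smult) (use u G in auto)
    then have "G (\<ominus>\<^bsub>P\<^esub> u) (\<ominus>\<^bsub>E\<^esub> v')" using c by (simp add: P.smult_l_minus E.smult_l_minus)
    from add[OF u m G(1) this] have "v \<oplus>\<^bsub>E\<^esub> \<ominus>\<^bsub>E\<^esub> v' = \<zero>\<^bsub>E\<^esub>"
      using c by (intro zero) (simp add: P.M.r_neg)
    then show ?thesis using c E.M.minus_equality[of v "\<ominus>\<^bsub>E\<^esub> v'"] by simp
  qed
  define f where "f u = (SOME v. G u v)" for u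
  have f: "G u (f u)" if "u \<in> A" for u
    unfolding f_def using ex[OF that] by (rule someI_ex)
  show ?thesis
  proof (rule that[of f])
    show iff: "G u v \<longleftrightarrow> f u = v" if "u \<in> A" for u v
      using f[OF that] uniq[OF that] by blast
    show "lin R P A E f"
      by (rule linI)
       (use car[OF _ f] P.submoduleE(4,5)[OF A] add[OF _ _ f f] smult[OF _ _ f] iff in \<open>simp_all\<close>)
  qed
qed

text \<open>A + Rp is the quotient of A \<oplus> R by the pairs (-rp, r) with r in A : p. A value e
  at p is therefore admissible as soon as it agrees with f on these multiples rp.\<close>

lemma lin_adjoin:
  assumes A: "submodule A R P" and p: "p \<in> carrier P" and f: "lin R P A E f" and e: "e \<in> carrier E"
    and compat: "\<And>r. r \<in> carrier R \<Longrightarrow> r \<odot>\<^bsub>P\<^esub> p \<in> A \<Longrightarrow> f (r \<odot>\<^bsub>P\<^esub> p) = r \<odot>\<^bsub>E\<^esub> e"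
  obtains f' where "lin R P (adjoin R P A p) E f'" "\<And>u. u \<in> A \<Longrightarrow> f' u = f u" "f' p = e"
proof -
  note Ac = P.submoduleE(1)[OF A, THEN subsetD]
  define G where "G u v \<longleftrightarrow> (\<exists>a\<in>A. \<exists>r\<in>carrier R. u = a \<oplus>\<^bsub>P\<^esub> r \<odot>\<^bsub>P\<^esub> p \<and> v = f a \<oplus>\<^bsub>E\<^esub> r \<odot>\<^bsub>E\<^esub> e)" for u v
  obtain f' where f': "lin R P (adjoin R P A p) E f'"
    and G: "\<And>u v. u \<in> adjoin R P A p \<Longrightarrow> G u v \<longleftrightarrow> f' u = v"
  proof (rule lin_of_graph[of "adjoin R P A p" G])
    show "submodule (adjoin R P A p) R P" by (rule P.adjoin_submodule[OF A p])
    show "\<exists>v. G u v" if "u \<in> adjoin R P A p" for u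
      using that unfolding adjoin_def G_def by blast
    show "v \<in> carrier E" if "G u v" for u v
      using that e lin_closed[OF f] unfolding G_def by auto
    show "G (u \<oplus>\<^bsub>P\<^esub> u') (v \<oplus>\<^bsub>E\<^esub> v')" if uv: "G u v" "G u' v'" for u u' v v'
    proof -
      obtain a r a' r' where *: "a \<in> A" "a' \<in> A" "r \<in> carrier R" "r' \<in> carrier R"
        "u = a \<oplus>\<^bsub>P\<^esub> r \<odot>\<^bsub>P\<^esub> p" "v = f a \<oplus>\<^bsub>E\<^esub> r \<odot>\<^bsub>E\<^esub> e"
        "u' = a' \<oplus>\<^bsub>P\<^esub> r' \<odot>\<^bsub>P\<^esub> p" "v' = f a' \<oplus>\<^bsub>E\<^esub> r' \<odot>\<^bsub>E\<^esub> e"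
        using uv unfolding G_def by blast
      then have "u \<oplus>\<^bsub>P\<^esub> u' = (a \<oplus>\<^bsub>P\<^esub> a') \<oplus>\<^bsub>P\<^esub> (r \<oplus>\<^bsub>R\<^esub> r') \<odot>\<^bsub>P\<^esub> p"
        "v \<oplus>\<^bsub>E\<^esub> v' = f (a \<oplus>\<^bsub>P\<^esub> a') \<oplus>\<^bsub>E\<^esub> (r \<oplus>\<^bsub>R\<^esub> r') \<odot>\<^bsub>E\<^esub> e"
        using p e Ac lin_closed[OF f] by (simp_all add: P.smult_l_distr E.smult_l_distr P.M.a_ac E.M.a_ac lin_add[OF f])
      then show ?thesis unfolding G_def using * P.submoduleE(5)[OF A] by blast
    qed
    show "G (r \<odot>\<^bsub>P\<^esub> u) (r \<odot>\<^bsub>E\<^esub> v)" if r: "r \<in> carrier R" and uv: "G u v" for r u v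
    proof -
      obtain a s where *: "a \<in> A" "s \<in> carrier R"
        "u = a \<oplus>\<^bsub>P\<^esub> s \<odot>\<^bsub>P\<^esub> p" "v = f a \<oplus>\<^bsub>E\<^esub> s \<odot>\<^bsub>E\<^esub> e"
        using uv unfolding G_def by blast
      then have "r \<odot>\<^bsub>P\<^esub> u = r \<odot>\<^bsub>P\<^esub> a \<oplus>\<^bsub>P\<^esub> (r \<otimes>\<^bsub>R\<^esub> s) \<odot>\<^bsub>P\<^esub> p"
        "r \<odot>\<^bsub>E\<^esub> v = f (r \<odot>\<^bsub>P\<^esub> a) \<oplus>\<^bsub>E\<^esub> (r \<otimes>\<^bsub>R\<^esub> s) \<odot>\<^bsub>E\<^esub> e"
        using p e r Ac lin_closed[OF f]
        by (simp_all add: P.smult_r_distr E.smult_r_distr P.smult_assoc1 E.smult_assoc1 lin_smult[OF f])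
      then show ?thesis unfolding G_def using * r P.submoduleE(4)[OF A] by blast
    qed
    show "v = \<zero>\<^bsub>E\<^esub>" if z: "G \<zero>\<^bsub>P\<^esub> v" for v
    proof -
      obtain a r where *: "a \<in> A" "r \<in> carrier R"
        "\<zero>\<^bsub>P\<^esub> = a \<oplus>\<^bsub>P\<^esub> r \<odot>\<^bsub>P\<^esub> p" "v = f a \<oplus>\<^bsub>E\<^esub> r \<odot>\<^bsub>E\<^esub> e"
        using z unfolding G_def by blast
      \<comment> \<open>If a + rp = 0, then (-r)p = a lies in A, where the compatibility condition
        determines f.\<close>
      have a: "a = (\<ominus>\<^bsub>R\<^esub> r) \<odot>\<^bsub>P\<^esub> p"
        using *(1-3) p Ac P.M.minus_equality[of a "r \<odot>\<^bsub>P\<^esub> p"] by (simp add: P.smult_l_minus)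
      have "f a = (\<ominus>\<^bsub>R\<^esub> r) \<odot>\<^bsub>E\<^esub> e"
        using compat[of "\<ominus>\<^bsub>R\<^esub> r"] a * by auto
      then show ?thesis using * e by (simp add: E.smult_l_minus E.M.l_neg)
    qed
  qed blast
  show ?thesis
  proof (rule that[of f'])
    show "lin R P (adjoin R P A p) E f'" by (rule f')
    show "f' u = f u" if u: "u \<in> A" for u
    proof -
      have "u = u \<oplus>\<^bsub>P\<^esub> \<zero>\<^bsub>R\<^esub> \<odot>\<^bsub>P\<^esub> p" "f u = f u \<oplus>\<^bsub>E\<^esub> \<zero>\<^bsub>R\<^esub> \<odot>\<^bsub>E\<^esub> e"
        using u p e Ac lin_closed[OF f u] by simp_all
      then have "G u (f u)" unfolding G_def using u by blast
      then show ?thesis using G[of u] P.adjoin_superset[OF A p] u by blast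
    qed
    have "p = \<zero>\<^bsub>P\<^esub> \<oplus>\<^bsub>P\<^esub> \<one>\<^bsub>R\<^esub> \<odot>\<^bsub>P\<^esub> p" "e = f \<zero>\<^bsub>P\<^esub> \<oplus>\<^bsub>E\<^esub> \<one>\<^bsub>R\<^esub> \<odot>\<^bsub>E\<^esub> e"
      using p e by (simp_all add: lin_zero[OF f A])
    then have "G p e" unfolding G_def using P.submodule_zero[OF A] by blast
    then show "f' p = e" using G[of p] P.adjoin_superset[OF A p] by blast
  qed
qed

text \<open>The inclusion of J in R is among the embeddings that \<open>injective_mod\<close> tests,
  and an extension to R is determined by its value at 1.\<close>

lemma injective_mod_Baer:
  assumes E: "injective_mod R E" and J: "ideal J R" and f: "lin R (self_mod R) J E f"
  obtains e where "e \<in> carrier E" "\<And>j. j \<in> J \<Longrightarrow> f j = j \<odot>\<^bsub>E\<^esub> e"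
proof -
  interpret S: plain_module R "self_mod R" by (rule plain_moduleI, rule P.R.module_self_mod)
  interpret J: ideal J R by (rule J)
  have Js: "submodule J R (self_mod R)" using J by (simp add: P.R.submodule_self_mod_iff)
  have "module R (sub_mod (self_mod R) J)" by (rule S.sub_mod_module[OF Js])
  moreover have "(\<lambda>u. u) \<in> mod_hom R (sub_mod (self_mod R) J) (self_mod R)"
    by (auto simp: mod_hom_def J.Icarr)
  moreover have "inj_on (\<lambda>u. u) (carrier (sub_mod (self_mod R) J))" by simp
  ultimately obtain h where h: "h \<in> mod_hom R (self_mod R) E" "\<forall>u\<in>J. h u = f u"
    using E f S.module_axioms unfolding injective_mod_def lin_def by (metis sub_mod_simps(1))
  have h': "lin R (self_mod R) (carrier R) E h" using h(1) by (simp add: mod_hom_iff_lin)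
  show ?thesis
  proof (rule that[of "h \<one>\<^bsub>R\<^esub>"])
    show "h \<one>\<^bsub>R\<^esub> \<in> carrier E" using lin_closed[OF h'] by simp
    show "f j = j \<odot>\<^bsub>E\<^esub> h \<one>\<^bsub>R\<^esub>" if "j \<in> J" for j
      using lin_smult[OF h', of j "\<one>\<^bsub>R\<^esub>"] that h(2) J.Icarr[OF that] by simp
  qed
qed

text \<open>Induction on the generators of P over A, one cyclic extension at a time. Each step only
  concerns an ideal of R, so P may live over any type although \<open>injective_mod\<close> tests
  modules over the type of R.\<close>

lemma injective_extends:
  assumes E: "injective_mod R E" and X: "finite X" "X \<subseteq> carrier P"
    and A: "submodule A R P" and f: "lin R P A E f"
    and gen: "\<And>N. submodule N R P \<Longrightarrow> A \<union> X \<subseteq> N \<Longrightarrow> carrier P \<subseteq> N"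
  obtains f' where "lin R P (carrier P) E f'" "\<And>u. u \<in> A \<Longrightarrow> f' u = f u"
proof -
  have "\<exists>f'. lin R P (carrier P) E f' \<and> (\<forall>u\<in>A. f' u = f u)"
    using X A f gen
  proof (induction X arbitrary: A f)
    case empty
    then have "A = carrier P" using P.submoduleE(1)[of A] by blast
    then show ?case using empty by blast
  next
    case (insert p X)
    then have p: "p \<in> carrier P" by simp
    note A = \<open>submodule A R P\<close> and f = \<open>lin R P A E f\<close>
    note Ac = P.submoduleE(1)[OF A, THEN subsetD]
    \<comment> \<open>Baer's criterion writes r \<mapsto> f(rp) on A : p as r \<mapsto> re; this e
      is then an admissible value at p.\<close>
    have "lin R (self_mod R) (colon R P A p) E (\<lambda>r. f (r \<odot>\<^bsub>P\<^esub> p))"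
      by (rule linI)
        (use p lin_closed[OF f] in \<open>auto simp: colon_def P.smult_l_distr P.smult_assoc1 lin_add[OF f] lin_smult[OF f]\<close>)
    from injective_mod_Baer[OF E P.colon_ideal[OF A p] this]
    obtain e where e: "e \<in> carrier E" "\<And>r. r \<in> colon R P A p \<Longrightarrow> f (r \<odot>\<^bsub>P\<^esub> p) = r \<odot>\<^bsub>E\<^esub> e" by blast
    obtain f1 where f1: "lin R P (adjoin R P A p) E f1" "\<And>u. u \<in> A \<Longrightarrow> f1 u = f u"
      by (rule lin_adjoin[OF A p f e(1)]) (use e(2) in \<open>auto simp: colon_def\<close>)
    have "carrier P \<subseteq> N" if "submodule N R P" "adjoin R P A p \<union> X \<subseteq> N" for N
      using insert.prems(4)[OF that(1)] that(2) P.adjoin_superset[OF A p] by blast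
    then obtain f' where f': "lin R P (carrier P) E f'" "\<forall>u\<in>adjoin R P A p. f' u = f1 u"
      using insert.IH[OF _ P.adjoin_submodule[OF A p] f1(1)] insert.prems(1) by blast
    have "\<forall>u\<in>A. f' u = f u"
      using f'(2) f1(2) P.adjoin_superset[OF A p] by (metis insert_subset subsetD)
    then show ?case using f' by blast
  qed
  then show ?thesis using that by blast
qed

end

section \<open>Noetherian local rings of dimension one\<close>

context plain_cring
begin

lemma nzd_closed: "s \<in> nonzerodivisors R \<Longrightarrow> s \<in> carrier R"
  by (simp add: nonzerodivisors_def)

lemma nzd_one: "\<one> \<in> nonzerodivisors R"
  by (simp add: nonzerodivisors_def)

lemma nzd_zero: "s \<in> nonzerodivisors R \<Longrightarrow> x \<in> carrier R \<Longrightarrow> s \<otimes> x = \<zero> \<Longrightarrow> x = \<zero>"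
  unfolding nonzerodivisors_def by blast

lemma nzd_mult:
  assumes "s \<in> nonzerodivisors R" "t \<in> nonzerodivisors R" shows "s \<otimes> t \<in> nonzerodivisors R"
proof -
  note c = nzd_closed[OF assms(1)] nzd_closed[OF assms(2)]
  have "x = \<zero>" if x: "x \<in> carrier R" "s \<otimes> t \<otimes> x = \<zero>" for x
  proof -
    have "s \<otimes> (t \<otimes> x) = \<zero>" using c x by (simp add: m_assoc)
    then have "t \<otimes> x = \<zero>" using nzd_zero[OF assms(1)] c x(1) by simp
    then show ?thesis using nzd_zero[OF assms(2)] x(1) by simp
  qed
  then show ?thesis unfolding nonzerodivisors_def using c by blast
qed

lemma nzd_cancel:
  assumes s: "s \<in> nonzerodivisors R" and uv: "u \<in> carrier R" "v \<in> carrier R" "s \<otimes> u = s \<otimes> v"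
  shows "u = v"
proof -
  have sc: "s \<in> carrier R" using s by (rule nzd_closed)
  have "s \<otimes> (u \<ominus> v) = \<zero>" using uv sc by (simp add: a_minus_def r_distr r_minus r_neg)
  then have "u \<ominus> v = \<zero>" using nzd_zero[OF s] uv by simp
  then show ?thesis using uv by simp
qed

end

section \<open>Noetherian rings: maximal members of families, finitely generated submodules,
  existence of primes\<close>

locale noetherian_cring = plain_cring R + noetherian_ring R for R :: "'a ring" (structure)

text \<open>In a Noetherian ring the union of a nonempty chain of ideals belongs to the chain, so
  Zorn's lemma applies to every nonempty family.\<close>

lemma (in noetherian_cring) ideal_family_maximal:
  assumes "F \<noteq> {}" "\<And>J. J \<in> F \<Longrightarrow> ideal J R"
  obtains J where "J \<in> F" "\<And>K. K \<in> F \<Longrightarrow> J \<subseteq> K \<Longrightarrow> K = J"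
proof -
  have "\<exists>U\<in>F. \<forall>S\<in>C. S \<subseteq> U" if C: "subset.chain F C" for C
  proof (cases "C = {}")
    case True
    then show ?thesis using assms(1) by blast
  next
    case False
    have "subset.chain {I. ideal I R} C" "C \<subseteq> F"
      using C assms(2) unfolding subset.chain_def by auto
    then have "\<Union>C \<in> F" using ideal_chain_is_trivial[OF False] by blast
    then show ?thesis by blast
  qed
  from subset_Zorn[of F, OF this] show ?thesis using that by blast
qed

lemma (in plain_module) mod_span_insert:
  assumes "X \<subseteq> carrier M" "p \<in> carrier M"
  shows "mod_span R M (insert p X) \<subseteq> adjoin R M (mod_span R M X) p"
  by (rule mod_span_minimal)
    (use adjoin_submodule[OF mod_span_submodule] adjoin_superset[OF mod_span_submodule]
      mod_span_superset[of X R M] assms in blast)+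

text \<open>Induction on the generators of the ambient module. The coefficients of the new generator
  p in elements of N form a finitely generated ideal; lifts of its generators, together with
  generators of the part of N in the span of X, generate N.\<close>

lemma (in plain_module) noetherian_fg_submodule:
  assumes noeth: "noetherian_ring R"
    and X: "finite X" "X \<subseteq> carrier M" and N: "submodule N R M" "N \<subseteq> mod_span R M X"
  shows "\<exists>Y. finite Y \<and> Y \<subseteq> N \<and> N \<subseteq> mod_span R M Y"
  using X N
proof (induction X arbitrary: N)
  case empty
  have "submodule {\<zero>\<^bsub>M\<^esub>} R M" by (rule submoduleI') auto
  then have "mod_span R M {} \<subseteq> {\<zero>\<^bsub>M\<^esub>}" by (rule mod_span_minimal) simp
  then have "N \<subseteq> {\<zero>\<^bsub>M\<^esub>}" using empty(3) by (rule_tac subset_trans)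
  also have "\<dots> \<subseteq> mod_span R M {}" using submodule_zero[OF mod_span_submodule[of "{}"]] by simp
  finally show ?case by blast
next
  case (insert p X)
  have pX: "p \<in> carrier M" "X \<subseteq> carrier M" using insert by auto
  let ?B = "mod_span R M X"
  note N = insert.prems(2)
  note B = mod_span_submodule[OF pX(2)]
  note Bc = submoduleE(1)[OF B, THEN subsetD] and Nc = submoduleE(1)[OF N, THEN subsetD]
  obtain Y' where Y': "finite Y'" "Y' \<subseteq> N \<inter> ?B" "N \<inter> ?B \<subseteq> mod_span R M Y'"
    using insert.IH[OF pX(2) submodule_Int[OF N B]] by blast
  \<comment> \<open>The ideal of coefficients of p. It is taken for an arbitrary submodule C because
    the one for N is compared below with the one for the span of Y.\<close>
  define J where "J C = {r \<in> carrier R. \<exists>b\<in>?B. r \<odot>\<^bsub>M\<^esub> p \<oplus>\<^bsub>M\<^esub> b \<in> C}" for C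
  have J: "ideal (J C) R" if C: "submodule C R M" for C
  proof -
    interpret S: plain_module R "self_mod R" by (rule plain_moduleI, rule R.module_self_mod)
    have "submodule (J C) R (self_mod R)"
    proof (rule S.submoduleI')
      show "J C \<subseteq> carrier (self_mod R)" by (auto simp: J_def)
      show "\<zero>\<^bsub>self_mod R\<^esub> \<in> J C"
        using pX submodule_zero[OF C] submodule_zero[OF B] unfolding J_def by force
      show "r \<oplus>\<^bsub>self_mod R\<^esub> s \<in> J C" if r: "r \<in> J C" and s: "s \<in> J C" for r s
      proof -
        obtain b c where *: "r \<in> carrier R" "s \<in> carrier R" "b \<in> ?B" "c \<in> ?B"
          "r \<odot>\<^bsub>M\<^esub> p \<oplus>\<^bsub>M\<^esub> b \<in> C" "s \<odot>\<^bsub>M\<^esub> p \<oplus>\<^bsub>M\<^esub> c \<in> C"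
          using r s unfolding J_def by blast
        have "(r \<oplus> s) \<odot>\<^bsub>M\<^esub> p \<oplus>\<^bsub>M\<^esub> (b \<oplus>\<^bsub>M\<^esub> c) = (r \<odot>\<^bsub>M\<^esub> p \<oplus>\<^bsub>M\<^esub> b) \<oplus>\<^bsub>M\<^esub> (s \<odot>\<^bsub>M\<^esub> p \<oplus>\<^bsub>M\<^esub> c)"
          using * pX Bc by (simp add: smult_l_distr M.a_ac)
        then show ?thesis unfolding J_def
          using * submoduleE(5)[OF C *(5,6)] submoduleE(5)[OF B *(3,4)] by (auto intro!: bexI[of _ "b \<oplus>\<^bsub>M\<^esub> c"])
      qed
      show "t \<odot>\<^bsub>self_mod R\<^esub> r \<in> J C" if t: "t \<in> carrier R" and r: "r \<in> J C" for t r
      proof -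
        obtain b where *: "r \<in> carrier R" "b \<in> ?B" "r \<odot>\<^bsub>M\<^esub> p \<oplus>\<^bsub>M\<^esub> b \<in> C"
          using r by (auto simp: J_def)
        have "(t \<otimes> r) \<odot>\<^bsub>M\<^esub> p \<oplus>\<^bsub>M\<^esub> t \<odot>\<^bsub>M\<^esub> b = t \<odot>\<^bsub>M\<^esub> (r \<odot>\<^bsub>M\<^esub> p \<oplus>\<^bsub>M\<^esub> b)"
          using * t pX Bc by (simp add: smult_r_distr smult_assoc1)
        then show ?thesis unfolding J_def
          using * t submoduleE(4)[OF C t *(3)] submoduleE(4)[OF B t *(2)] by (auto intro!: bexI[of _ "t \<odot>\<^bsub>M\<^esub> b"])
      qed
    qed
    then show ?thesis by (simp add: R.submodule_self_mod_iff)
  qed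
  obtain T where T: "T \<subseteq> carrier R" "finite T" "J N = Idl T"
    using noetherian_ring.finetely_gen[OF noeth J[OF N]] by blast
  have "\<forall>r\<in>T. \<exists>b\<in>?B. r \<odot>\<^bsub>M\<^esub> p \<oplus>\<^bsub>M\<^esub> b \<in> N"
    using R.genideal_self[OF T(1)] T(3) unfolding J_def by blast
  then obtain b where b: "\<And>r. r \<in> T \<Longrightarrow> b r \<in> ?B" "\<And>r. r \<in> T \<Longrightarrow> r \<odot>\<^bsub>M\<^esub> p \<oplus>\<^bsub>M\<^esub> b r \<in> N"
    by metis
  define Y where "Y = (\<lambda>r. r \<odot>\<^bsub>M\<^esub> p \<oplus>\<^bsub>M\<^esub> b r) ` T \<union> Y'"
  have YN: "Y \<subseteq> N" unfolding Y_def using b Y' by auto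
  have Yc: "Y \<subseteq> carrier M" using YN Nc by blast
  note SY = mod_span_submodule[OF Yc]
  have SYN: "mod_span R M Y \<subseteq> N" by (rule mod_span_minimal[OF N YN])
  have "T \<subseteq> J (mod_span R M Y)"
    using T(1) b(1) mod_span_superset[of Y R M] unfolding J_def Y_def by blast
  then have JN: "J N \<subseteq> J (mod_span R M Y)"
    unfolding T(3) by (rule R.genideal_minimal[OF J[OF SY]])
  have "N \<subseteq> mod_span R M Y"
  proof
    fix n assume n: "n \<in> N"
    then have "n \<in> adjoin R M ?B p" using insert.prems(3) mod_span_insert[OF pX(2,1)] by blast
    then obtain c r where n_eq: "n = c \<oplus>\<^bsub>M\<^esub> r \<odot>\<^bsub>M\<^esub> p" and c: "c \<in> ?B" and r: "r \<in> carrier R"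
      unfolding adjoin_def by blast
    then have "r \<in> J N" unfolding J_def using n pX Bc by (force simp: M.a_comm)
    then obtain c' where c': "c' \<in> ?B" "r \<odot>\<^bsub>M\<^esub> p \<oplus>\<^bsub>M\<^esub> c' \<in> mod_span R M Y"
      using JN unfolding J_def by blast
    \<comment> \<open>Subtracting an element of the span of Y with the same coefficient of p leaves
      an element of N in the span of X, where the induction hypothesis applies.\<close>
    have "n \<ominus>\<^bsub>M\<^esub> (r \<odot>\<^bsub>M\<^esub> p \<oplus>\<^bsub>M\<^esub> c') = c \<ominus>\<^bsub>M\<^esub> c'"
      using n_eq c c'(1) r pX Bc
      by (simp add: a_minus_def M.minus_add M.a_ac M.r_neg M.r_neg1 M.r_neg2)
    moreover have "n \<ominus>\<^bsub>M\<^esub> (r \<odot>\<^bsub>M\<^esub> p \<oplus>\<^bsub>M\<^esub> c') \<in> N" using submodule_minus[OF N n] c' SYN by blast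
    ultimately have "n \<ominus>\<^bsub>M\<^esub> (r \<odot>\<^bsub>M\<^esub> p \<oplus>\<^bsub>M\<^esub> c') \<in> mod_span R M Y'"
      using submodule_minus[OF B c c'(1)] Y'(3) by auto
    moreover have "mod_span R M Y' \<subseteq> mod_span R M Y"
      by (rule mod_span_minimal[OF SY]) (use mod_span_superset[of Y R M] Y_def in blast)
    ultimately have "(n \<ominus>\<^bsub>M\<^esub> (r \<odot>\<^bsub>M\<^esub> p \<oplus>\<^bsub>M\<^esub> c')) \<oplus>\<^bsub>M\<^esub> (r \<odot>\<^bsub>M\<^esub> p \<oplus>\<^bsub>M\<^esub> c') \<in> mod_span R M Y"
      using submoduleE(5)[OF SY _ c'(2)] by blast
    moreover have "(n \<ominus>\<^bsub>M\<^esub> (r \<odot>\<^bsub>M\<^esub> p \<oplus>\<^bsub>M\<^esub> c')) \<oplus>\<^bsub>M\<^esub> (r \<odot>\<^bsub>M\<^esub> p \<oplus>\<^bsub>M\<^esub> c') = n"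
      using Nc[OF n] c'(1) r pX Bc by (simp add: a_minus_def M.a_assoc M.l_neg)
    ultimately show "n \<in> mod_span R M Y" by simp
  qed
  moreover have "finite Y" unfolding Y_def using T Y' by simp
  ultimately show ?case using YN by blast
qed

text \<open>An ideal that is maximal among those containing J and avoiding S is prime: enlarging it
  by either of two elements outside it meets S, and the product of the two meeting points would put
  their product outside it.\<close>

lemma (in noetherian_cring) exists_prime_disjoint:
  assumes J: "ideal J R" and S: "S \<subseteq> carrier R" "\<one> \<in> S" "\<And>s t. s \<in> S \<Longrightarrow> t \<in> S \<Longrightarrow> s \<otimes> t \<in> S"
    and disj: "J \<inter> S = {}"
  obtains P where "primeideal P R" "J \<subseteq> P" "P \<inter> S = {}"
proof -
  interpret M: plain_module R "self_mod R" by (rule plain_moduleI, rule module_self_mod)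
  let ?F = "{K. ideal K R \<and> J \<subseteq> K \<and> K \<inter> S = {}}"
  obtain P where P: "P \<in> ?F" and max: "\<And>K. K \<in> ?F \<Longrightarrow> P \<subseteq> K \<Longrightarrow> K = P"
    by (rule ideal_family_maximal[of ?F]) (use J disj in auto)
  interpret P: ideal P R using P by blast
  have Ps: "submodule P R (self_mod R)" using P by (simp add: submodule_self_mod_iff)
  have meets: "\<exists>p\<in>P. \<exists>r\<in>carrier R. p \<oplus> r \<otimes> a \<in> S" if a: "a \<in> carrier R" "a \<notin> P" for a
  proof -
    let ?K = "adjoin R (self_mod R) P a"
    have K: "submodule ?K R (self_mod R)" "insert a P \<subseteq> ?K"
      using M.adjoin_submodule[OF Ps] M.adjoin_superset[OF Ps] a by simp_all
    then have "?K \<noteq> P" using a by blast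
    then have "?K \<notin> ?F" using max[of ?K] K by blast
    moreover have "ideal ?K R" using K(1) by (simp only: submodule_self_mod_iff)
    moreover have "J \<subseteq> ?K" using K(2) P by blast
    ultimately have "?K \<inter> S \<noteq> {}" by blast
    then show ?thesis by (auto simp: adjoin_def)
  qed
  have "primeideal P R"
  proof (rule primeidealI)
    show "carrier R \<noteq> P" using P S(1,2) by blast
    fix a b assume ab: "a \<in> carrier R" "b \<in> carrier R" "a \<otimes> b \<in> P"
    show "a \<in> P \<or> b \<in> P"
    proof (rule ccontr)
      assume "\<not> (a \<in> P \<or> b \<in> P)"
      then obtain p q r s where *: "p \<in> P" "q \<in> P" "r \<in> carrier R" "s \<in> carrier R"
        "p \<oplus> r \<otimes> a \<in> S" "q \<oplus> s \<otimes> b \<in> S"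
        using meets ab by metis
      \<comment> \<open>Every term of the expanded product has a factor in P, namely p, q or
        ab.\<close>
      have "(p \<oplus> r \<otimes> a) \<otimes> (q \<oplus> s \<otimes> b) = p \<otimes> (q \<oplus> s \<otimes> b) \<oplus> ((r \<otimes> a) \<otimes> q \<oplus> (r \<otimes> s) \<otimes> (a \<otimes> b))"
        using * ab P.Icarr by algebra
      also have "\<dots> \<in> P"
      proof (intro P.a_closed)
        show "p \<otimes> (q \<oplus> s \<otimes> b) \<in> P" using * ab P.Icarr by (intro P.I_r_closed) auto
        show "(r \<otimes> a) \<otimes> q \<in> P" using * ab by (intro P.I_l_closed) auto
        show "(r \<otimes> s) \<otimes> (a \<otimes> b) \<in> P" using * by (intro P.I_l_closed[OF ab(3)]) simp
      qed
      finally show False using S(3)[OF *(5,6)] P by blast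
    qed
  qed (rule P.ideal_axioms cring_axioms)+
  then show ?thesis using that P by blast
qed

section \<open>Local rings of dimension one: primes, socle elements, Nakayama's lemma\<close>

locale local_dim_one = noetherian_cring R for R :: "'a ring" (structure) +
  fixes m :: "'a set"
  assumes m_max: "maximalideal m R"
    and m_unique: "\<And>n. maximalideal n R \<Longrightarrow> n = m"
    and dim: "krull_dim R = 1"
begin

sublocale m: maximalideal m R by (rule m_max)

lemma one_notin_m: "\<one> \<notin> m"
  using m.I_notcarr m.one_imp_carrier by blast

lemma proper_subset_m:
  assumes "ideal J R" "J \<noteq> carrier R" shows "J \<subseteq> m"
proof -
  let ?F = "{K. ideal K R \<and> K \<noteq> carrier R \<and> J \<subseteq> K}"
  obtain K where "K \<in> ?F" and max: "\<And>L. L \<in> ?F \<Longrightarrow> K \<subseteq> L \<Longrightarrow> L = K"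
    by (rule ideal_family_maximal[of ?F]) (use assms in auto)
  then have K: "ideal K R" "K \<noteq> carrier R" "J \<subseteq> K" by auto
  have "maximalideal K R"
    by (rule maximalidealI) (use K max in blast)+
  then show ?thesis using m_unique K by blast
qed

lemma Units_if_notin_m:
  assumes "u \<in> carrier R" "u \<notin> m" shows "u \<in> Units R"
proof -
  have "PIdl u = carrier R"
    using proper_subset_m[OF cgenideal_ideal[OF assms(1)]] cgenideal_self[OF assms(1)] assms(2) by blast
  then obtain v where "v \<in> carrier R" "\<one> = v \<otimes> u"
    using one_closed unfolding cgenideal_def by blast
  then show ?thesis using assms(1) m_comm[of u v] by (auto simp: Units_def)
qed

lemma prime_subset_m: "primeideal P R \<Longrightarrow> P \<subseteq> m"
  using proper_subset_m[of P] primeideal.axioms(1)[of P R] primeideal.I_notcarr[of P R] by blast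

text \<open>A prime containing a nonzerodivisor is not minimal. If it were also different from m, a
  smaller prime Q would complete a chain Q, P, m of length two.\<close>

lemma prime_eq_m:
  assumes P: "primeideal P R" and x: "x \<in> P" "x \<in> nonzerodivisors R"
  shows "P = m"
proof (rule ccontr)
  assume "P \<noteq> m"
  interpret P: primeideal P R by (rule P)
  have xc: "x \<in> carrier R" using x P.Icarr by blast
  have xn: "x [^] (n::nat) \<otimes> r = \<zero> \<Longrightarrow> r \<in> carrier R \<Longrightarrow> r = \<zero>" for n r
  proof (induction n arbitrary: r)
    case (Suc n)
    then have "x [^] n \<otimes> (x \<otimes> r) = \<zero>" using xc by (simp add: m_assoc)
    then have "x \<otimes> r = \<zero>" using Suc xc by blast
    then show ?case using x(2) Suc(3) unfolding nonzerodivisors_def by blast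
  qed simp
  \<comment> \<open>A prime avoiding this multiplicative set avoids the complement of P (take n = 0)
    and x (take s = 1); hence it lies in P and differs from P. Zero is avoided since x is a
    nonzerodivisor.\<close>
  let ?S = "{x [^] (n::nat) \<otimes> s | n s. s \<in> carrier R - P}"
  have "\<zero> \<notin> ?S"
  proof
    assume "\<zero> \<in> ?S"
    then obtain n s where "x [^] (n::nat) \<otimes> s = \<zero>" "s \<in> carrier R - P" by auto
    then show False using xn[of n s] P.zero_closed by auto
  qed
  moreover have "s \<otimes> t \<in> ?S" if st: "s \<in> ?S" "t \<in> ?S" for s t
  proof -
    obtain k n s' t' where *: "s = x [^] (k::nat) \<otimes> s'" "t = x [^] (n::nat) \<otimes> t'"
      "s' \<in> carrier R - P" "t' \<in> carrier R - P"
      using st by blast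
    have "s \<otimes> t = x [^] (k + n) \<otimes> (s' \<otimes> t')" "s' \<otimes> t' \<in> carrier R - P"
      using * xc P.I_prime by (auto simp: nat_pow_mult[symmetric] m_ac)
    then show ?thesis by blast
  qed
  moreover have "x [^] (0::nat) \<otimes> \<one> \<in> ?S" using P.one_imp_carrier P.I_notcarr by blast
  then have "\<one> \<in> ?S" by simp
  moreover have "?S \<subseteq> carrier R" using xc by auto
  ultimately obtain Q where Q: "primeideal Q R" "Q \<inter> ?S = {}"
    using exists_prime_disjoint[OF zeroideal, of ?S] by (metis (no_types, lifting) Int_insert_left_if0 Int_empty_left)
  have "x [^] (1::nat) \<otimes> \<one> \<in> ?S" using P.one_imp_carrier P.I_notcarr by blast
  then have xQ: "x \<notin> Q" using Q(2) xc by auto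
  have "Q \<subseteq> P"
  proof
    fix q assume q: "q \<in> Q"
    then have qc: "q \<in> carrier R" using ideal.Icarr[OF primeideal.axioms(1)[OF Q(1)]] by blast
    show "q \<in> P"
    proof (rule ccontr)
      assume "q \<notin> P"
      then have "x [^] (0::nat) \<otimes> q \<in> ?S" using qc by blast
      then show False using Q(2) q qc by auto
    qed
  qed
  then have QP: "Q \<subset> P" using xQ x by blast
  have Pm: "P \<subset> m" using prime_subset_m[OF P] \<open>P \<noteq> m\<close> by blast
  define c where "c i = (if i = 0 then Q else if i = 1 then P else m)" for i :: nat
  have "\<forall>i\<le>2. primeideal (c i) R"
    using Q P maximalideal_prime[OF m_max] by (simp add: c_def)
  moreover have "\<forall>i<2. c i \<subset> c (Suc i)"
    using QP Pm by (simp add: c_def less_2_cases_iff)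
  ultimately have "enat 2 \<le> krull_dim R"
    unfolding krull_dim_def by (intro SUP_upper) blast
  then show False using dim by (simp add: one_enat_def)
qed

text \<open>By \<open>prime_eq_m\<close> the only prime containing x is m, so m is contained in the
  radical of xR.\<close>

lemma power_in_PIdl:
  assumes x: "x \<in> m" "x \<in> nonzerodivisors R" and r: "r \<in> m"
  obtains n :: nat where "r [^] n \<in> PIdl x"
proof (rule ccontr)
  assume "\<not> thesis"
  then have "PIdl x \<inter> range (\<lambda>n::nat. r [^] n) = {}" using that by blast
  moreover have rc: "r \<in> carrier R" "x \<in> carrier R" using r x m.Icarr by auto
  ultimately obtain P where P: "primeideal P R" "PIdl x \<subseteq> P" "P \<inter> range (\<lambda>n::nat. r [^] n) = {}"
    by (rule_tac exists_prime_disjoint[OF cgenideal_ideal, of x "range (\<lambda>n::nat. r [^] n)"])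
      (auto simp: nat_pow_mult intro: range_eqI[of _ _ "0::nat"])
  have "P = m" by (rule prime_eq_m[OF P(1) _ x(2)]) (use P cgenideal_self rc in blast)
  moreover have "r [^] (1::nat) = r" using rc by simp
  ultimately show False using P(3) r by (metis disjoint_iff rangeI)
qed

text \<open>A maximal member among the annihilators, modulo A, of the multiples of y outside A is
  prime, as for associated primes. It contains the nonzerodivisor x and so equals m. In effect R/m
  embeds into (A + Ry)/A.\<close>

lemma socle_element:
  fixes M :: "('a, 'b) module"
  assumes M: "module R M" and A: "submodule A R M" and y: "y \<in> carrier M" "y \<notin> A"
    and x: "x \<in> m" "x \<in> nonzerodivisors R" "x \<odot>\<^bsub>M\<^esub> y \<in> A"
  obtains r where "r \<in> carrier R" "r \<odot>\<^bsub>M\<^esub> y \<notin> A" "colon R M A (r \<odot>\<^bsub>M\<^esub> y) = m"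
proof -
  interpret M: plain_module R M by (rule plain_moduleI, rule M)
  have xc: "x \<in> carrier R" using x m.Icarr by blast
  let ?F = "{colon R M A (r \<odot>\<^bsub>M\<^esub> y) | r. r \<in> carrier R \<and> r \<odot>\<^bsub>M\<^esub> y \<notin> A}"
  have "colon R M A (\<one> \<odot>\<^bsub>M\<^esub> y) \<in> ?F" using y by force
  then obtain J where J: "J \<in> ?F" and max: "\<And>K. K \<in> ?F \<Longrightarrow> J \<subseteq> K \<Longrightarrow> K = J"
    by (rule_tac ideal_family_maximal[of ?F]) (use M.colon_ideal[OF A] y in auto)
  obtain r where r: "r \<in> carrier R" "r \<odot>\<^bsub>M\<^esub> y \<notin> A" "J = colon R M A (r \<odot>\<^bsub>M\<^esub> y)"
    using J by blast
  define z where "z = r \<odot>\<^bsub>M\<^esub> y"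
  have z: "z \<in> carrier M" unfolding z_def using r y by simp
  have "primeideal J R"
  proof (rule primeidealI)
    show "ideal J R" using M.colon_ideal[OF A] r y by simp
    show "cring R" by (rule cring_axioms)
    have "\<one> \<notin> J" using r y by (simp add: colon_def)
    then show "carrier R \<noteq> J" by blast
    fix a b assume ab: "a \<in> carrier R" "b \<in> carrier R" "a \<otimes> b \<in> J"
    show "a \<in> J \<or> b \<in> J"
    proof (rule disjCI)
      assume b: "b \<notin> J"
      have bz: "b \<odot>\<^bsub>M\<^esub> z = (b \<otimes> r) \<odot>\<^bsub>M\<^esub> y" using ab r y by (simp add: z_def M.smult_assoc1)
      then have "b \<odot>\<^bsub>M\<^esub> z \<notin> A" using b ab r unfolding z_def colon_def by simp
      then have "colon R M A (b \<odot>\<^bsub>M\<^esub> z) \<in> ?F" unfolding bz using ab r by blast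
      moreover have "c \<odot>\<^bsub>M\<^esub> (b \<odot>\<^bsub>M\<^esub> z) = b \<odot>\<^bsub>M\<^esub> (c \<odot>\<^bsub>M\<^esub> z)" if "c \<in> carrier R" for c
        using that ab z by (simp add: M.smult_assoc1[symmetric] m_comm)
      then have "J \<subseteq> colon R M A (b \<odot>\<^bsub>M\<^esub> z)"
        using r ab M.submoduleE(4)[OF A] unfolding z_def[symmetric] colon_def by auto
      ultimately have "colon R M A (b \<odot>\<^bsub>M\<^esub> z) = J" by (rule max)
      moreover have "a \<in> colon R M A (b \<odot>\<^bsub>M\<^esub> z)"
        using ab r z unfolding z_def[symmetric] colon_def by (simp add: M.smult_assoc1)
      ultimately show "a \<in> J" by blast
    qed
  qed
  moreover have "x \<odot>\<^bsub>M\<^esub> z = r \<odot>\<^bsub>M\<^esub> (x \<odot>\<^bsub>M\<^esub> y)"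
    using r y xc by (simp add: z_def M.smult_assoc1[symmetric] m_comm)
  then have "x \<in> J" using r x(3) xc M.submoduleE(4)[OF A] unfolding z_def[symmetric] colon_def by simp
  ultimately have "J = m" using x by (intro prime_eq_m)
  then show ?thesis using that r by blast
qed

text \<open>Generators are eliminated one by one: p = n + x(c + rp) is solved for p with the unit 1
  - xr, and substitution into the relations of the other generators keeps their shape over the
  smaller set. N need not lie in the span of X.\<close>

lemma nakayama:
  fixes M :: "('a, 'b) module"
  assumes M: "module R M" and N: "submodule N R M" and x: "x \<in> m"
    and X: "finite X" "X \<subseteq> carrier M"
    and gen: "\<And>y. y \<in> X \<Longrightarrow> \<exists>n\<in>N. \<exists>b\<in>mod_span R M X. y = n \<oplus>\<^bsub>M\<^esub> x \<odot>\<^bsub>M\<^esub> b"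
  shows "X \<subseteq> N"
  using X gen
proof (induction X)
  case empty
  then show ?case by simp
next
  case (insert p X)
  interpret M: plain_module R M by (rule plain_moduleI, rule M)
  have pX: "p \<in> carrier M" "X \<subseteq> carrier M" using insert by auto
  have xc: "x \<in> carrier R" using x m.Icarr by blast
  let ?B = "mod_span R M X"
  note B = M.mod_span_submodule[OF pX(2)]
  note Bc = M.submoduleE(1)[OF B, THEN subsetD] and Nc = M.submoduleE(1)[OF N, THEN subsetD]
  have span: "\<exists>n\<in>N. \<exists>c\<in>?B. \<exists>r\<in>carrier R. y = n \<oplus>\<^bsub>M\<^esub> x \<odot>\<^bsub>M\<^esub> (c \<oplus>\<^bsub>M\<^esub> r \<odot>\<^bsub>M\<^esub> p)" if y: "y \<in> insert p X" for y
    using insert.prems(2)[OF y] M.mod_span_insert[OF pX(2,1)] unfolding adjoin_def by blast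
  obtain n c r where p: "n \<in> N" "c \<in> ?B" "r \<in> carrier R"
    "p = n \<oplus>\<^bsub>M\<^esub> x \<odot>\<^bsub>M\<^esub> (c \<oplus>\<^bsub>M\<^esub> r \<odot>\<^bsub>M\<^esub> p)"
    using span[of p] by blast
  \<comment> \<open>A unit, since x lies in m and R is local.\<close>
  define u where "u = \<one> \<ominus> x \<otimes> r"
  have uc: "u \<in> carrier R" using xc p by (simp add: u_def)
  have "u \<notin> m"
  proof
    assume "u \<in> m"
    then have "u \<oplus> x \<otimes> r \<in> m" using m.I_r_closed[OF x p(3)] by simp
    moreover have "u \<oplus> x \<otimes> r = \<one>" unfolding u_def using xc p by algebra
    ultimately show False using one_notin_m by simp
  qed
  then obtain v where v: "v \<in> carrier R" "v \<otimes> u = \<one>"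
    using Units_if_notin_m[OF uc] by (auto simp: Units_def)
  have up: "u \<odot>\<^bsub>M\<^esub> p = n \<oplus>\<^bsub>M\<^esub> x \<odot>\<^bsub>M\<^esub> c"
  proof -
    have "u \<odot>\<^bsub>M\<^esub> p = p \<ominus>\<^bsub>M\<^esub> (x \<otimes> r) \<odot>\<^bsub>M\<^esub> p"
      using xc p(3) pX by (simp add: u_def a_minus_def M.smult_l_distr M.smult_l_minus)
    also have "\<dots> = (n \<oplus>\<^bsub>M\<^esub> x \<odot>\<^bsub>M\<^esub> c \<oplus>\<^bsub>M\<^esub> (x \<otimes> r) \<odot>\<^bsub>M\<^esub> p) \<ominus>\<^bsub>M\<^esub> (x \<otimes> r) \<odot>\<^bsub>M\<^esub> p"
      by (subst p(4)) (use xc p(1-3) pX Bc Nc in \<open>simp add: M.smult_r_distr M.smult_assoc1 M.M.a_assoc\<close>)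
    also have "\<dots> = n \<oplus>\<^bsub>M\<^esub> x \<odot>\<^bsub>M\<^esub> c"
      using xc p(1-3) pX Bc Nc by (simp add: a_minus_def M.M.a_assoc M.M.r_neg)
    finally show ?thesis .
  qed
  have p': "p = v \<odot>\<^bsub>M\<^esub> n \<oplus>\<^bsub>M\<^esub> x \<odot>\<^bsub>M\<^esub> (v \<odot>\<^bsub>M\<^esub> c)"
  proof -
    have "p = v \<odot>\<^bsub>M\<^esub> (u \<odot>\<^bsub>M\<^esub> p)" using v uc pX by (simp add: M.smult_assoc1[symmetric])
    then show ?thesis using up v xc p pX Bc Nc
      by (simp add: M.smult_r_distr M.smult_assoc1[symmetric] m_comm)
  qed
  have "X \<subseteq> N"
  proof (rule insert.IH[OF pX(2)])
    fix y assume "y \<in> X"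
    then obtain k d s where y: "k \<in> N" "d \<in> ?B" "s \<in> carrier R"
      "y = k \<oplus>\<^bsub>M\<^esub> x \<odot>\<^bsub>M\<^esub> (d \<oplus>\<^bsub>M\<^esub> s \<odot>\<^bsub>M\<^esub> p)"
      using span[of y] by blast
    let ?k = "k \<oplus>\<^bsub>M\<^esub> (x \<otimes> s \<otimes> v) \<odot>\<^bsub>M\<^esub> n" and ?d = "d \<oplus>\<^bsub>M\<^esub> (s \<otimes> x \<otimes> v) \<odot>\<^bsub>M\<^esub> c"
    have "y = k \<oplus>\<^bsub>M\<^esub> x \<odot>\<^bsub>M\<^esub> (d \<oplus>\<^bsub>M\<^esub> s \<odot>\<^bsub>M\<^esub> (v \<odot>\<^bsub>M\<^esub> n \<oplus>\<^bsub>M\<^esub> x \<odot>\<^bsub>M\<^esub> (v \<odot>\<^bsub>M\<^esub> c)))"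
      using y(4) p' by simp
    also have "\<dots> = ?k \<oplus>\<^bsub>M\<^esub> x \<odot>\<^bsub>M\<^esub> ?d"
      using y p xc v Bc Nc
      by (simp add: M.smult_r_distr M.smult_assoc1[symmetric] M.M.a_ac m_ac)
    finally have "y = ?k \<oplus>\<^bsub>M\<^esub> x \<odot>\<^bsub>M\<^esub> ?d" .
    moreover have "?k \<in> N" "?d \<in> ?B"
      using y p xc v by (auto intro!: M.submoduleE(4,5)[OF N] M.submoduleE(4,5)[OF B])
    ultimately show "\<exists>n\<in>N. \<exists>b\<in>?B. y = n \<oplus>\<^bsub>M\<^esub> x \<odot>\<^bsub>M\<^esub> b" by blast
  qed
  then have "?B \<subseteq> N" by (rule mod_span_minimal[OF N])
  then have "p \<in> N" by (subst p') (use p v xc in \<open>auto intro!: M.submoduleE(4,5)[OF N]\<close>)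
  then show ?case using \<open>X \<subseteq> N\<close> by blast
qed

end

section \<open>Free modules\<close>

text \<open>Tuples are functions on all natural numbers that vanish from n on. Thus equality of
  tuples is equality of functions, and R^n is literally contained in R^(n+1), which is used when a
  coordinate is added.\<close>

definition free_mod :: "'a ring \<Rightarrow> nat \<Rightarrow> ('a, nat \<Rightarrow> 'a) module" where
  "free_mod R n = \<lparr>carrier = {t. \<forall>i. t i \<in> carrier R \<and> (n \<le> i \<longrightarrow> t i = \<zero>\<^bsub>R\<^esub>)},
     mult = undefined, one = undefined, zero = (\<lambda>i. \<zero>\<^bsub>R\<^esub>),
     add = (\<lambda>s t i. s i \<oplus>\<^bsub>R\<^esub> t i), smult = (\<lambda>r t i. r \<otimes>\<^bsub>R\<^esub> t i)\<rparr>"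

lemma free_mod_simps [simp]:
  "t \<in> carrier (free_mod R n) \<longleftrightarrow> (\<forall>i. t i \<in> carrier R \<and> (n \<le> i \<longrightarrow> t i = \<zero>\<^bsub>R\<^esub>))"
  "zero (free_mod R n) = (\<lambda>i. \<zero>\<^bsub>R\<^esub>)" "add (free_mod R n) = (\<lambda>s t i. s i \<oplus>\<^bsub>R\<^esub> t i)"
  "smult (free_mod R n) = (\<lambda>r t i. r \<otimes>\<^bsub>R\<^esub> t i)"
  by (simp_all add: free_mod_def)

definition unit_vec :: "'a ring \<Rightarrow> nat \<Rightarrow> nat \<Rightarrow> 'a" where
  "unit_vec R i = (\<lambda>j. if j = i then \<one>\<^bsub>R\<^esub> else \<zero>\<^bsub>R\<^esub>)"

text \<open>The sum of the t_i p_i for i < n. The recursion splits off the last coordinate by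
  definition, and entries from n on may be arbitrary.\<close>

primrec lincomb :: "('a, 'b) module \<Rightarrow> (nat \<Rightarrow> 'a) \<Rightarrow> (nat \<Rightarrow> 'b) \<Rightarrow> nat \<Rightarrow> 'b" where
  "lincomb M t p 0 = \<zero>\<^bsub>M\<^esub>"
| "lincomb M t p (Suc n) = lincomb M t p n \<oplus>\<^bsub>M\<^esub> t n \<odot>\<^bsub>M\<^esub> p n"

lemma (in plain_cring) free_mod_module: "module R (free_mod R n)"
proof (rule moduleI)
  show "abelian_group (free_mod R n)"
  proof (rule abelian_groupI)
    fix t assume t: "t \<in> carrier (free_mod R n)"
    then show "\<exists>s\<in>carrier (free_mod R n). s \<oplus>\<^bsub>free_mod R n\<^esub> t = \<zero>\<^bsub>free_mod R n\<^esub>"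
      by (intro bexI[of _ "\<lambda>i. \<ominus> t i"]) (auto simp: l_neg)
  qed (auto simp: a_ac fun_eq_iff)
qed (auto simp: l_distr r_distr m_assoc cring_axioms)

lemma (in plain_cring) unit_vec_closed: "i < n \<Longrightarrow> unit_vec R i \<in> carrier (free_mod R n)"
  by (auto simp: unit_vec_def)

context plain_module
begin

lemma lincomb_in_submodule:
  "submodule N R M \<Longrightarrow> (\<And>i. i < n \<Longrightarrow> t i \<in> carrier R) \<Longrightarrow> (\<And>i. i < n \<Longrightarrow> p i \<in> N) \<Longrightarrow> lincomb M t p n \<in> N"
proof (induction n)
  case 0
  then show ?case by (simp add: submodule_zero)
next
  case (Suc n)
  then show ?case by (auto intro!: submoduleE(4,5)[OF Suc.prems(1)])
qed

lemma lincomb_closed: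
  "(\<And>i. i < n \<Longrightarrow> t i \<in> carrier R) \<Longrightarrow> (\<And>i. i < n \<Longrightarrow> p i \<in> carrier M) \<Longrightarrow> lincomb M t p n \<in> carrier M"
  by (rule lincomb_in_submodule[OF carrier_is_submodule])

lemma lincomb_cong:
  "(\<And>i. i < n \<Longrightarrow> t i = s i) \<Longrightarrow> (\<And>i. i < n \<Longrightarrow> p i = q i) \<Longrightarrow> lincomb M t p n = lincomb M s q n"
  by (induction n) auto

lemma lincomb_zero:
  "(\<And>i. i < n \<Longrightarrow> p i \<in> carrier M) \<Longrightarrow> (\<And>i. i < n \<Longrightarrow> t i = \<zero>) \<Longrightarrow> lincomb M t p n = \<zero>\<^bsub>M\<^esub>"
  by (induction n) auto

lemma lincomb_add:
  assumes "\<And>i. i < n \<Longrightarrow> p i \<in> carrier M" "\<And>i. i < n \<Longrightarrow> s i \<in> carrier R" "\<And>i. i < n \<Longrightarrow> t i \<in> carrier R"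
  shows "lincomb M (\<lambda>i. s i \<oplus> t i) p n = lincomb M s p n \<oplus>\<^bsub>M\<^esub> lincomb M t p n"
  using assms
proof (induction n)
  case (Suc n)
  then have "lincomb M s p n \<in> carrier M" "lincomb M t p n \<in> carrier M"
    by (auto intro!: lincomb_closed)
  with Suc show ?case by (simp add: smult_l_distr M.a_ac)
qed simp

lemma lincomb_smult:
  assumes "\<And>i. i < n \<Longrightarrow> p i \<in> carrier M" "\<And>i. i < n \<Longrightarrow> s i \<in> carrier R" "r \<in> carrier R"
  shows "lincomb M (\<lambda>i. r \<otimes> s i) p n = r \<odot>\<^bsub>M\<^esub> lincomb M s p n"
  using assms
proof (induction n)
  case (Suc n)
  then have "lincomb M s p n \<in> carrier M" by (auto intro!: lincomb_closed)
  with Suc show ?case by (simp add: smult_r_distr smult_assoc1)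
qed simp

lemma lincomb_smult_right:
  assumes "\<And>i. i < n \<Longrightarrow> p i \<in> carrier M" "\<And>i. i < n \<Longrightarrow> s i \<in> carrier R" "r \<in> carrier R"
  shows "lincomb M s (\<lambda>i. r \<odot>\<^bsub>M\<^esub> p i) n = r \<odot>\<^bsub>M\<^esub> lincomb M s p n"
  using assms
proof (induction n)
  case (Suc n)
  then have "lincomb M s p n \<in> carrier M" by (auto intro!: lincomb_closed)
  with Suc show ?case by (simp add: smult_r_distr smult_assoc1[symmetric] R.m_comm)
qed simp

lemma lincomb_lin:
  "(\<And>i. i < n \<Longrightarrow> p i \<in> carrier M) \<Longrightarrow> lin R (free_mod R n) (carrier (free_mod R n)) M (\<lambda>t. lincomb M t p n)"
  by (rule linI) (auto simp: lincomb_add lincomb_smult intro!: lincomb_closed)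

lemma lincomb_unit_vec:
  assumes "\<And>i. i < n \<Longrightarrow> p i \<in> carrier M" "i < n"
  shows "lincomb M (unit_vec R i) p n = p i"
  using assms
proof (induction n)
  case (Suc n)
  show ?case
  proof (cases "i = n")
    case True
    then have "lincomb M (unit_vec R i) p n = \<zero>\<^bsub>M\<^esub>"
      using Suc.prems by (intro lincomb_zero) (auto simp: unit_vec_def)
    then show ?thesis using True Suc.prems by (simp add: unit_vec_def)
  next
    case False
    then have "lincomb M (unit_vec R i) p n = p i" using Suc by simp
    then show ?thesis using False Suc.prems by (simp add: unit_vec_def)
  qed
qed simp

end

lemma (in module_pair) lin_lincomb:
  assumes f: "lin R P A E f" and A: "submodule A R P"
    and "\<And>i. i < n \<Longrightarrow> t i \<in> carrier R" "\<And>i. i < n \<Longrightarrow> p i \<in> A"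
  shows "f (lincomb P t p n) = lincomb E t (\<lambda>i. f (p i)) n"
  using assms(3,4)
proof (induction n)
  case 0
  then show ?case by (simp add: lin_zero[OF f A])
next
  case (Suc n)
  then have "lincomb P t p n \<in> A" by (intro P.lincomb_in_submodule[OF A]) auto
  with Suc show ?case by (simp add: lin_add[OF f] lin_smult[OF f] P.submoduleE(4)[OF A])
qed

lemma (in plain_cring) lincomb_unit_vecs:
  assumes "t \<in> carrier (free_mod R n)"
  shows "lincomb (free_mod R n) t (unit_vec R) n = t"
proof -
  have "lincomb (free_mod R n) t (unit_vec R) k = (\<lambda>i. if i < k then t i else \<zero>)" if "k \<le> n" for k
    using that by (induction k) (use assms in \<open>auto simp: unit_vec_def fun_eq_iff less_Suc_eq\<close>)
  then show ?thesis using assms by (auto simp: fun_eq_iff)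
qed

lemma (in plain_cring) free_mod_generated:
  assumes "submodule N R (free_mod R n)" "unit_vec R ` {..<n} \<subseteq> N"
  shows "carrier (free_mod R n) \<subseteq> N"
proof
  fix t assume t: "t \<in> carrier (free_mod R n)"
  interpret F: plain_module R "free_mod R n" by (rule plain_moduleI, rule free_mod_module)
  show "t \<in> N"
    using F.lincomb_in_submodule[OF assms(1), of n t "unit_vec R"] assms(2) t lincomb_unit_vecs[OF t] by auto
qed

text \<open>A finite generating set becomes a surjection from R^n: its image is a submodule
  containing the generators.\<close>

lemma (in plain_module) fg_module_lincomb:
  assumes "fg_module R M"
  obtains n p where "\<And>i. i < (n::nat) \<Longrightarrow> p i \<in> carrier M"
    "\<And>y. y \<in> carrier M \<Longrightarrow> \<exists>t\<in>carrier (free_mod R n). y = lincomb M t p n"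
proof -
  obtain X where X: "finite X" "X \<subseteq> carrier M" "mod_span R M X = carrier M"
    using assms unfolding fg_module_def by blast
  obtain n :: nat and p where Xp: "X = p ` {i. i < n}"
    using finite_imp_nat_seg_image_inj_on[OF X(1)] by blast
  have p: "\<And>i. i < n \<Longrightarrow> p i \<in> carrier M" using X(2) Xp by blast
  let ?F = "free_mod R n" and ?L = "\<lambda>t. lincomb M t p n"
  interpret FM: module_pair R ?F M
    by (rule module_pairI[OF R.free_mod_module module_axioms])
  have L: "lin R ?F (carrier ?F) M ?L" by (rule lincomb_lin) (rule p)
  have "submodule (?L ` carrier ?F) R M"
  proof (rule submoduleI')
    show "?L ` carrier ?F \<subseteq> carrier M" using lin_closed[OF L] by blast
    show "\<zero>\<^bsub>M\<^esub> \<in> ?L ` carrier ?F"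
      using FM.lin_zero[OF L FM.P.carrier_is_submodule] FM.P.M.zero_closed by (metis image_eqI)
    show "a \<oplus>\<^bsub>M\<^esub> b \<in> ?L ` carrier ?F" if "a \<in> ?L ` carrier ?F" "b \<in> ?L ` carrier ?F" for a b
      using that lin_add[OF L, symmetric] FM.P.M.add.m_closed by (smt (verit) imageE image_eqI)
    show "r \<odot>\<^bsub>M\<^esub> a \<in> ?L ` carrier ?F" if r: "r \<in> carrier R" and a: "a \<in> ?L ` carrier ?F" for r a
    proof -
      obtain t where t: "t \<in> carrier ?F" "a = ?L t" using a by blast
      show ?thesis
        by (rule image_eqI[OF _ FM.P.smult_closed[OF r t(1)]]) (simp only: t(2) lin_smult[OF L r t(1)])
    qed
  qed
  moreover have "X \<subseteq> ?L ` carrier ?F"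
  proof
    fix y assume "y \<in> X"
    then obtain i where i: "y = p i" "i < n" using Xp by blast
    show "y \<in> ?L ` carrier ?F"
      by (rule image_eqI[OF _ R.unit_vec_closed[OF i(2)]]) (simp add: i p lincomb_unit_vec)
  qed
  ultimately have "carrier M \<subseteq> ?L ` carrier ?F" using mod_span_minimal X(3) by metis
  then show ?thesis using that p by blast
qed

text \<open>P is R^n modulo the relations among the p_i, so p_i \<mapsto> w_i defines a map once
  each such relation also holds for the w_i.\<close>

lemma (in plain_cring) lin_of_lincomb:
  fixes P :: "('a, 'b) module" and E :: "('a, 'c) module"
  assumes P: "module R P" and E: "module R E"
    and p: "\<And>i. i < n \<Longrightarrow> p i \<in> carrier P" and w: "\<And>i. i < n \<Longrightarrow> w i \<in> carrier E"
    and gen: "\<And>y. y \<in> carrier P \<Longrightarrow> \<exists>t\<in>carrier (free_mod R n). y = lincomb P t p n"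
    and rel: "\<And>t. t \<in> carrier (free_mod R n) \<Longrightarrow> lincomb P t p n = \<zero>\<^bsub>P\<^esub> \<Longrightarrow> lincomb E t w n = \<zero>\<^bsub>E\<^esub>"
  obtains f where "lin R P (carrier P) E f"
    "\<And>t. t \<in> carrier (free_mod R n) \<Longrightarrow> f (lincomb P t p n) = lincomb E t w n"
proof -
  interpret PE: module_pair R P E by (rule module_pairI; fact)
  interpret F: plain_module R "free_mod R n" by (rule plain_moduleI, rule free_mod_module)
  have Lp: "lin R (free_mod R n) (carrier (free_mod R n)) P (\<lambda>t. lincomb P t p n)"
    by (rule PE.P.lincomb_lin) (rule p)
  have Lw: "lin R (free_mod R n) (carrier (free_mod R n)) E (\<lambda>t. lincomb E t w n)"
    by (rule PE.E.lincomb_lin) (rule w)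
  define G where "G u v \<longleftrightarrow> (\<exists>t\<in>carrier (free_mod R n). u = lincomb P t p n \<and> v = lincomb E t w n)" for u v
  obtain f where f: "lin R P (carrier P) E f" "\<And>u v. u \<in> carrier P \<Longrightarrow> G u v \<longleftrightarrow> f u = v"
  proof (rule PE.lin_of_graph[of "carrier P" G])
    show "submodule (carrier P) R P" by (rule PE.P.carrier_is_submodule)
    show "\<exists>v. G u v" if "u \<in> carrier P" for u using gen[OF that] unfolding G_def by blast
    show "v \<in> carrier E" if "G u v" for u v using that lin_closed[OF Lw] unfolding G_def by metis
    show "G (u \<oplus>\<^bsub>P\<^esub> u') (v \<oplus>\<^bsub>E\<^esub> v')" if "G u v" "G u' v'" for u v u' v'
      using that lin_add[OF Lp] lin_add[OF Lw] F.M.add.m_closed unfolding G_def by metis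
    show "G (r \<odot>\<^bsub>P\<^esub> u) (r \<odot>\<^bsub>E\<^esub> v)" if "r \<in> carrier R" "G u v" for r u v
      using that lin_smult[OF Lp] lin_smult[OF Lw] F.smult_closed unfolding G_def by metis
    show "v = \<zero>\<^bsub>E\<^esub>" if "G \<zero>\<^bsub>P\<^esub> v" for v using that rel unfolding G_def by metis
  qed blast
  show ?thesis
  proof (rule that[OF f(1)])
    fix t assume t: "t \<in> carrier (free_mod R n)"
    then have "G (lincomb P t p n) (lincomb E t w n)" unfolding G_def by blast
    then show "f (lincomb P t p n) = lincomb E t w n" by (rule iffD1[OF f(2)[OF lin_closed[OF Lp t]]])
  qed
qed

section \<open>Vanishing of Ext for a finite injective resolution\<close>

locale injectively_resolved = local_dim_one R m for R :: "'a ring" (structure) and m +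
  fixes x :: 'a and W :: "'a set" and \<epsilon> :: "'a \<Rightarrow> 'e"
    and E :: "nat \<Rightarrow> ('a, 'e) module" and d :: "nat \<Rightarrow> 'e \<Rightarrow> 'e" and N :: nat
  assumes x: "x \<in> m" "x \<in> nonzerodivisors R"
    and W: "ideal W R"
    and res: "injective_resolution R (ideal_mod R W) \<epsilon> E d"
    and finite_res: "\<And>i. N < i \<Longrightarrow> carrier (E i) = {\<zero>\<^bsub>E i\<^esub>}"
begin

lemma E_injective: "injective_mod R (E i)"
  using res by (simp add: injective_resolution_def)

sublocale E: plain_module R "E i" for i
  using E_injective by (intro plain_moduleI) (simp add: injective_mod_def)

sublocale EE: module_pair R "E i" "E j" for i j
  by unfold_locales

sublocale RM: plain_module R "self_mod R"
  by (rule plain_moduleI, rule module_self_mod)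

sublocale RE: module_pair R "self_mod R" "E i" for i
  by unfold_locales

lemma x_closed: "x \<in> carrier R"
  using x m.Icarr by blast

lemma x_cancel: "r \<in> carrier R \<Longrightarrow> x \<otimes> r = \<zero> \<Longrightarrow> r = \<zero>"
  using nzd_zero[OF x(2)] .

lemma W_submodule: "submodule W R (self_mod R)"
  using W by (simp add: submodule_self_mod_iff)

lemma W_closed: "w \<in> W \<Longrightarrow> w \<in> carrier R"
  using ideal.Icarr[OF W] .

lemma d_lin: "lin R (E i) (carrier (E i)) (E (Suc i)) (d i)"
  using res by (simp add: injective_resolution_def mod_hom_iff_lin)

lemma d_image: "d i ` carrier (E i) = {e \<in> carrier (E (Suc i)). d (Suc i) e = \<zero>\<^bsub>E (Suc (Suc i))\<^esub>}"
  using res by (simp only: injective_resolution_def)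

lemma d_exact:
  assumes "e \<in> carrier (E (Suc i))" "d (Suc i) e = \<zero>\<^bsub>E (Suc (Suc i))\<^esub>"
  shows "\<exists>e'\<in>carrier (E i). d i e' = e"
proof -
  have "e \<in> d i ` carrier (E i)" unfolding d_image using assms by simp
  then show ?thesis by auto
qed

lemma d_d: "e \<in> carrier (E i) \<Longrightarrow> d (Suc i) (d i e) = \<zero>\<^bsub>E (Suc (Suc i))\<^esub>"
proof -
  assume "e \<in> carrier (E i)"
  then have "d i e \<in> d i ` carrier (E i)" by simp
  then show ?thesis unfolding d_image by simp
qed

lemma eps_lin: "lin R (self_mod R) W (E 0) \<epsilon>"
  using res by (simp add: injective_resolution_def lin_def ideal_mod_def)

lemma eps_inj: "inj_on \<epsilon> W"
  using res by (simp add: injective_resolution_def ideal_mod_def)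

lemma eps_exact: "e \<in> carrier (E 0) \<Longrightarrow> d 0 e = \<zero>\<^bsub>E 1\<^esub> \<longleftrightarrow> e \<in> \<epsilon> ` W"
proof -
  have "\<epsilon> ` W = {e \<in> carrier (E 0). d 0 e = \<zero>\<^bsub>E 1\<^esub>}"
    using res unfolding injective_resolution_def ideal_mod_def by simp
  then show "e \<in> carrier (E 0) \<Longrightarrow> ?thesis" by blast
qed

lemma d_closed [simp]: "e \<in> carrier (E i) \<Longrightarrow> d i e \<in> carrier (E (Suc i))"
  using lin_closed[OF d_lin] .

text \<open>Elements of E i killed by an ideal K are the maps R/K -> E i. Multiplication by s embeds
  R/(J : s) into R/J, and injectivity extends the map given by b along this embedding.\<close>

lemma solve_linear_equation:
  assumes J: "ideal J R" and s: "s \<in> carrier R" and b: "b \<in> carrier (E i)"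
    and compat: "\<And>r. r \<in> carrier R \<Longrightarrow> r \<otimes> s \<in> J \<Longrightarrow> r \<odot>\<^bsub>E i\<^esub> b = \<zero>\<^bsub>E i\<^esub>"
  obtains e where "e \<in> carrier (E i)" "\<And>j. j \<in> J \<Longrightarrow> j \<odot>\<^bsub>E i\<^esub> e = \<zero>\<^bsub>E i\<^esub>" "s \<odot>\<^bsub>E i\<^esub> e = b"
proof -
  have Js: "submodule J R (self_mod R)" using J by (simp add: submodule_self_mod_iff)
  have sc: "s \<in> carrier (self_mod R)" using s by simp
  obtain f where f: "lin R (self_mod R) (adjoin R (self_mod R) J s) (E i) f"
    "\<And>u. u \<in> J \<Longrightarrow> f u = \<zero>\<^bsub>E i\<^esub>" "f s = b"
    by (rule RE.lin_adjoin[OF Js sc RE.lin_zero_fun b]) (use compat in auto)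
  have "ideal (adjoin R (self_mod R) J s) R"
    using RM.adjoin_submodule[OF Js sc] by (simp add: submodule_self_mod_iff)
  from RE.injective_mod_Baer[OF E_injective this f(1)] obtain e
    where e: "e \<in> carrier (E i)" "\<And>j. j \<in> adjoin R (self_mod R) J s \<Longrightarrow> f j = j \<odot>\<^bsub>E i\<^esub> e" by blast
  have "insert s J \<subseteq> adjoin R (self_mod R) J s" by (rule RM.adjoin_superset[OF Js sc])
  then show ?thesis using that[OF e(1)] e(2) f(2,3) by (metis insert_subset subsetD)
qed

definition lifts :: "nat \<Rightarrow> bool" where
  "lifts i \<longleftrightarrow> (\<forall>J c. ideal J R \<longrightarrow> x \<in> J \<longrightarrow> c \<in> carrier (E (Suc i)) \<longrightarrow>
     d (Suc i) c = \<zero>\<^bsub>E (Suc (Suc i))\<^esub> \<longrightarrow> (\<forall>r\<in>J. r \<odot>\<^bsub>E (Suc i)\<^esub> c = \<zero>\<^bsub>E (Suc i)\<^esub>) \<longrightarrow>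
     (\<exists>e\<in>carrier (E i). (\<forall>r\<in>J. r \<odot>\<^bsub>E i\<^esub> e = \<zero>\<^bsub>E i\<^esub>) \<and> d i e = c))"

text \<open>\<open>lifts i\<close> says that \<open>Ext\<^sup>i\<^sup>+\<^sup>1(R/J, W) = 0\<close> whenever \<open>x \<in> J\<close>; for \<open>i \<ge> 1\<close> this is proved by downward
  induction along the resolution.  The case \<open>J = (x)\<close> holds since \<open>R/(x)\<close> has projective dimension one; the
  residue field is handled by embedding it into \<open>R/(x)\<close>, and the general case by peeling off socle elements.\<close>

lemma lifts_PIdl_x:
  assumes c: "c \<in> carrier (E (Suc (Suc i)))" "d (Suc (Suc i)) c = \<zero>\<^bsub>E (Suc (Suc (Suc i)))\<^esub>"
    and xc: "x \<odot>\<^bsub>E (Suc (Suc i))\<^esub> c = \<zero>\<^bsub>E (Suc (Suc i))\<^esub>"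
  obtains e where "e \<in> carrier (E (Suc i))" "x \<odot>\<^bsub>E (Suc i)\<^esub> e = \<zero>\<^bsub>E (Suc i)\<^esub>" "d (Suc i) e = c"
proof -
  obtain e where e: "e \<in> carrier (E (Suc i))" "d (Suc i) e = c" using d_exact[OF c] by blast
  \<comment> \<open>The cocycle xe is a coboundary from degree i. This lowering of the degree is why
    the vanishing starts with Ext^2: one degree lower the cocycles are W, and an element of W need
    not be of the form d b.\<close>
  have "d (Suc i) (x \<odot>\<^bsub>E (Suc i)\<^esub> e) = \<zero>\<^bsub>E (Suc (Suc i))\<^esub>"
    using lin_smult[OF d_lin x_closed e(1)] e(2) xc by simp
  then obtain b where b: "b \<in> carrier (E i)" "d i b = x \<odot>\<^bsub>E (Suc i)\<^esub> e"
    using d_exact[of "x \<odot>\<^bsub>E (Suc i)\<^esub> e" i] e x_closed by auto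
  \<comment> \<open>Since rx = 0 only for r = 0, the equation x b' = b carries no compatibility
    condition.\<close>
  obtain b' where b': "b' \<in> carrier (E i)" "x \<odot>\<^bsub>E i\<^esub> b' = b"
  proof (rule solve_linear_equation[OF zeroideal x_closed b(1)])
    show "r \<odot>\<^bsub>E i\<^esub> b = \<zero>\<^bsub>E i\<^esub>" if "r \<in> carrier R" "r \<otimes> x \<in> {\<zero>}" for r
      using that x_cancel[of r] b x_closed by (simp add: m_comm)
  qed blast
  show ?thesis
  proof (rule that[of "e \<ominus>\<^bsub>E (Suc i)\<^esub> d i b'"])
    have "x \<odot>\<^bsub>E (Suc i)\<^esub> d i b' = x \<odot>\<^bsub>E (Suc i)\<^esub> e"
      using lin_smult[OF d_lin x_closed b'(1)] b b' by simp
    then show "x \<odot>\<^bsub>E (Suc i)\<^esub> (e \<ominus>\<^bsub>E (Suc i)\<^esub> d i b') = \<zero>\<^bsub>E (Suc i)\<^esub>"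
      using e b' x_closed by (simp add: a_minus_def E.smult_r_distr E.smult_r_minus E.M.r_neg)
    have "d (Suc i) (e \<ominus>\<^bsub>E (Suc i)\<^esub> d i b') = d (Suc i) e \<ominus>\<^bsub>E (Suc (Suc i))\<^esub> d (Suc i) (d i b')"
      using EE.lin_minus[OF d_lin E.carrier_is_submodule] e b' by simp
    then show "d (Suc i) (e \<ominus>\<^bsub>E (Suc i)\<^esub> d i b') = c"
      using c e d_d[OF b'(1)] by (simp add: a_minus_def)
  qed (use e b' in simp)
qed

lemma x_not_unit_multiple: "\<one> \<notin> PIdl x"
proof
  assume "\<one> \<in> PIdl x"
  then have "\<one> \<in> m" using cgenideal_minimal[OF m.ideal_axioms x(1)] by blast
  then show False using one_notin_m by simp
qed

text \<open>The elementwise form of the sequence 0 -> R/m -> R/(x) -> R/(x, s) -> 0, where s is a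
  socle element modulo x: vanishing of Ext^(i+2) on R/(x) and of Ext^(i+3) on R/(x, s) forces it for
  Ext^(i+2) on R/m.\<close>

lemma lifts_m:
  assumes IH: "lifts (Suc (Suc i))"
    and c: "c \<in> carrier (E (Suc (Suc i)))" "d (Suc (Suc i)) c = \<zero>\<^bsub>E (Suc (Suc (Suc i)))\<^esub>"
    and mc: "\<And>r. r \<in> m \<Longrightarrow> r \<odot>\<^bsub>E (Suc (Suc i))\<^esub> c = \<zero>\<^bsub>E (Suc (Suc i))\<^esub>"
  obtains e where "e \<in> carrier (E (Suc i))" "\<And>r. r \<in> m \<Longrightarrow> r \<odot>\<^bsub>E (Suc i)\<^esub> e = \<zero>\<^bsub>E (Suc i)\<^esub>" "d (Suc i) e = c"
proof -
  let ?I = "Suc (Suc i)"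
  interpret X: ideal "PIdl x" R by (rule cgenideal_ideal[OF x_closed])
  have Xs: "submodule (PIdl x) R (self_mod R)" by (simp add: submodule_self_mod_iff X.ideal_axioms)
  have xX: "x \<in> PIdl x" by (rule cgenideal_self[OF x_closed])
  obtain s where s: "s \<in> carrier R" "s \<notin> PIdl x" "colon R (self_mod R) (PIdl x) s = m"
  proof -
    obtain r where "r \<in> carrier R" "r \<odot>\<^bsub>self_mod R\<^esub> \<one> \<notin> PIdl x"
      "colon R (self_mod R) (PIdl x) (r \<odot>\<^bsub>self_mod R\<^esub> \<one>) = m"
      by (rule socle_element[OF module_self_mod Xs _ _ x, of \<one>]) (use x_not_unit_multiple xX x_closed in auto)
    then show ?thesis using that by simp
  qed
  have ms: "r \<in> m \<longleftrightarrow> r \<otimes> s \<in> PIdl x" if "r \<in> carrier R" for r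
    using s(3) that by (auto simp: colon_def)
  \<comment> \<open>c, seen as a map on the copy of R/m generated by s in R/(x), is extended to
    R/(x).\<close>
  obtain e where e: "e \<in> carrier (E ?I)" "\<And>j. j \<in> PIdl x \<Longrightarrow> j \<odot>\<^bsub>E ?I\<^esub> e = \<zero>\<^bsub>E ?I\<^esub>" "s \<odot>\<^bsub>E ?I\<^esub> e = c"
    by (rule solve_linear_equation[OF X.ideal_axioms s(1) c(1)]) (use ms mc in auto)
  let ?J = "adjoin R (self_mod R) (PIdl x) s"
  have J: "ideal ?J R" "insert s (PIdl x) \<subseteq> ?J"
    using RM.adjoin_submodule[OF Xs, of s] RM.adjoin_superset[OF Xs, of s] s(1)
    by (simp_all add: submodule_self_mod_iff)
  \<comment> \<open>Because s d(e) = d(c) = 0, the coboundary of e is a cocycle killed by (x, s);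
    the hypothesis one degree higher provides a correction e' killed by the same ideal.\<close>
  have "\<exists>e'\<in>carrier (E ?I). (\<forall>r\<in>?J. r \<odot>\<^bsub>E ?I\<^esub> e' = \<zero>\<^bsub>E ?I\<^esub>) \<and> d ?I e' = d ?I e"
  proof -
    have "r \<odot>\<^bsub>E (Suc ?I)\<^esub> d ?I e = \<zero>\<^bsub>E (Suc ?I)\<^esub>" if r: "r \<in> ?J" for r
    proof -
      obtain a t where r_eq: "r = a \<oplus> t \<otimes> s" and at: "a \<in> PIdl x" "t \<in> carrier R"
        using r unfolding adjoin_def by auto
      have "r \<odot>\<^bsub>E ?I\<^esub> e = t \<odot>\<^bsub>E ?I\<^esub> c"
        using at e s(1) X.Icarr[OF at(1)] c by (simp add: r_eq E.smult_l_distr E.smult_assoc1)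
      then have "r \<odot>\<^bsub>E (Suc ?I)\<^esub> d ?I e = t \<odot>\<^bsub>E (Suc ?I)\<^esub> d ?I c"
        using lin_smult[OF d_lin _ e(1), of r] lin_smult[OF d_lin at(2) c(1)] ideal.Icarr[OF J(1) r] by simp
      then show ?thesis using c at by simp
    qed
    then show ?thesis
      using IH[unfolded lifts_def, rule_format, OF J(1), of "d ?I e"] J(2) xX e(1) d_d[OF e(1)] by auto
  qed
  then obtain e' where e': "e' \<in> carrier (E ?I)" "\<And>r. r \<in> ?J \<Longrightarrow> r \<odot>\<^bsub>E ?I\<^esub> e' = \<zero>\<^bsub>E ?I\<^esub>" "d ?I e' = d ?I e"
    by blast
  let ?f = "e \<ominus>\<^bsub>E ?I\<^esub> e'"
  have f: "?f \<in> carrier (E ?I)" "d ?I ?f = \<zero>\<^bsub>E (Suc ?I)\<^esub>"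
    using EE.lin_minus[OF d_lin E.carrier_is_submodule e(1) e'(1)] e e'
    by (simp_all add: a_minus_def E.M.r_neg)
  have xs: "x \<in> ?J" "s \<in> ?J" using xX J(2) by blast+
  have xf: "x \<odot>\<^bsub>E ?I\<^esub> ?f = \<zero>\<^bsub>E ?I\<^esub>"
    using e(1) e(2)[OF xX] e'(1) e'(2)[OF xs(1)] x_closed by (simp add: a_minus_def E.smult_r_distr E.smult_r_minus)
  have sf: "s \<odot>\<^bsub>E ?I\<^esub> ?f = c"
    using e(1,3) e'(1) e'(2)[OF xs(2)] s(1) c(1) by (simp add: a_minus_def E.smult_r_distr E.smult_r_minus)
  obtain b where b: "b \<in> carrier (E (Suc i))" "x \<odot>\<^bsub>E (Suc i)\<^esub> b = \<zero>\<^bsub>E (Suc i)\<^esub>" "d (Suc i) b = ?f"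
    by (rule lifts_PIdl_x[OF f xf])
  show ?thesis
  proof (rule that[of "s \<odot>\<^bsub>E (Suc i)\<^esub> b"])
    show "d (Suc i) (s \<odot>\<^bsub>E (Suc i)\<^esub> b) = c" using lin_smult[OF d_lin s(1) b(1)] b(3) sf by simp
    show "r \<odot>\<^bsub>E (Suc i)\<^esub> (s \<odot>\<^bsub>E (Suc i)\<^esub> b) = \<zero>\<^bsub>E (Suc i)\<^esub>" if r: "r \<in> m" for r
    proof -
      have rc: "r \<in> carrier R" using r m.Icarr by blast
      then obtain t where t: "t \<in> carrier R" "r \<otimes> s = t \<otimes> x" using ms r unfolding cgenideal_def by blast
      have "r \<odot>\<^bsub>E (Suc i)\<^esub> (s \<odot>\<^bsub>E (Suc i)\<^esub> b) = t \<odot>\<^bsub>E (Suc i)\<^esub> (x \<odot>\<^bsub>E (Suc i)\<^esub> b)"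
        using rc s(1) b(1) t x_closed by (simp add: E.smult_assoc1[symmetric])
      then show ?thesis using b t by simp
    qed
  qed (use s b in simp)
qed

text \<open>Noetherian induction: for a maximal counterexample J and a socle element s modulo J, the
  restriction of c to the copy of R/m generated by s is a coboundary by \<open>lifts_m\<close>.
  Subtracting it leaves a cocycle killed by the larger ideal J + Rs, which is no
  counterexample.\<close>

lemma lifts_step:
  assumes IH: "lifts (Suc (Suc i))" shows "lifts (Suc i)"
proof (rule ccontr)
  let ?I = "Suc (Suc i)"
  define bad where "bad J c \<longleftrightarrow> ideal J R \<and> x \<in> J \<and> c \<in> carrier (E ?I) \<and>
     d ?I c = \<zero>\<^bsub>E (Suc ?I)\<^esub> \<and> (\<forall>r\<in>J. r \<odot>\<^bsub>E ?I\<^esub> c = \<zero>\<^bsub>E ?I\<^esub>) \<and>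
     \<not> (\<exists>e\<in>carrier (E (Suc i)). (\<forall>r\<in>J. r \<odot>\<^bsub>E (Suc i)\<^esub> e = \<zero>\<^bsub>E (Suc i)\<^esub>) \<and> d (Suc i) e = c)" for J c
  assume "\<not> lifts (Suc i)"
  then have "{J. \<exists>c. bad J c} \<noteq> {}" unfolding lifts_def bad_def by blast
  then obtain J where "J \<in> {J. \<exists>c. bad J c}"
    and max: "\<And>K. K \<in> {J. \<exists>c. bad J c} \<Longrightarrow> J \<subseteq> K \<Longrightarrow> K = J"
    by (rule ideal_family_maximal) (auto simp: bad_def)
  then obtain c where "bad J c" by blast
  then have J: "ideal J R" "x \<in> J" and c: "c \<in> carrier (E ?I)" "d ?I c = \<zero>\<^bsub>E (Suc ?I)\<^esub>"
    and Jc: "\<And>r. r \<in> J \<Longrightarrow> r \<odot>\<^bsub>E ?I\<^esub> c = \<zero>\<^bsub>E ?I\<^esub>"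
    and no: "\<And>e. e \<in> carrier (E (Suc i)) \<Longrightarrow> (\<And>r. r \<in> J \<Longrightarrow> r \<odot>\<^bsub>E (Suc i)\<^esub> e = \<zero>\<^bsub>E (Suc i)\<^esub>) \<Longrightarrow> d (Suc i) e \<noteq> c"
    unfolding bad_def by blast+
  have Js: "submodule J R (self_mod R)" using J by (simp add: submodule_self_mod_iff)
  have "\<one> \<notin> J"
  proof
    assume "\<one> \<in> J"
    then have "c = \<zero>\<^bsub>E ?I\<^esub>" using Jc[of \<one>] c by simp
    moreover have "d (Suc i) \<zero>\<^bsub>E (Suc i)\<^esub> = \<zero>\<^bsub>E ?I\<^esub>" by (rule EE.lin_zero[OF d_lin E.carrier_is_submodule])
    ultimately show False using no[of "\<zero>\<^bsub>E (Suc i)\<^esub>"] ideal.Icarr[OF J(1)] by simp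
  qed
  then obtain s where s: "s \<in> carrier R" "s \<notin> J" "colon R (self_mod R) J s = m"
  proof -
    assume "\<one> \<notin> J"
    then obtain r where "r \<in> carrier R" "r \<odot>\<^bsub>self_mod R\<^esub> \<one> \<notin> J"
      "colon R (self_mod R) J (r \<odot>\<^bsub>self_mod R\<^esub> \<one>) = m"
      by (rule_tac socle_element[OF module_self_mod Js _ _ x, of \<one>]) (use J x_closed in auto)
    then show ?thesis using that by simp
  qed
  have ms: "r \<in> m \<longleftrightarrow> r \<otimes> s \<in> J" if "r \<in> carrier R" for r
    using s(3) that by (auto simp: colon_def)
  have sc: "s \<odot>\<^bsub>E ?I\<^esub> c \<in> carrier (E ?I)" "d ?I (s \<odot>\<^bsub>E ?I\<^esub> c) = \<zero>\<^bsub>E (Suc ?I)\<^esub>"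
    using lin_smult[OF d_lin s(1) c(1)] c s(1) by simp_all
  have msc: "r \<odot>\<^bsub>E ?I\<^esub> (s \<odot>\<^bsub>E ?I\<^esub> c) = \<zero>\<^bsub>E ?I\<^esub>" if "r \<in> m" for r
    using that ms[of r] Jc[of "r \<otimes> s"] c s(1) m.Icarr[OF that] by (simp add: E.smult_assoc1)
  obtain b where b: "b \<in> carrier (E (Suc i))" "\<And>r. r \<in> m \<Longrightarrow> r \<odot>\<^bsub>E (Suc i)\<^esub> b = \<zero>\<^bsub>E (Suc i)\<^esub>"
    "d (Suc i) b = s \<odot>\<^bsub>E ?I\<^esub> c"
    using lifts_m[OF IH sc msc] by metis
  \<comment> \<open>b0 extends b from the copy of R/m in R/J to all of R/J, so that c - d(b0) is
    killed by s as well as by J.\<close>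
  obtain b0 where b0: "b0 \<in> carrier (E (Suc i))" "\<And>j. j \<in> J \<Longrightarrow> j \<odot>\<^bsub>E (Suc i)\<^esub> b0 = \<zero>\<^bsub>E (Suc i)\<^esub>"
    "s \<odot>\<^bsub>E (Suc i)\<^esub> b0 = b"
    by (rule solve_linear_equation[OF J(1) s(1) b(1)]) (use ms b(2) in auto)
  let ?c = "c \<ominus>\<^bsub>E ?I\<^esub> d (Suc i) b0" and ?J = "adjoin R (self_mod R) J s"
  have J': "ideal ?J R" "insert s J \<subseteq> ?J"
    using RM.adjoin_submodule[OF Js, of s] RM.adjoin_superset[OF Js, of s] s(1)
    by (simp_all add: submodule_self_mod_iff)
  have c': "?c \<in> carrier (E ?I)" "d ?I ?c = \<zero>\<^bsub>E (Suc ?I)\<^esub>"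
    using EE.lin_minus[OF d_lin E.carrier_is_submodule c(1), of "d (Suc i) b0"] c b0(1) d_d[OF b0(1)]
    by (simp_all add: a_minus_def)
  have Jc': "r \<odot>\<^bsub>E ?I\<^esub> ?c = \<zero>\<^bsub>E ?I\<^esub>" if r: "r \<in> ?J" for r
  proof -
    obtain a t where r_eq: "r = a \<oplus> t \<otimes> s" and at: "a \<in> J" "t \<in> carrier R"
      using r unfolding adjoin_def by auto
    have ac: "a \<in> carrier R" by (rule ideal.Icarr[OF J(1) at(1)])
    have "d (Suc i) (a \<odot>\<^bsub>E (Suc i)\<^esub> b0) = a \<odot>\<^bsub>E ?I\<^esub> d (Suc i) b0" by (rule lin_smult[OF d_lin ac b0(1)])
    then have a0: "a \<odot>\<^bsub>E ?I\<^esub> d (Suc i) b0 = \<zero>\<^bsub>E ?I\<^esub>"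
      using b0(2)[OF at(1)] EE.lin_zero[OF d_lin E.carrier_is_submodule] by simp
    have s0: "s \<odot>\<^bsub>E ?I\<^esub> d (Suc i) b0 = s \<odot>\<^bsub>E ?I\<^esub> c"
      using lin_smult[OF d_lin s(1) b0(1)] b0(3) b(3) by simp
    have "s \<odot>\<^bsub>E ?I\<^esub> ?c = \<zero>\<^bsub>E ?I\<^esub>" "a \<odot>\<^bsub>E ?I\<^esub> ?c = \<zero>\<^bsub>E ?I\<^esub>"
      using s0 a0 Jc[OF at(1)] c b0(1) s(1) ac
      by (simp_all add: a_minus_def E.smult_r_distr E.smult_r_minus E.M.r_neg)
    then show ?thesis using c'(1) ac at s(1) by (simp add: r_eq E.smult_l_distr E.smult_assoc1)
  qed
  have "\<not> bad ?J ?c" using max[of ?J] J' s(2) by blast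
  then obtain b1 where b1: "b1 \<in> carrier (E (Suc i))" "\<And>r. r \<in> ?J \<Longrightarrow> r \<odot>\<^bsub>E (Suc i)\<^esub> b1 = \<zero>\<^bsub>E (Suc i)\<^esub>"
    "d (Suc i) b1 = ?c"
    unfolding bad_def using J' J c' Jc' by blast
  have "d (Suc i) (b0 \<oplus>\<^bsub>E (Suc i)\<^esub> b1) = d (Suc i) b0 \<oplus>\<^bsub>E ?I\<^esub> ?c"
    using lin_add[OF d_lin b0(1) b1(1)] b1(3) by simp
  also have "\<dots> = c" using b0(1) c by (simp add: a_minus_def E.M.a_ac E.M.r_neg E.M.r_neg1 E.M.r_neg2)
  finally show False
    using no[of "b0 \<oplus>\<^bsub>E (Suc i)\<^esub> b1"] b0 b1 J' ideal.Icarr[OF J(1)] by (auto simp: E.smult_r_distr)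
qed

lemma lifts_Suc: "lifts (Suc i)"
proof -
  \<comment> \<open>k counts the steps to the end of the resolution; for i at least N the module
    containing c is zero.\<close>
  have "N \<le> i + k \<Longrightarrow> lifts (Suc i)" for k
  proof (induction k arbitrary: i)
    case 0
    have "d (Suc i) \<zero>\<^bsub>E (Suc i)\<^esub> = \<zero>\<^bsub>E (Suc (Suc i))\<^esub>" by (rule EE.lin_zero[OF d_lin E.carrier_is_submodule])
    moreover have "carrier (E (Suc (Suc i))) = {\<zero>\<^bsub>E (Suc (Suc i))\<^esub>}" using 0 by (intro finite_res) simp
    ultimately show ?case unfolding lifts_def using ideal.Icarr by (fastforce intro!: bexI[of _ "\<zero>\<^bsub>E (Suc i)\<^esub>"])
  next
    case (Suc k)
    then have "lifts (Suc (Suc i))" by simp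
    then show ?case by (rule lifts_step)
  qed
  then show ?thesis using le_add2 by blast
qed

end

declare free_mod_simps [simp del]

lemma ideal_mod_simps [simp]:
  "carrier (ideal_mod R W) = W" "zero (ideal_mod R W) = zero R"
  "add (ideal_mod R W) = add R" "smult (ideal_mod R W) = mult R"
  by (simp_all add: ideal_mod_def)

lemma (in plain_cring) ideal_mod_module: "ideal J R \<Longrightarrow> module R (ideal_mod R J)"
proof -
  interpret S: plain_module R "self_mod R" by (rule plain_moduleI, rule module_self_mod)
  show "ideal J R \<Longrightarrow> ?thesis" unfolding ideal_mod_def
    by (rule S.sub_mod_module) (simp add: submodule_self_mod_iff)
qed

section \<open>From cyclic modules to torsion-free quotients: vanishing of Ext^1\<close>

context injectively_resolved
begin

sublocale WM: plain_module R "ideal_mod R W"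
  by (rule plain_moduleI, rule ideal_mod_module, rule W)

lemma eps_lin_ideal_mod: "lin R (ideal_mod R W) W (E 0) \<epsilon>"
  using eps_lin by (simp add: lin_iff)

text \<open>Ext^(i+2)(P/A, W) = 0 when x kills P/A. P is filtered by adding one generator at a time
  to A; the successive quotients are R/(A : p) with x in A : p, where \<open>lifts_Suc\<close>
  applies.\<close>

lemma lift_killing_submodule:
  fixes P :: "('a, 'b) module"
  assumes P: "module R P" and X: "finite X" "X \<subseteq> carrier P" and A: "submodule A R P"
    and xA: "\<And>p. p \<in> carrier P \<Longrightarrow> x \<odot>\<^bsub>P\<^esub> p \<in> A"
    and gen: "\<And>B. submodule B R P \<Longrightarrow> A \<union> X \<subseteq> B \<Longrightarrow> carrier P \<subseteq> B"
    and u: "lin R P (carrier P) (E (Suc (Suc i))) u"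
    and du: "\<And>p. p \<in> carrier P \<Longrightarrow> d (Suc (Suc i)) (u p) = \<zero>\<^bsub>E (Suc (Suc (Suc i)))\<^esub>"
    and uA: "\<And>p. p \<in> A \<Longrightarrow> u p = \<zero>\<^bsub>E (Suc (Suc i))\<^esub>"
  shows "\<exists>v. lin R P (carrier P) (E (Suc i)) v \<and> (\<forall>p\<in>carrier P. d (Suc i) (v p) = u p) \<and>
    (\<forall>p\<in>A. v p = \<zero>\<^bsub>E (Suc i)\<^esub>)"
  using X A xA gen u du uA
proof (induction X arbitrary: A u)
  interpret PE: module_pair R P "E j" for j
    by (rule module_pairI[OF P E.module_axioms])
  case empty
  then have "A = carrier P" using PE.P.submoduleE(1)[of A] by blast
  moreover have "d (Suc i) \<zero>\<^bsub>E (Suc i)\<^esub> = \<zero>\<^bsub>E (Suc (Suc i))\<^esub>" by (rule EE.lin_zero[OF d_lin E.carrier_is_submodule])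
  ultimately show ?case using empty(7) PE.lin_zero_fun[of "carrier P" "Suc i"]
    by (intro exI[of _ "\<lambda>_. \<zero>\<^bsub>E (Suc i)\<^esub>"]) simp
next
  interpret PE: module_pair R P "E j" for j
    by (rule module_pairI[OF P E.module_axioms])
  case (insert p X)
  let ?I = "Suc (Suc i)"
  note A = \<open>submodule A R P\<close> and u = \<open>lin R P (carrier P) (E ?I) u\<close> and uA = insert.prems(7) and du = insert.prems(6)
  have p: "p \<in> carrier P" using insert.prems by simp
  note Ac = PE.P.submoduleE(1)[OF A, THEN subsetD]
  have J: "ideal (colon R P A p) R" by (rule PE.P.colon_ideal[OF A p])
  have xJ: "x \<in> colon R P A p" using insert.prems(3)[OF p] x_closed by (simp add: colon_def)
  have Ju: "\<forall>r\<in>colon R P A p. r \<odot>\<^bsub>E ?I\<^esub> u p = \<zero>\<^bsub>E ?I\<^esub>"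
  proof
    fix r assume "r \<in> colon R P A p"
    then have "r \<in> carrier R" "r \<odot>\<^bsub>P\<^esub> p \<in> A" unfolding colon_def by blast+
    then show "r \<odot>\<^bsub>E ?I\<^esub> u p = \<zero>\<^bsub>E ?I\<^esub>" using lin_smult[OF u _ p, of r] uA by simp
  qed
  obtain e where e: "e \<in> carrier (E (Suc i))" "\<And>r. r \<in> colon R P A p \<Longrightarrow> r \<odot>\<^bsub>E (Suc i)\<^esub> e = \<zero>\<^bsub>E (Suc i)\<^esub>"
    "d (Suc i) e = u p"
    using lifts_Suc[of i, unfolded lifts_def, rule_format, OF J xJ lin_closed[OF u p] du[OF p]] Ju by blast
  obtain f where f: "lin R P (adjoin R P A p) (E (Suc i)) f" "\<And>a. a \<in> A \<Longrightarrow> f a = \<zero>\<^bsub>E (Suc i)\<^esub>" "f p = e"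
    by (rule PE.lin_adjoin[OF A p PE.lin_zero_fun e(1)]) (use e(2) in \<open>auto simp: colon_def\<close>)
  note A' = PE.P.adjoin_submodule[OF A p] and AA' = PE.P.adjoin_superset[OF A p]
  have gen': "carrier P \<subseteq> B" if "submodule B R P" "adjoin R P A p \<union> X \<subseteq> B" for B
    by (rule insert.prems(4)[OF that(1)]) (use that(2) AA' in blast)
  have X: "X \<subseteq> carrier P" using insert.prems by simp
  \<comment> \<open>The solution on A + Rp is extended to all of P by injectivity. What remains of u
    vanishes on A + Rp and is left to the induction hypothesis.\<close>
  obtain v1 where v1: "lin R P (carrier P) (E (Suc i)) v1" "\<And>a. a \<in> adjoin R P A p \<Longrightarrow> v1 a = f a"
    using PE.injective_extends[OF E_injective insert.hyps(1) X A' f(1) gen'] by metis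
  have dv1: "lin R P (carrier P) (E ?I) (\<lambda>q. d (Suc i) (v1 q))"
    by (rule lin_comp[OF v1(1) d_lin]) (rule lin_closed[OF v1(1)])
  let ?u = "\<lambda>q. u q \<ominus>\<^bsub>E ?I\<^esub> d (Suc i) (v1 q)"
  have u': "lin R P (carrier P) (E ?I) ?u" by (rule PE.lin_minus_fun[OF u dv1])
  have du': "d ?I (?u q) = \<zero>\<^bsub>E (Suc ?I)\<^esub>" if q: "q \<in> carrier P" for q
    using EE.lin_minus[OF d_lin E.carrier_is_submodule lin_closed[OF u q] lin_closed[OF dv1 q]]
      du[OF q] d_d[OF lin_closed[OF v1(1) q]] by (simp add: a_minus_def)
  have uA': "?u q = \<zero>\<^bsub>E ?I\<^esub>" if q: "q \<in> adjoin R P A p" for q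
  proof -
    obtain a r where ar: "q = a \<oplus>\<^bsub>P\<^esub> r \<odot>\<^bsub>P\<^esub> p" "a \<in> A" "r \<in> carrier R"
      using q unfolding adjoin_def by blast
    have rp: "r \<odot>\<^bsub>P\<^esub> p \<in> adjoin R P A p" using AA' ar(3) PE.P.submoduleE(4)[OF A'] by blast
    have "f q = f a \<oplus>\<^bsub>E (Suc i)\<^esub> r \<odot>\<^bsub>E (Suc i)\<^esub> f p"
      using lin_add[OF f(1) _ rp, of a] lin_smult[OF f(1) ar(3), of p] AA' ar by auto
    then have "f q = r \<odot>\<^bsub>E (Suc i)\<^esub> e" using f(2)[OF ar(2)] f(3) e(1) ar(3) by simp
    then have "d (Suc i) (v1 q) = r \<odot>\<^bsub>E ?I\<^esub> u p"
      using v1(2)[OF q] lin_smult[OF d_lin ar(3) e(1)] e(3) by simp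
    moreover have "u q = r \<odot>\<^bsub>E ?I\<^esub> u p"
      using lin_add[OF u Ac[OF ar(2)], of "r \<odot>\<^bsub>P\<^esub> p"] lin_smult[OF u ar(3) p] uA[OF ar(2)] p ar(1,3)
        lin_closed[OF u p] by simp
    ultimately show ?thesis using lin_closed[OF u p] ar(3) by (simp add: a_minus_def E.M.r_neg)
  qed
  have xA': "x \<odot>\<^bsub>P\<^esub> q \<in> adjoin R P A p" if "q \<in> carrier P" for q
    using insert.prems(3)[OF that] AA' by blast
  obtain v2 where v2: "lin R P (carrier P) (E (Suc i)) v2" "\<forall>q\<in>carrier P. d (Suc i) (v2 q) = ?u q"
    "\<forall>q\<in>adjoin R P A p. v2 q = \<zero>\<^bsub>E (Suc i)\<^esub>"
    using insert.IH[OF X A' xA' gen' u' du' uA'] by blast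
  let ?v = "\<lambda>q. v1 q \<oplus>\<^bsub>E (Suc i)\<^esub> v2 q"
  show ?case
  proof (intro exI[of _ ?v] conjI ballI)
    show "lin R P (carrier P) (E (Suc i)) ?v" by (rule PE.lin_add_fun[OF v1(1) v2(1)])
    show "d (Suc i) (?v q) = u q" if q: "q \<in> carrier P" for q
      using lin_add[OF d_lin lin_closed[OF v1(1) q] lin_closed[OF v2(1) q]] v2(2) q
        lin_closed[OF u q] lin_closed[OF dv1 q]
      by (simp add: a_minus_def E.M.a_ac E.M.r_neg E.M.r_neg1 E.M.r_neg2)
    show "?v q = \<zero>\<^bsub>E (Suc i)\<^esub>" if q: "q \<in> A" for q
    proof -
      have "q \<in> adjoin R P A p" using q AA' by blast
      then show ?thesis using v1(2)[of q] v2(3) f(2)[OF q] by simp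
    qed
  qed
qed

text \<open>\<open>x\<close> acts surjectively on \<open>Ext\<^sup>1(P/Z, W)\<close>, as \<open>Ext\<^sup>2\<close> of \<open>P/(xP + Z)\<close> vanishes.\<close>

lemma Ext1_divisible:
  fixes P :: "('a, 'b) module"
  assumes P: "module R P" and X: "finite X" "X \<subseteq> carrier P" and Z: "submodule Z R P"
    and gen: "\<And>B. submodule B R P \<Longrightarrow> X \<subseteq> B \<Longrightarrow> carrier P \<subseteq> B"
    and pure: "\<And>p. p \<in> carrier P \<Longrightarrow> x \<odot>\<^bsub>P\<^esub> p \<in> Z \<Longrightarrow> p \<in> Z"
    and h: "lin R P (carrier P) (E 1) h"
    and dh: "\<And>p. p \<in> carrier P \<Longrightarrow> d 1 (h p) = \<zero>\<^bsub>E 2\<^esub>"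
    and hZ: "\<And>p. p \<in> Z \<Longrightarrow> h p = \<zero>\<^bsub>E 1\<^esub>"
  obtains h' where "lin R P (carrier P) (E 1) h'" "\<And>p. p \<in> carrier P \<Longrightarrow> d 1 (h' p) = \<zero>\<^bsub>E 2\<^esub>"
    "\<And>p. p \<in> Z \<Longrightarrow> h' p = \<zero>\<^bsub>E 1\<^esub>" "\<And>p. p \<in> carrier P \<Longrightarrow> h p = x \<odot>\<^bsub>E 1\<^esub> h' p"
proof -
  interpret PE: module_pair R P "E j" for j
    by (rule module_pairI[OF P E.module_axioms])
  note Zc = PE.P.submoduleE(1)[OF Z, THEN subsetD]
  \<comment> \<open>The relation of xf + z \<mapsto> h(f) on xP + Z. Purity of Z and the vanishing
    of h on Z make it single-valued.\<close>
  define G where "G q v \<longleftrightarrow> (\<exists>f\<in>carrier P. \<exists>z\<in>Z. q = x \<odot>\<^bsub>P\<^esub> f \<oplus>\<^bsub>P\<^esub> z \<and> v = h f)" for q v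
  define A where "A = {q. \<exists>v. G q v}"
  have Gadd: "G (q \<oplus>\<^bsub>P\<^esub> q') (v \<oplus>\<^bsub>E 1\<^esub> v')" if qv: "G q v" "G q' v'" for q v q' v'
  proof -
    obtain f z f' z' where *: "f \<in> carrier P" "f' \<in> carrier P" "z \<in> Z" "z' \<in> Z"
      "q = x \<odot>\<^bsub>P\<^esub> f \<oplus>\<^bsub>P\<^esub> z" "q' = x \<odot>\<^bsub>P\<^esub> f' \<oplus>\<^bsub>P\<^esub> z'" "v = h f" "v' = h f'"
      using qv unfolding G_def by blast
    have "q \<oplus>\<^bsub>P\<^esub> q' = x \<odot>\<^bsub>P\<^esub> (f \<oplus>\<^bsub>P\<^esub> f') \<oplus>\<^bsub>P\<^esub> (z \<oplus>\<^bsub>P\<^esub> z')"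
      using * Zc x_closed by (simp add: PE.P.smult_r_distr PE.P.M.a_ac)
    moreover have "v \<oplus>\<^bsub>E 1\<^esub> v' = h (f \<oplus>\<^bsub>P\<^esub> f')" using * lin_add[OF h] by simp
    ultimately show ?thesis unfolding G_def
      using * PE.P.submoduleE(5)[OF Z] PE.P.M.add.m_closed by blast
  qed
  have Gsmult: "G (r \<odot>\<^bsub>P\<^esub> q) (r \<odot>\<^bsub>E 1\<^esub> v)" if qv: "G q v" and r: "r \<in> carrier R" for q v r
  proof -
    obtain f z where *: "f \<in> carrier P" "z \<in> Z" "q = x \<odot>\<^bsub>P\<^esub> f \<oplus>\<^bsub>P\<^esub> z" "v = h f"
      using qv unfolding G_def by blast
    have "r \<odot>\<^bsub>P\<^esub> q = x \<odot>\<^bsub>P\<^esub> (r \<odot>\<^bsub>P\<^esub> f) \<oplus>\<^bsub>P\<^esub> r \<odot>\<^bsub>P\<^esub> z"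
      using * Zc x_closed r by (simp add: PE.P.smult_r_distr PE.P.smult_assoc1[symmetric] m_comm)
    moreover have "r \<odot>\<^bsub>E 1\<^esub> v = h (r \<odot>\<^bsub>P\<^esub> f)" using * r lin_smult[OF h] by simp
    ultimately show ?thesis unfolding G_def
      using * r PE.P.submoduleE(4)[OF Z] PE.P.smult_closed by blast
  qed
  have Gx: "G (x \<odot>\<^bsub>P\<^esub> f) (h f)" if "f \<in> carrier P" for f
    unfolding G_def using that x_closed PE.P.submodule_zero[OF Z] by (intro bexI[of _ f] bexI[of _ "\<zero>\<^bsub>P\<^esub>"]) auto
  have GZ: "G z \<zero>\<^bsub>E 1\<^esub>" if "z \<in> Z" for z
    unfolding G_def using that x_closed Zc PE.lin_zero[OF h PE.P.carrier_is_submodule]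
    by (intro bexI[of _ "\<zero>\<^bsub>P\<^esub>"] bexI[of _ z]) auto
  have A: "submodule A R P"
  proof (rule PE.P.submoduleI')
    show "A \<subseteq> carrier P" unfolding A_def G_def using x_closed Zc by auto
    show "\<zero>\<^bsub>P\<^esub> \<in> A" unfolding A_def using GZ PE.P.submodule_zero[OF Z] by blast
  qed (use Gadd Gsmult A_def in blast)+
  obtain u0 where u0: "lin R P A (E 1) u0" "\<And>q v. q \<in> A \<Longrightarrow> G q v \<longleftrightarrow> u0 q = v"
  proof (rule PE.lin_of_graph[OF A, of G 1])
    show "v = \<zero>\<^bsub>E 1\<^esub>" if Gz: "G \<zero>\<^bsub>P\<^esub> v" for v
    proof -
      obtain f z where *: "f \<in> carrier P" "z \<in> Z" "\<zero>\<^bsub>P\<^esub> = x \<odot>\<^bsub>P\<^esub> f \<oplus>\<^bsub>P\<^esub> z" "v = h f"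
        using Gz unfolding G_def by blast
      have "\<ominus>\<^bsub>P\<^esub> z = x \<odot>\<^bsub>P\<^esub> f"
        using PE.P.M.minus_equality[of "x \<odot>\<^bsub>P\<^esub> f" z] * Zc x_closed by simp
      then have "x \<odot>\<^bsub>P\<^esub> f \<in> Z" using PE.P.submoduleE(3)[OF Z *(2)] by simp
      then show ?thesis using pure[OF *(1)] hZ *(4) by simp
    qed
    show "v \<in> carrier (E 1)" if "G q v" for q v using that lin_closed[OF h] unfolding G_def by blast
  qed (use Gadd Gsmult A_def in blast)+
  have gen': "carrier P \<subseteq> B" if "submodule B R P" "A \<union> X \<subseteq> B" for B
    using gen[OF that(1)] that(2) by blast
  obtain u where u: "lin R P (carrier P) (E 1) u" "\<And>q. q \<in> A \<Longrightarrow> u q = u0 q"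
    using PE.injective_extends[OF E_injective X A u0(1) gen'] by metis
  have ux: "u (x \<odot>\<^bsub>P\<^esub> f) = h f" if "f \<in> carrier P" for f
  proof -
    have "x \<odot>\<^bsub>P\<^esub> f \<in> A" unfolding A_def using Gx[OF that] by blast
    then show ?thesis using u(2) iffD1[OF u0(2) Gx[OF that]] by simp
  qed
  have uZ: "u z = \<zero>\<^bsub>E 1\<^esub>" if "z \<in> Z" for z
  proof -
    have "z \<in> A" unfolding A_def using GZ[OF that] by blast
    then show ?thesis using u(2) iffD1[OF u0(2) GZ[OF that]] by simp
  qed
  have du: "lin R P (carrier P) (E 2) (\<lambda>q. d 1 (u q))"
    using lin_comp[OF u(1) d_lin[of 1] lin_closed[OF u(1)]] by (simp add: numeral_2_eq_2)
  \<comment> \<open>The extension u satisfies h = xu but need not consist of cocycles. Its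
    coboundary vanishes on xP + Z, so it is a cocycle of degree two on P/(xP + Z) and can be removed
    by some v that is zero there.\<close>
  have duA: "d 1 (u q) = \<zero>\<^bsub>E 2\<^esub>" if q: "q \<in> A" for q
  proof -
    obtain f z where *: "f \<in> carrier P" "z \<in> Z" "q = x \<odot>\<^bsub>P\<^esub> f \<oplus>\<^bsub>P\<^esub> z"
      using q unfolding A_def G_def by blast
    have "u q = h f" using lin_add[OF u(1), of "x \<odot>\<^bsub>P\<^esub> f" z] * Zc x_closed ux uZ lin_closed[OF h *(1)] by simp
    then show ?thesis using dh[OF *(1)] by simp
  qed
  have "\<exists>v. lin R P (carrier P) (E (Suc 0)) v \<and> (\<forall>p\<in>carrier P. d (Suc 0) (v p) = d (Suc 0) (u p)) \<and>
    (\<forall>p\<in>A. v p = \<zero>\<^bsub>E (Suc 0)\<^esub>)"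
  proof (rule lift_killing_submodule[OF P X A _ gen'])
    show "x \<odot>\<^bsub>P\<^esub> p \<in> A" if "p \<in> carrier P" for p unfolding A_def using Gx[OF that] by blast
    show "lin R P (carrier P) (E (Suc (Suc 0))) (\<lambda>p. d (Suc 0) (u p))" using du by (simp add: numeral_2_eq_2)
    show "d (Suc (Suc 0)) (d (Suc 0) (u p)) = \<zero>\<^bsub>E (Suc (Suc (Suc 0)))\<^esub>" if "p \<in> carrier P" for p
      using d_d[of "u p" "Suc 0"] lin_closed[OF u(1) that] by simp
    show "d (Suc 0) (u p) = \<zero>\<^bsub>E (Suc (Suc 0))\<^esub>" if "p \<in> A" for p
      using duA[OF that] by (simp add: numeral_2_eq_2)
  qed
  then obtain v where v: "lin R P (carrier P) (E 1) v" "\<forall>p\<in>carrier P. d 1 (v p) = d 1 (u p)"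
    "\<forall>p\<in>A. v p = \<zero>\<^bsub>E 1\<^esub>" by auto
  let ?h = "\<lambda>q. u q \<ominus>\<^bsub>E 1\<^esub> v q"
  have h': "lin R P (carrier P) (E 1) ?h" by (rule PE.lin_minus_fun[OF u(1) v(1)])
  show ?thesis
  proof (rule that[OF h'])
    fix p assume p: "p \<in> carrier P"
    show "d 1 (?h p) = \<zero>\<^bsub>E 2\<^esub>"
      using EE.lin_minus[OF d_lin E.carrier_is_submodule lin_closed[OF u(1) p] lin_closed[OF v(1) p]]
        v(2) p lin_closed[OF du p] by (simp add: numeral_2_eq_2 a_minus_def E.M.r_neg)
    have xp: "x \<odot>\<^bsub>P\<^esub> p \<in> A" unfolding A_def using Gx[OF p] by blast
    have "x \<odot>\<^bsub>E 1\<^esub> ?h p = ?h (x \<odot>\<^bsub>P\<^esub> p)" using lin_smult[OF h' x_closed p] by simp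
    also have "\<dots> = h p" using ux[OF p] v(3) xp lin_closed[OF h p] by (simp add: a_minus_def)
    finally show "h p = x \<odot>\<^bsub>E 1\<^esub> ?h p" by simp
  next
    fix z assume z: "z \<in> Z"
    then have "z \<in> A" unfolding A_def using GZ by blast
    then show "?h z = \<zero>\<^bsub>E 1\<^esub>" using uZ[OF z] v(3) by (simp add: a_minus_def)
  qed
qed

text \<open>By exactness at \<open>E 0\<close>, the maps into \<open>E 0\<close> that are killed by
  d are exactly the maps into W followed by \<epsilon>.\<close>

lemma eps_factor:
  fixes P :: "('a, 'b) module"
  assumes P: "module R P" and A: "submodule A R P" and f: "lin R P A (E 0) f"
    and df: "\<And>p. p \<in> A \<Longrightarrow> d 0 (f p) = \<zero>\<^bsub>E 1\<^esub>"
  obtains g where "lin R P A (ideal_mod R W) g" "\<And>p. p \<in> A \<Longrightarrow> \<epsilon> (g p) = f p"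
proof -
  interpret P: plain_module R P by (rule plain_moduleI, rule P)
  have im: "f p \<in> \<epsilon> ` W" if "p \<in> A" for p by (rule iffD1[OF eps_exact[OF lin_closed[OF f that]] df[OF that]])
  define g where "g p = inv_into W \<epsilon> (f p)" for p
  have gW: "g p \<in> W" and eg: "\<epsilon> (g p) = f p" if "p \<in> A" for p
    using im[OF that] by (simp_all add: g_def inv_into_into f_inv_into_f)
  have eq: "b = g p" if "b \<in> W" "p \<in> A" "\<epsilon> b = f p" for b p
    using inj_onD[OF eps_inj, of b "g p"] gW[OF that(2)] eg[OF that(2)] that by simp
  have "lin R P A (ideal_mod R W) g"
  proof (rule linI)
    show "g p \<in> carrier (ideal_mod R W)" if "p \<in> A" for p using gW that by simp
    show "g (p \<oplus>\<^bsub>P\<^esub> q) = g p \<oplus>\<^bsub>ideal_mod R W\<^esub> g q" if "p \<in> A" "q \<in> A" for p q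
      by (rule eq[symmetric])
       (use that gW eg lin_add[OF eps_lin_ideal_mod, of "g p" "g q"] lin_add[OF f, of p q] P.submoduleE(5)[OF A]
          WM.M.add.m_closed in auto)
    show "g (r \<odot>\<^bsub>P\<^esub> p) = r \<odot>\<^bsub>ideal_mod R W\<^esub> g p" if "p \<in> A" "r \<in> carrier R" for p r
      by (rule eq[symmetric])
       (use that gW eg lin_smult[OF eps_lin_ideal_mod, of r "g p"] lin_smult[OF f, of r p] P.submoduleE(4)[OF A]
          WM.smult_closed in auto)
  qed
  then show ?thesis using that eg by blast
qed

text \<open>The cokernel of restriction from Hom(F, W) to Hom(Z, W) is Ext^1(F/Z, W), on which x is
  surjective; so Hom(Z, W) is spanned by the restrictions and x Hom(Z, W).\<close>

lemma extend_mod_x: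
  fixes n :: nat
  defines "F \<equiv> free_mod R n"
  assumes Z: "submodule Z R F" and pure: "\<And>t. t \<in> carrier F \<Longrightarrow> x \<odot>\<^bsub>F\<^esub> t \<in> Z \<Longrightarrow> t \<in> Z"
    and g: "lin R F Z (ideal_mod R W) g"
  obtains G g' where "lin R F (carrier F) (ideal_mod R W) G" "lin R F Z (ideal_mod R W) g'"
    "\<And>t. t \<in> Z \<Longrightarrow> g t = G t \<oplus> x \<otimes> g' t"
proof -
  interpret FE: module_pair R F "E j" for j
    unfolding F_def by (rule module_pairI[OF free_mod_module E.module_axioms])
  note Fm = FE.P.module_axioms
  note Zc = FE.P.submoduleE(1)[OF Z, THEN subsetD]
  let ?X = "unit_vec R ` {..<n}"
  have X: "finite ?X" "?X \<subseteq> carrier F" unfolding F_def using unit_vec_closed by auto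
  have gen: "carrier F \<subseteq> B" if "submodule B R F" "?X \<subseteq> B" for B
    using free_mod_generated that unfolding F_def by blast
  have "lin R F Z (E 0) (\<lambda>t. \<epsilon> (g t))"
    by (rule lin_comp[OF g eps_lin_ideal_mod]) (use lin_closed[OF g] in simp)
  from FE.injective_extends[OF E_injective X Z this] gen
  obtain k where k: "lin R F (carrier F) (E 0) k" "\<And>t. t \<in> Z \<Longrightarrow> k t = \<epsilon> (g t)"
    by (metis Un_subset_iff)
  \<comment> \<open>This cocycle vanishes on Z and represents the image of g under the connecting
    map to Ext^1(F/Z, W).\<close>
  have h: "lin R F (carrier F) (E 1) (\<lambda>t. d 0 (k t))"
    using lin_comp[OF k(1) d_lin lin_closed[OF k(1)]] by simp
  obtain h' where h': "lin R F (carrier F) (E 1) h'" "\<And>t. t \<in> carrier F \<Longrightarrow> d 1 (h' t) = \<zero>\<^bsub>E 2\<^esub>"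
    "\<And>t. t \<in> Z \<Longrightarrow> h' t = \<zero>\<^bsub>E 1\<^esub>" "\<And>t. t \<in> carrier F \<Longrightarrow> d 0 (k t) = x \<odot>\<^bsub>E 1\<^esub> h' t"
  proof (rule Ext1_divisible[OF Fm X Z gen pure h])
    show "d 1 (d 0 (k t)) = \<zero>\<^bsub>E 2\<^esub>" if "t \<in> carrier F" for t
      using d_d[OF lin_closed[OF k(1) that]] by (simp add: numeral_2_eq_2)
    show "d 0 (k t) = \<zero>\<^bsub>E 1\<^esub>" if t: "t \<in> Z" for t
    proof -
      have "k t \<in> carrier (E 0)" by (rule lin_closed[OF k(1) Zc[OF t]])
      moreover have "k t \<in> \<epsilon> ` W" using k(2)[OF t] lin_closed[OF g t] by simp
      ultimately show ?thesis using eps_exact by blast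
    qed
  qed blast+
  \<comment> \<open>Over the free module F the cocycle h' is a coboundary: preimages under d are
    chosen on the unit vectors and extended linearly.\<close>
  have "\<exists>y\<in>carrier (E 0). d 0 y = h' (unit_vec R i)" if "i < n" for i
  proof -
    have "unit_vec R i \<in> carrier F" using unit_vec_closed that unfolding F_def by blast
    then show ?thesis
      using d_exact[of "h' (unit_vec R i)" 0] lin_closed[OF h'(1)] h'(2) by (simp add: numeral_2_eq_2)
  qed
  then obtain y where y: "\<And>i. i < n \<Longrightarrow> y i \<in> carrier (E 0)" "\<And>i. i < n \<Longrightarrow> d 0 (y i) = h' (unit_vec R i)"
    by metis
  let ?w = "\<lambda>t. lincomb (E 0) t y n"
  have w: "lin R F (carrier F) (E 0) ?w" unfolding F_def by (rule E.lincomb_lin) (rule y(1))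
  have dw: "d 0 (?w t) = h' t" if t: "t \<in> carrier F" for t
  proof -
    have tR: "t i \<in> carrier R" for i using t unfolding F_def by (simp add: free_mod_simps)
    have "d 0 (?w t) = lincomb (E 1) t (\<lambda>i. d 0 (y i)) n"
      using EE.lin_lincomb[OF d_lin E.carrier_is_submodule, of n t y 0] tR y(1) by simp
    also have "\<dots> = lincomb (E 1) t (\<lambda>i. h' (unit_vec R i)) n"
      by (rule E.lincomb_cong) (use y(2) in auto)
    also have "\<dots> = h' (lincomb F t (unit_vec R) n)"
      by (rule FE.lin_lincomb[OF h'(1) FE.P.carrier_is_submodule, symmetric]) (use tR X in auto)
    also have "\<dots> = h' t" using lincomb_unit_vecs t unfolding F_def by simp
    finally show ?thesis .
  qed
  have xw: "lin R F (carrier F) (E 0) (\<lambda>t. x \<odot>\<^bsub>E 0\<^esub> ?w t)" by (rule FE.lin_smult_fun[OF w x_closed])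
  \<comment> \<open>k - xw is killed by d, hence has values in \<epsilon>(W) on all of F; this gives
    G. On Z, where h' vanishes, w itself has values in \<epsilon>(W); this gives g'.\<close>
  have l: "lin R F (carrier F) (E 0) (\<lambda>t. k t \<ominus>\<^bsub>E 0\<^esub> x \<odot>\<^bsub>E 0\<^esub> ?w t)"
    by (rule FE.lin_minus_fun[OF k(1) xw])
  obtain G where G: "lin R F (carrier F) (ideal_mod R W) G"
    "\<And>t. t \<in> carrier F \<Longrightarrow> \<epsilon> (G t) = k t \<ominus>\<^bsub>E 0\<^esub> x \<odot>\<^bsub>E 0\<^esub> ?w t"
  proof (rule eps_factor[OF Fm FE.P.carrier_is_submodule l])
    fix t assume t: "t \<in> carrier F"
    have "d 0 (k t \<ominus>\<^bsub>E 0\<^esub> x \<odot>\<^bsub>E 0\<^esub> ?w t) = d 0 (k t) \<ominus>\<^bsub>E 1\<^esub> d 0 (x \<odot>\<^bsub>E 0\<^esub> ?w t)"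
      using EE.lin_minus[OF d_lin E.carrier_is_submodule lin_closed[OF k(1) t] lin_closed[OF xw t]] by simp
    also have "\<dots> = \<zero>\<^bsub>E 1\<^esub>"
      using h'(4)[OF t] lin_smult[OF d_lin x_closed lin_closed[OF w t]] dw[OF t] lin_closed[OF h t]
      by (simp add: a_minus_def E.M.r_neg)
    finally show "d 0 (k t \<ominus>\<^bsub>E 0\<^esub> x \<odot>\<^bsub>E 0\<^esub> ?w t) = \<zero>\<^bsub>E 1\<^esub>" .
  qed blast
  have wZ: "lin R F Z (E 0) ?w" by (rule lin_subset[OF w FE.P.submoduleE(1)[OF Z]])
  obtain g' where g': "lin R F Z (ideal_mod R W) g'" "\<And>t. t \<in> Z \<Longrightarrow> \<epsilon> (g' t) = ?w t"
    by (rule eps_factor[OF Fm Z wZ]) (use dw Zc h'(3) in auto)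
  show ?thesis
  proof (rule that[OF G(1) g'(1)])
    fix t assume t: "t \<in> Z"
    have W': "g t \<in> W" "G t \<in> W" "g' t \<in> W" "x \<otimes> g' t \<in> W"
      using lin_closed[OF g t] lin_closed[OF G(1) Zc[OF t]] lin_closed[OF g'(1) t] x_closed WM.smult_closed
      by auto
    have "\<epsilon> (G t \<oplus> x \<otimes> g' t) = (k t \<ominus>\<^bsub>E 0\<^esub> x \<odot>\<^bsub>E 0\<^esub> ?w t) \<oplus>\<^bsub>E 0\<^esub> x \<odot>\<^bsub>E 0\<^esub> ?w t"
      using lin_add[OF eps_lin, OF W'(2,4)] lin_smult[OF eps_lin x_closed W'(3)] G(2)[OF Zc[OF t]] g'(2)[OF t] by simp
    also have "\<dots> = k t"
      using lin_closed[OF k(1) Zc[OF t]] lin_closed[OF xw Zc[OF t]]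
      by (simp add: a_minus_def E.M.a_ac E.M.r_neg)
    finally have "\<epsilon> (G t \<oplus> x \<otimes> g' t) = \<epsilon> (g t)" using k(2)[OF t] by simp
    moreover have "G t \<oplus> x \<otimes> g' t \<in> W" using W' WM.M.add.m_closed by auto
    ultimately show "g t = G t \<oplus> x \<otimes> g' t" using inj_onD[OF eps_inj, of "g t" "G t \<oplus> x \<otimes> g' t"] W'(1) by simp
  qed
qed

text \<open>Nakayama's lemma for the restriction Hom(F, W) -> Hom(Z, W). Evaluation at finitely many
  generators of Z makes both sides submodules of some R^r, where finite generation comes from
  Noetherianity.\<close>

lemma extend_free:
  fixes n :: nat
  defines "F \<equiv> free_mod R n"
  assumes Z: "submodule Z R F" and pure: "\<And>t. t \<in> carrier F \<Longrightarrow> x \<odot>\<^bsub>F\<^esub> t \<in> Z \<Longrightarrow> t \<in> Z"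
    and g: "lin R F Z (ideal_mod R W) g"
  obtains G where "lin R F (carrier F) (ideal_mod R W) G" "\<And>t. t \<in> Z \<Longrightarrow> G t = g t"
proof -
  interpret FW: module_pair R F "ideal_mod R W"
    unfolding F_def by (rule module_pairI[OF free_mod_module WM.module_axioms])
  note Zc = FW.P.submoduleE(1)[OF Z, THEN subsetD]
  let ?X = "unit_vec R ` {..<n}"
  have X: "finite ?X" "?X \<subseteq> carrier F" unfolding F_def using unit_vec_closed by auto
  have "carrier F \<subseteq> mod_span R F ?X"
    using free_mod_generated[of "mod_span R F ?X" n] FW.P.mod_span_submodule[OF X(2)] mod_span_superset[of ?X R F]
    unfolding F_def by blast
  then obtain Y where Y: "finite Y" "Y \<subseteq> Z" "Z \<subseteq> mod_span R F Y"
    using FW.P.noetherian_fg_submodule[OF noetherian_ring_axioms X Z] FW.P.submoduleE(1)[OF Z] by blast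
  obtain r :: nat and q where Yq: "Y = q ` {i. i < r}"
    using finite_imp_nat_seg_image_inj_on[OF Y(1)] by blast
  have qZ: "q i \<in> Z" if "i < r" for i using that Y(2) Yq by blast
  let ?V = "free_mod R r"
  interpret V: plain_module R ?V by (rule plain_moduleI, rule free_mod_module)
  \<comment> \<open>Values at the generators of Z; these determine a linear map on Z.\<close>
  define ev where "ev f = (\<lambda>i. if i < r then f (q i) else \<zero>)" for f :: "(nat \<Rightarrow> 'a) \<Rightarrow> 'a"
  define H where "H B = {ev f | f. lin R F B (ideal_mod R W) f}" for B
  have H: "submodule (H B) R ?V" if B: "Z \<subseteq> B" for B
  proof (rule V.submoduleI')
    have qB: "q i \<in> B" if "i < r" for i using qZ[OF that] B by blast
    show "H B \<subseteq> carrier ?V"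
    proof
      fix v assume "v \<in> H B"
      then obtain f where f: "lin R F B (ideal_mod R W) f" "v = ev f" unfolding H_def by blast
      have "f (q i) \<in> carrier R" if "i < r" for i
        using lin_closed[OF f(1) qB[OF that]] W_closed by simp
      then show "v \<in> carrier ?V" unfolding f(2) ev_def by (simp add: free_mod_simps)
    qed
    have "\<zero>\<^bsub>?V\<^esub> = ev (\<lambda>_. \<zero>)" by (simp add: free_mod_simps ev_def fun_eq_iff)
    then show "\<zero>\<^bsub>?V\<^esub> \<in> H B" unfolding H_def using FW.lin_zero_fun[of B] by auto
    show "u \<oplus>\<^bsub>?V\<^esub> v \<in> H B" if u: "u \<in> H B" and v: "v \<in> H B" for u v
    proof -
      obtain f f' where f: "lin R F B (ideal_mod R W) f" "u = ev f" "lin R F B (ideal_mod R W) f'" "v = ev f'"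
        using u v unfolding H_def by blast
      have "u \<oplus>\<^bsub>?V\<^esub> v = ev (\<lambda>t. f t \<oplus> f' t)" using f by (auto simp: free_mod_simps ev_def fun_eq_iff)
      then show ?thesis unfolding H_def using FW.lin_add_fun[OF f(1,3)] by auto
    qed
    show "c \<odot>\<^bsub>?V\<^esub> u \<in> H B" if c: "c \<in> carrier R" and u: "u \<in> H B" for c u
    proof -
      obtain f where f: "lin R F B (ideal_mod R W) f" "u = ev f"
        using u unfolding H_def by blast
      have "c \<odot>\<^bsub>?V\<^esub> u = ev (\<lambda>t. c \<otimes> f t)" using f c by (auto simp: free_mod_simps ev_def fun_eq_iff)
      then show ?thesis unfolding H_def using FW.lin_smult_fun[OF f(1) c] by auto
    qed
  qed
  let ?U = "unit_vec R ` {..<r}"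
  have U: "finite ?U" "?U \<subseteq> carrier ?V" using unit_vec_closed by auto
  have "carrier ?V \<subseteq> mod_span R ?V ?U"
    using free_mod_generated[of "mod_span R ?V ?U" r] V.mod_span_submodule[OF U(2)] mod_span_superset[of ?U R ?V]
    by blast
  then obtain T where T: "finite T" "T \<subseteq> H Z" "H Z \<subseteq> mod_span R ?V T"
    using V.noetherian_fg_submodule[OF noetherian_ring_axioms U H[OF order_refl]] V.submoduleE(1)[OF H[OF order_refl]] by blast
  have Tc: "T \<subseteq> carrier ?V" using T(2) V.submoduleE(1)[OF H[OF order_refl]] by blast
  have ZF: "Z \<subseteq> carrier F" using Zc by blast
  have "T \<subseteq> H (carrier F)"
  \<comment> \<open>T generates the evaluations of maps on Z, and by \<open>extend_mod_x\<close>
    each of them is an evaluation of a map on F plus x times an element of the span of T.\<close>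
  proof (rule nakayama[OF V.module_axioms H[OF ZF] x(1) T(1) Tc])
    fix y assume "y \<in> T"
    then obtain f where f: "lin R F Z (ideal_mod R W) f" "y = ev f" using T(2) unfolding H_def by blast
    obtain G f' where G: "lin R F (carrier F) (ideal_mod R W) G" "lin R F Z (ideal_mod R W) f'"
      "\<And>t. t \<in> Z \<Longrightarrow> f t = G t \<oplus> x \<otimes> f' t"
      using extend_mod_x[of Z n f] Z pure f(1) unfolding F_def by metis
    have "y = ev G \<oplus>\<^bsub>?V\<^esub> x \<odot>\<^bsub>?V\<^esub> ev f'"
      using f(2) G(3) qZ x_closed by (auto simp: free_mod_simps ev_def fun_eq_iff)
    moreover have "ev G \<in> H (carrier F)" "ev f' \<in> mod_span R ?V T" using G(1,2) T(3) unfolding H_def by blast+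
    ultimately show "\<exists>n\<in>H (carrier F). \<exists>b\<in>mod_span R ?V T. y = n \<oplus>\<^bsub>?V\<^esub> x \<odot>\<^bsub>?V\<^esub> b" by blast
  qed
  then have "H Z \<subseteq> H (carrier F)" using mod_span_minimal[OF H[OF ZF]] T(3) by blast
  moreover have "ev g \<in> H Z" using g unfolding H_def by blast
  ultimately obtain G where G: "lin R F (carrier F) (ideal_mod R W) G" "ev g = ev G"
    unfolding H_def by blast
  have GZ: "lin R F Z (ideal_mod R W) G" by (rule lin_subset[OF G(1) ZF])
  let ?E = "{t \<in> Z. G t = g t}"
  have gW: "g t \<in> W" if "t \<in> Z" for t using lin_closed[OF g that] by simp
  have "submodule ?E R F"
    by (rule FW.P.submoduleI')
      (use Zc FW.P.submodule_zero[OF Z] FW.P.submoduleE(4,5)[OF Z] FW.lin_zero[OF GZ Z] FW.lin_zero[OF g Z]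
         lin_add[OF GZ] lin_add[OF g] lin_smult[OF GZ] lin_smult[OF g] in auto)
  moreover have "Y \<subseteq> ?E"
  proof
    fix y assume "y \<in> Y"
    then obtain i where i: "i < r" "y = q i" using Yq by blast
    have "ev g i = ev G i" using G(2) by simp
    then show "y \<in> ?E" using i qZ by (simp add: ev_def)
  qed
  ultimately have "Z \<subseteq> ?E" using mod_span_minimal Y(3) by blast
  then show ?thesis using that[OF G(1)] by blast
qed

text \<open>The vanishing of \<open>Ext\<^sup>1(P/Z, W)\<close> in elementary terms.\<close>

lemma extend:
  fixes P :: "('a, 'b) module"
  assumes P: "fg_module R P" and Z: "submodule Z R P"
    and pure: "\<And>p. p \<in> carrier P \<Longrightarrow> x \<odot>\<^bsub>P\<^esub> p \<in> Z \<Longrightarrow> p \<in> Z"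
    and g: "lin R P Z (ideal_mod R W) g"
  obtains G where "lin R P (carrier P) (ideal_mod R W) G" "\<And>z. z \<in> Z \<Longrightarrow> G z = g z"
proof -
  have Pm: "module R P" using P by (simp add: fg_module_def)
  interpret PW: module_pair R P "ideal_mod R W"
    by (rule module_pairI[OF Pm WM.module_axioms])
  obtain n p where p: "\<And>i. i < (n::nat) \<Longrightarrow> p i \<in> carrier P"
    and gen: "\<And>y. y \<in> carrier P \<Longrightarrow> \<exists>t\<in>carrier (free_mod R n). y = lincomb P t p n"
    using PW.P.fg_module_lincomb[OF P] by metis
  let ?F = "free_mod R n" and ?L = "\<lambda>t. lincomb P t p n"
  interpret FP: module_pair R ?F P
    by (rule module_pairI[OF free_mod_module Pm])
  interpret FW: module_pair R ?F "ideal_mod R W"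
    by (rule module_pairI[OF free_mod_module WM.module_axioms])
  have L: "lin R ?F (carrier ?F) P ?L" by (rule PW.P.lincomb_lin) (rule p)
  \<comment> \<open>The preimage of Z contains all relations among the generators, and the
    pulled-back map is zero on them. An extension to the free module therefore descends to
    P.\<close>
  let ?Z = "{t \<in> carrier ?F. ?L t \<in> Z}"
  have Z': "submodule ?Z R ?F" by (rule FP.lin_vimage_submodule[OF L FP.P.carrier_is_submodule Z])
  have pure': "t \<in> ?Z" if t: "t \<in> carrier ?F" "x \<odot>\<^bsub>?F\<^esub> t \<in> ?Z" for t
    using pure[OF lin_closed[OF L t(1)]] lin_smult[OF L x_closed t(1)] t by simp
  have "lin R ?F ?Z P ?L" by (rule lin_subset[OF L]) blast
  then have g': "lin R ?F ?Z (ideal_mod R W) (\<lambda>t. g (?L t))" by (rule lin_comp[OF _ g]) blast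
  obtain G where G: "lin R ?F (carrier ?F) (ideal_mod R W) G" "\<And>t. t \<in> ?Z \<Longrightarrow> G t = g (?L t)"
  proof (rule extend_free[OF Z' _ g'])
    show "t \<in> ?Z" if "t \<in> carrier ?F" "x \<odot>\<^bsub>?F\<^esub> t \<in> ?Z" for t by (rule pure'[OF that])
  qed blast
  have Glc: "G t = lincomb (ideal_mod R W) t (\<lambda>i. G (unit_vec R i)) n" if t: "t \<in> carrier ?F" for t
  proof -
    have "G t = G (lincomb ?F t (unit_vec R) n)" using lincomb_unit_vecs[OF t] by simp
    also have "\<dots> = lincomb (ideal_mod R W) t (\<lambda>i. G (unit_vec R i)) n"
      by (rule FW.lin_lincomb[OF G(1) FP.P.carrier_is_submodule])
        (use t unit_vec_closed in \<open>auto simp: free_mod_simps\<close>)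
    finally show ?thesis .
  qed
  obtain f where f: "lin R P (carrier P) (ideal_mod R W) f"
    "\<And>t. t \<in> carrier ?F \<Longrightarrow> f (?L t) = lincomb (ideal_mod R W) t (\<lambda>i. G (unit_vec R i)) n"
  proof (rule lin_of_lincomb[OF Pm WM.module_axioms, of n p "\<lambda>i. G (unit_vec R i)"])
    show "G (unit_vec R i) \<in> carrier (ideal_mod R W)" if "i < n" for i
      using lin_closed[OF G(1) unit_vec_closed[OF that]] .
    fix t assume t: "t \<in> carrier ?F" "?L t = \<zero>\<^bsub>P\<^esub>"
    then have "t \<in> ?Z" using PW.P.submodule_zero[OF Z] by simp
    then show "lincomb (ideal_mod R W) t (\<lambda>i. G (unit_vec R i)) n = \<zero>\<^bsub>ideal_mod R W\<^esub>"
      using Glc[OF t(1)] G(2) t(2) PW.lin_zero[OF g Z] by simp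
  qed (use p gen in blast)+
  show ?thesis
  proof (rule that[OF f(1)])
    fix z assume z: "z \<in> Z"
    then obtain t where t: "t \<in> carrier ?F" "z = ?L t" using gen PW.P.submoduleE(1)[OF Z] by blast
    then show "f z = g z" using f(2)[OF t(1)] Glc[OF t(1)] G(2) z by simp
  qed
qed

end

section \<open>Duality with respect to a canonical ideal\<close>

lemma (in plain_cring) fg_module_self_mod: "fg_module R (self_mod R)"
proof -
  interpret S: plain_module R "self_mod R" by (rule plain_moduleI, rule module_self_mod)
  have "carrier R \<subseteq> mod_span R (self_mod R) {\<one>}"
  proof
    fix r assume r: "r \<in> carrier R"
    have "submodule (mod_span R (self_mod R) {\<one>}) R (self_mod R)" by (rule S.mod_span_submodule) simp
    from S.submoduleE(4)[OF this r, of \<one>] show "r \<in> mod_span R (self_mod R) {\<one>}"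
      using mod_span_superset[of "{\<one>}" R "self_mod R"] r by simp
  qed
  moreover have "mod_span R (self_mod R) {\<one>} \<subseteq> carrier R"
    using mod_span_minimal[OF S.carrier_is_submodule] by simp
  ultimately have "mod_span R (self_mod R) {\<one>} = carrier (self_mod R)" by simp
  then show ?thesis unfolding fg_module_def
    by (intro conjI exI[of _ "{\<one>}"]) (auto simp: module_self_mod)
qed

lemma (in plain_cring) fg_module_free_mod: "fg_module R (free_mod R n)"
proof -
  interpret F: plain_module R "free_mod R n" by (rule plain_moduleI, rule free_mod_module)
  let ?X = "unit_vec R ` {..<n}"
  have X: "finite ?X" "?X \<subseteq> carrier (free_mod R n)" using unit_vec_closed by auto
  have "carrier (free_mod R n) \<subseteq> mod_span R (free_mod R n) ?X"
    by (rule free_mod_generated[OF F.mod_span_submodule[OF X(2)] mod_span_superset])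
  then have "mod_span R (free_mod R n) ?X = carrier (free_mod R n)"
    using mod_span_minimal[OF F.carrier_is_submodule X(2)] by blast
  then show ?thesis unfolding fg_module_def using F.module_axioms X by blast
qed

lemma (in noetherian_cring) fg_module_sub_mod:
  fixes P :: "('a, 'b) module"
  assumes P: "fg_module R P" and A: "submodule A R P"
  shows "fg_module R (sub_mod P A)"
proof -
  interpret P: plain_module R P using P by (intro plain_moduleI) (simp add: fg_module_def)
  obtain X where X: "finite X" "X \<subseteq> carrier P" "mod_span R P X = carrier P"
    using P unfolding fg_module_def by blast
  obtain Y where Y: "finite Y" "Y \<subseteq> A" "A \<subseteq> mod_span R P Y"
    using P.noetherian_fg_submodule[OF noetherian_ring_axioms X(1,2) A] X(3) P.submoduleE(1)[OF A] by blast
  have "submodule N R (sub_mod P A) \<longleftrightarrow> submodule N R P \<and> N \<subseteq> A" for N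
    by (rule P.submodule_trans[OF A])
  then have "mod_span R (sub_mod P A) Y = A"
    using Y(2,3) A unfolding mod_span_def by blast
  then show ?thesis unfolding fg_module_def using P.sub_mod_module[OF A] Y by auto
qed

lemma lin_sub_mod [simp]: "lin R (sub_mod P A) B E f \<longleftrightarrow> lin R P B E f"
  by (simp add: lin_iff)

text \<open>\<open>not_multiplication\<close> is Ext^1(R/m, W) \<noteq> 0 in elementary terms: the
  sequence 0 -> m -> R -> R/m -> 0 identifies this group with the maps m -> W modulo multiplications
  by elements of W.\<close>

locale canonical_ideal_resolved = injectively_resolved R m x W \<epsilon> E d N
  for R :: "'a ring" (structure) and m x and W :: "'a set" and \<epsilon> :: "'a \<Rightarrow> 'e" and E d N +
  assumes not_multiplication: "\<exists>\<phi>. lin R (self_mod R) m (ideal_mod R W) \<phi> \<and> \<not> (\<exists>c\<in>W. \<forall>r\<in>m. \<phi> r = r \<otimes> c)"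
begin

lemma lin_W_closed: "lin R P A (ideal_mod R W) f \<Longrightarrow> u \<in> A \<Longrightarrow> f u \<in> carrier R"
  using lin_closed W_closed by fastforce

text \<open>If P is not zero, Nakayama gives a copy of R/m in P/xP, say (xP + Ry)/xP. Since Ext^1(xP
  + Ry, W) = 0, the group Ext^1(R/m, W) is a quotient of Hom(xP, W). The latter is isomorphic to
  Hom(P, W) = 0, a contradiction.\<close>

lemma dual_zero_imp_zero:
  fixes P :: "('a, 'b) module"
  assumes P: "fg_module R P" and tf: "\<And>p. p \<in> carrier P \<Longrightarrow> x \<odot>\<^bsub>P\<^esub> p = \<zero>\<^bsub>P\<^esub> \<Longrightarrow> p = \<zero>\<^bsub>P\<^esub>"
    and dual: "\<And>f p. lin R P (carrier P) (ideal_mod R W) f \<Longrightarrow> p \<in> carrier P \<Longrightarrow> f p = \<zero>"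
  shows "carrier P = {\<zero>\<^bsub>P\<^esub>}"
proof (rule ccontr)
  assume nz: "carrier P \<noteq> {\<zero>\<^bsub>P\<^esub>}"
  have Pm: "module R P" using P by (simp add: fg_module_def)
  interpret P: plain_module R P by (rule plain_moduleI, rule Pm)
  obtain X where X: "finite X" "X \<subseteq> carrier P" "mod_span R P X = carrier P"
    using P unfolding fg_module_def by blast
  have zero_sub: "submodule {\<zero>\<^bsub>P\<^esub>} R P" by (rule P.submoduleI') auto
  define A where "A = (\<lambda>p. x \<odot>\<^bsub>P\<^esub> p) ` carrier P"
  have A: "submodule A R P"
  proof (rule P.submoduleI')
    show "A \<subseteq> carrier P" unfolding A_def using x_closed by auto
    show "\<zero>\<^bsub>P\<^esub> \<in> A" unfolding A_def by (rule image_eqI[of _ _ "\<zero>\<^bsub>P\<^esub>"]) (use x_closed in auto)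
    show "a \<oplus>\<^bsub>P\<^esub> b \<in> A" if "a \<in> A" "b \<in> A" for a b
      using that x_closed unfolding A_def by (auto simp: P.smult_r_distr[symmetric])
    show "r \<odot>\<^bsub>P\<^esub> a \<in> A" if r: "r \<in> carrier R" and a: "a \<in> A" for r a
    proof -
      obtain p where p: "p \<in> carrier P" "a = x \<odot>\<^bsub>P\<^esub> p" using a unfolding A_def by blast
      have "r \<odot>\<^bsub>P\<^esub> a = x \<odot>\<^bsub>P\<^esub> (r \<odot>\<^bsub>P\<^esub> p)"
        using p r x_closed by (simp add: P.smult_assoc1[symmetric] m_comm)
      then show ?thesis unfolding A_def using p r by auto
    qed
  qed
  have "\<exists>y\<in>carrier P. y \<notin> A"
  proof (rule ccontr)
    assume "\<not> ?thesis"
    then have all: "carrier P \<subseteq> A" by blast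
    have "X \<subseteq> {\<zero>\<^bsub>P\<^esub>}"
    proof (rule nakayama[OF Pm zero_sub x(1) X(1,2)])
      fix y assume "y \<in> X"
      then obtain b where "b \<in> carrier P" "y = x \<odot>\<^bsub>P\<^esub> b" using all X(2) unfolding A_def by blast
      then show "\<exists>n\<in>{\<zero>\<^bsub>P\<^esub>}. \<exists>b\<in>mod_span R P X. y = n \<oplus>\<^bsub>P\<^esub> x \<odot>\<^bsub>P\<^esub> b"
        using X(3) x_closed by (intro bexI[of _ "\<zero>\<^bsub>P\<^esub>"] bexI[of _ b]) auto
    qed
    then have "carrier P \<subseteq> {\<zero>\<^bsub>P\<^esub>}" using mod_span_minimal[OF zero_sub] X(3) by blast
    then show False using nz by auto
  qed
  then obtain y0 where y0: "y0 \<in> carrier P" "y0 \<notin> A" by blast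
  obtain y where y: "y \<in> carrier P" "colon R P A y = m"
  proof -
    have "x \<odot>\<^bsub>P\<^esub> y0 \<in> A" unfolding A_def using y0 by blast
    then obtain r where "r \<in> carrier R" "colon R P A (r \<odot>\<^bsub>P\<^esub> y0) = m"
      using socle_element[OF Pm A y0 x] by metis
    then show ?thesis using that[of "r \<odot>\<^bsub>P\<^esub> y0"] y0 by simp
  qed
  obtain n p where p: "\<And>i. i < (n::nat) \<Longrightarrow> p i \<in> carrier P"
    and gen: "\<And>y. y \<in> carrier P \<Longrightarrow> \<exists>t\<in>carrier (free_mod R n). y = lincomb P t p n"
    using P.fg_module_lincomb[OF P] by metis
  obtain \<phi> where \<phi>: "lin R (self_mod R) m (ideal_mod R W) \<phi>" "\<not> (\<exists>c\<in>W. \<forall>r\<in>m. \<phi> r = r \<otimes> c)"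
    using not_multiplication by blast
  let ?F = "free_mod R (Suc n)"
  interpret FP: module_pair R ?F P
    by (rule module_pairI[OF free_mod_module Pm])
  interpret FW: module_pair R ?F "ideal_mod R W"
    by (rule module_pairI[OF free_mod_module WM.module_axioms])
  \<comment> \<open>L maps onto xP + Ry. On its kernel the last coordinate lies in m, because y is a
    socle element modulo xP, so \<phi> can be applied to it.\<close>
  define L where "L t = lincomb P t (\<lambda>i. x \<odot>\<^bsub>P\<^esub> p i) n \<oplus>\<^bsub>P\<^esub> t n \<odot>\<^bsub>P\<^esub> y" for t
  have Lx: "L t = x \<odot>\<^bsub>P\<^esub> lincomb P t p n \<oplus>\<^bsub>P\<^esub> t n \<odot>\<^bsub>P\<^esub> y" if "\<And>i. t i \<in> carrier R" for t
    unfolding L_def using that P.lincomb_smult_right[of n p t x] p x_closed by simp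
  have L: "lin R ?F (carrier ?F) P L"
  proof -
    have "lin R ?F (carrier ?F) P (\<lambda>t. lincomb P t (\<lambda>i. if i < n then x \<odot>\<^bsub>P\<^esub> p i else y) (Suc n))"
      by (rule P.lincomb_lin) (use p y x_closed in auto)
    moreover have "lincomb P t (\<lambda>i. if i < n then x \<odot>\<^bsub>P\<^esub> p i else y) n = lincomb P t (\<lambda>i. x \<odot>\<^bsub>P\<^esub> p i) n" for t
      by (rule P.lincomb_cong) auto
    ultimately show ?thesis by (simp add: L_def[abs_def])
  qed
  let ?Z = "{t \<in> carrier ?F. L t \<in> {\<zero>\<^bsub>P\<^esub>}}"
  have Z: "submodule ?Z R ?F" by (rule FP.lin_vimage_submodule[OF L FP.P.carrier_is_submodule zero_sub])
  have Zm: "t n \<in> m" if t: "t \<in> ?Z" for t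
  proof -
    have tR: "\<And>i. t i \<in> carrier R" using t by (auto simp: free_mod_simps)
    have c: "lincomb P t p n \<in> carrier P" by (rule P.lincomb_closed) (use tR p in auto)
    then have "x \<odot>\<^bsub>P\<^esub> lincomb P t p n \<in> A" unfolding A_def by blast
    then have "\<ominus>\<^bsub>P\<^esub> (x \<odot>\<^bsub>P\<^esub> lincomb P t p n) \<in> A" by (rule P.submoduleE(3)[OF A])
    moreover have "t n \<odot>\<^bsub>P\<^esub> y = \<ominus>\<^bsub>P\<^esub> (x \<odot>\<^bsub>P\<^esub> lincomb P t p n)"
      using Lx[OF tR] t c x_closed y(1) tR P.M.minus_equality[of "t n \<odot>\<^bsub>P\<^esub> y" "x \<odot>\<^bsub>P\<^esub> lincomb P t p n"]
      by (simp add: P.M.a_comm)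
    ultimately show ?thesis unfolding y(2)[symmetric] colon_def using tR by simp
  qed
  have pure: "t \<in> ?Z" if t: "t \<in> carrier ?F" "x \<odot>\<^bsub>?F\<^esub> t \<in> ?Z" for t
    using tf[OF lin_closed[OF L t(1)]] lin_smult[OF L x_closed t(1)] t by simp
  have g: "lin R ?F ?Z (ideal_mod R W) (\<lambda>t. \<phi> (t n))"
    by (rule linI) (use Zm lin_closed[OF \<phi>(1)] lin_add[OF \<phi>(1)] lin_smult[OF \<phi>(1)] in \<open>auto simp: free_mod_simps\<close>)
  obtain G where G: "lin R ?F (carrier ?F) (ideal_mod R W) G" "\<And>t. t \<in> ?Z \<Longrightarrow> G t = \<phi> (t n)"
  proof (rule extend[OF fg_module_free_mod Z _ g])
    show "t \<in> ?Z" if "t \<in> carrier ?F" "x \<odot>\<^bsub>?F\<^esub> t \<in> ?Z" for t by (rule pure[OF that])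
  qed blast
  let ?w = "\<lambda>i. G (unit_vec R i)"
  have wW: "?w i \<in> W" if "i < Suc n" for i using lin_closed[OF G(1) unit_vec_closed[OF that]] by simp
  have Glc: "G t = lincomb (ideal_mod R W) t ?w n \<oplus> t n \<otimes> ?w n" if t: "t \<in> carrier ?F" for t
  proof -
    have "G t = G (lincomb ?F t (unit_vec R) (Suc n))" using lincomb_unit_vecs[OF t] by simp
    also have "\<dots> = lincomb (ideal_mod R W) t ?w (Suc n)"
      by (rule FW.lin_lincomb[OF G(1) FP.P.carrier_is_submodule])
        (use t unit_vec_closed in \<open>auto simp: free_mod_simps\<close>)
    finally show ?thesis by simp
  qed
  have \<phi>0: "\<phi> \<zero> = \<zero>"
    using lin_smult[OF \<phi>(1) zero_closed m.zero_closed] lin_W_closed[OF \<phi>(1) m.zero_closed] by simp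
  \<comment> \<open>On relations with last coordinate 0 the extension G equals \<phi>(0) = 0, so its
    first n coefficients define a form on P. That form is zero by hypothesis, and only the last
    coefficient contributes.\<close>
  obtain f where f: "lin R P (carrier P) (ideal_mod R W) f"
    "\<And>t. t \<in> carrier (free_mod R n) \<Longrightarrow> f (lincomb P t p n) = lincomb (ideal_mod R W) t ?w n"
  proof (rule lin_of_lincomb[OF Pm WM.module_axioms, of n p ?w])
    fix t assume t: "t \<in> carrier (free_mod R n)" "lincomb P t p n = \<zero>\<^bsub>P\<^esub>"
    have tR: "t i \<in> carrier R" and tn: "t n = \<zero>" and tF: "t \<in> carrier ?F" for i
      using t(1) by (auto simp: free_mod_simps)
    have "L t = \<zero>\<^bsub>P\<^esub>" using Lx[OF tR] tn t(2) y(1) x_closed by simp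
    then have "G t = \<zero>" using G(2)[of t] tF tn \<phi>0 by simp
    moreover have "lincomb (ideal_mod R W) t ?w n \<in> W"
      using WM.lincomb_closed[of n t ?w] tR wW by simp
    ultimately show "lincomb (ideal_mod R W) t ?w n = \<zero>\<^bsub>ideal_mod R W\<^esub>"
      using Glc[OF tF] tn wW[of n] W_closed by simp
  qed (use p gen wW in auto)
  have w0: "lincomb (ideal_mod R W) t ?w n = \<zero>" if t: "t \<in> carrier (free_mod R n)" for t
  proof -
    have "lincomb P t p n \<in> carrier P" by (rule P.lincomb_closed) (use t p in \<open>auto simp: free_mod_simps\<close>)
    then show ?thesis using dual[OF f(1)] f(2)[OF t] by simp
  qed
  \<comment> \<open>As ry lies in xP, some element of the kernel of L has last coordinate r; there G
    equals both \<phi>(r) and r times its last coefficient.\<close>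
  have "\<phi> r = r \<otimes> ?w n" if r: "r \<in> m" for r
  proof -
    have rc: "r \<in> carrier R" "r \<odot>\<^bsub>P\<^esub> y \<in> A" using r unfolding y(2)[symmetric] colon_def by auto
    then have "\<ominus>\<^bsub>P\<^esub> (r \<odot>\<^bsub>P\<^esub> y) \<in> A" using P.submoduleE(3)[OF A] by blast
    then obtain z where z: "z \<in> carrier P" "\<ominus>\<^bsub>P\<^esub> (r \<odot>\<^bsub>P\<^esub> y) = x \<odot>\<^bsub>P\<^esub> z" unfolding A_def by blast
    obtain t where t: "t \<in> carrier (free_mod R n)" "z = lincomb P t p n" using gen[OF z(1)] by blast
    define s where "s = t(n := r)"
    have s: "s \<in> carrier ?F" "\<And>i. s i \<in> carrier R" "s n = r"
      using t(1) rc by (auto simp: s_def free_mod_simps)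
    have "lincomb P s p n = z" unfolding t(2) by (rule P.lincomb_cong) (auto simp: s_def)
    then have "L s = \<zero>\<^bsub>P\<^esub>" using Lx[OF s(2)] s(3) z(2)[symmetric] y(1) rc by (simp add: P.M.l_neg)
    then have "\<phi> r = G s" using G(2)[of s] s by simp
    moreover have "lincomb (ideal_mod R W) s ?w n = lincomb (ideal_mod R W) t ?w n"
      by (rule WM.lincomb_cong) (auto simp: s_def)
    ultimately show ?thesis using Glc[OF s(1)] w0[OF t(1)] s(3) rc wW[of n] W_closed by simp
  qed
  then show False using \<phi>(2) wW[of n] by blast
qed

text \<open>The elements killed by all forms make up a pure submodule, because W has no x-torsion.
  Forms on it extend to P and hence vanish, so this submodule has zero dual and is zero.\<close>

lemma dual_separates:
  fixes P :: "('a, 'b) module"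
  assumes P: "fg_module R P" and tf: "\<And>p. p \<in> carrier P \<Longrightarrow> x \<odot>\<^bsub>P\<^esub> p = \<zero>\<^bsub>P\<^esub> \<Longrightarrow> p = \<zero>\<^bsub>P\<^esub>"
    and z: "z \<in> carrier P" and dual: "\<And>f. lin R P (carrier P) (ideal_mod R W) f \<Longrightarrow> f z = \<zero>"
  shows "z = \<zero>\<^bsub>P\<^esub>"
proof -
  have Pm: "module R P" using P by (simp add: fg_module_def)
  interpret PW: module_pair R P "ideal_mod R W"
    by (rule module_pairI[OF Pm WM.module_axioms])
  let ?Z = "{z \<in> carrier P. \<forall>f. lin R P (carrier P) (ideal_mod R W) f \<longrightarrow> f z = \<zero>}"
  have Z: "submodule ?Z R P"
  proof (rule PW.P.submoduleI')
    show "\<zero>\<^bsub>P\<^esub> \<in> ?Z" using PW.lin_zero[OF _ PW.P.carrier_is_submodule] by auto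
    show "u \<oplus>\<^bsub>P\<^esub> v \<in> ?Z" if uv: "u \<in> ?Z" "v \<in> ?Z" for u v
    proof -
      have "f (u \<oplus>\<^bsub>P\<^esub> v) = \<zero>" if f: "lin R P (carrier P) (ideal_mod R W) f" for f
      proof -
        have "f u = \<zero>" "f v = \<zero>" using uv f by blast+
        moreover have "u \<in> carrier P" "v \<in> carrier P" using uv by blast+
        ultimately show ?thesis using lin_add[OF f, of u v] by simp
      qed
      then show ?thesis using uv by simp
    qed
    show "r \<odot>\<^bsub>P\<^esub> u \<in> ?Z" if r: "r \<in> carrier R" and u: "u \<in> ?Z" for r u
    proof -
      have "f (r \<odot>\<^bsub>P\<^esub> u) = \<zero>" if f: "lin R P (carrier P) (ideal_mod R W) f" for f
      proof -
        have "f u = \<zero>" "u \<in> carrier P" using u f by blast+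
        then show ?thesis using r lin_smult[OF f r, of u] by simp
      qed
      then show ?thesis using u r by simp
    qed
  qed auto
  have pure: "p \<in> ?Z" if p: "p \<in> carrier P" "x \<odot>\<^bsub>P\<^esub> p \<in> ?Z" for p
  proof -
    have "f p = \<zero>" if f: "lin R P (carrier P) (ideal_mod R W) f" for f
    proof -
      have "f (x \<odot>\<^bsub>P\<^esub> p) = \<zero>" using p f by blast
      then show ?thesis using lin_smult[OF f x_closed p(1)] x_cancel[OF lin_W_closed[OF f p(1)]] by simp
    qed
    then show ?thesis using p by simp
  qed
  have "carrier (sub_mod P ?Z) = {\<zero>\<^bsub>sub_mod P ?Z\<^esub>}"
  proof (rule dual_zero_imp_zero[OF fg_module_sub_mod[OF P Z]])
    show "p = \<zero>\<^bsub>sub_mod P ?Z\<^esub>" if "p \<in> carrier (sub_mod P ?Z)" "x \<odot>\<^bsub>sub_mod P ?Z\<^esub> p = \<zero>\<^bsub>sub_mod P ?Z\<^esub>" for p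
      using tf that by simp
    fix f p assume "lin R (sub_mod P ?Z) (carrier (sub_mod P ?Z)) (ideal_mod R W) f" and p: "p \<in> carrier (sub_mod P ?Z)"
    then have f: "lin R P ?Z (ideal_mod R W) f" by simp
    obtain G where G: "lin R P (carrier P) (ideal_mod R W) G" "\<And>z. z \<in> ?Z \<Longrightarrow> G z = f z"
    proof (rule extend[OF P Z _ f])
      show "p \<in> ?Z" if "p \<in> carrier P" "x \<odot>\<^bsub>P\<^esub> p \<in> ?Z" for p by (rule pure[OF that])
    qed blast
    then show "f p = \<zero>" using p by auto
  qed
  then show ?thesis using z dual by auto
qed

text \<open>A form on R is multiplication by its value at 1, an element of W; so y is killed by all
  forms on R, and these separate points.\<close>

lemma W_faithful:
  assumes y: "y \<in> carrier R" and yW: "\<And>w. w \<in> W \<Longrightarrow> y \<otimes> w = \<zero>"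
  shows "y = \<zero>"
proof -
  have "y = \<zero>\<^bsub>self_mod R\<^esub>"
  proof (rule dual_separates[OF fg_module_self_mod])
    fix f assume f: "lin R (self_mod R) (carrier (self_mod R)) (ideal_mod R W) f"
    have "f y = y \<otimes> f \<one>" using lin_smult[OF f y, of \<one>] y by simp
    then show "f y = \<zero>" using yW lin_closed[OF f, of \<one>] by simp
  qed (use y x_cancel in auto)
  then show ?thesis by simp
qed

text \<open>This is Hom(W, W) = R for the endomorphism b/a. Otherwise a multiple c of b is a socle
  element modulo a. Every map aR -> W, a \<mapsto> w, extends to aR + cR by c \<mapsto> w' with cw =
  aw'; together with Ext^1(aR + cR, W) = 0 this would make Ext^1(R/m, W) vanish.\<close>

lemma mult_W_into_aW:
  assumes a: "a \<in> W" "a \<in> nonzerodivisors R" and b: "b \<in> carrier R"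
    and bW: "\<And>w. w \<in> W \<Longrightarrow> \<exists>w'\<in>W. b \<otimes> w = a \<otimes> w'"
  shows "\<exists>r\<in>carrier R. b = a \<otimes> r"
proof (rule ccontr)
  assume no: "\<not> ?thesis"
  have ac: "a \<in> carrier R" using a W_closed by blast
  interpret A: ideal "PIdl a" R by (rule cgenideal_ideal[OF ac])
  have As: "submodule (PIdl a) R (self_mod R)" by (simp add: submodule_self_mod_iff A.ideal_axioms)
  have bA: "b \<notin> PIdl a" using no m_comm[OF ac] unfolding cgenideal_def by auto
  \<comment> \<open>For a unit a the claim is immediate; membership in m allows a to be the regular
    element of \<open>socle_element\<close>.\<close>
  have am: "a \<in> m"
  proof (rule ccontr)
    assume "a \<notin> m"
    then have "a \<in> Units R" using Units_if_notin_m ac by blast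
    then have "b = a \<otimes> (inv a \<otimes> b)" using ac b by (simp add: m_assoc[symmetric])
    then show False using no \<open>a \<in> Units R\<close> b by blast
  qed
  have "a \<otimes> b \<in> PIdl a" using A.I_r_closed[OF cgenideal_self[OF ac] b] .
  then obtain s where s: "s \<in> carrier R" "colon R (self_mod R) (PIdl a) (s \<otimes> b) = m"
    using socle_element[OF module_self_mod As _ bA am a(2)] b by (metis self_mod_simps(1,4))
  define c where "c = s \<otimes> b"
  have c: "c \<in> carrier R" "\<And>r. r \<in> carrier R \<Longrightarrow> r \<in> m \<longleftrightarrow> r \<otimes> c \<in> PIdl a"
    using s b by (auto simp: c_def colon_def)
  have cW: "\<exists>w'\<in>W. c \<otimes> w = a \<otimes> w'" if w: "w \<in> W" for w
  proof -
    obtain w' where w': "w' \<in> W" "b \<otimes> w = a \<otimes> w'" using bW[OF w] by blast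
    have "c \<otimes> w = a \<otimes> (s \<otimes> w')"
      unfolding c_def using s b ac w' W_closed[OF w] W_closed[OF w'(1)] by (simp add: m_assoc m_lcomm)
    then show ?thesis using ideal.I_l_closed[OF W w'(1) s(1)] by blast
  qed
  obtain \<phi> where \<phi>: "lin R (self_mod R) m (ideal_mod R W) \<phi>" "\<not> (\<exists>c\<in>W. \<forall>r\<in>m. \<phi> r = r \<otimes> c)"
    using not_multiplication by blast
  let ?F = "free_mod R 2"
  interpret FS: module_pair R ?F "self_mod R"
    by (rule module_pairI[OF free_mod_module module_self_mod])
  define L where "L t = t 0 \<otimes> a \<oplus> t 1 \<otimes> c" for t :: "nat \<Rightarrow> 'a"
  have L: "lin R ?F (carrier ?F) (self_mod R) L"
    by (rule linI) (use ac c in \<open>auto simp: L_def free_mod_simps l_distr r_distr m_assoc a_ac\<close>)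
  have zero_sub: "submodule {\<zero>} R (self_mod R)" using zeroideal by (simp add: submodule_self_mod_iff)
  let ?Z = "{t \<in> carrier ?F. L t \<in> {\<zero>}}"
  have Z: "submodule ?Z R ?F" by (rule FS.lin_vimage_submodule[OF L FS.P.carrier_is_submodule zero_sub])
  have Zm: "t 1 \<in> m" if t: "t \<in> ?Z" for t
  proof -
    have tR: "\<And>i. t i \<in> carrier R" using t by (auto simp: free_mod_simps)
    have "t 1 \<otimes> c = \<ominus> (t 0) \<otimes> a"
      using t tR ac c(1) minus_equality[of "t 1 \<otimes> c" "t 0 \<otimes> a"] by (simp add: L_def a_comm l_minus)
    moreover have "\<ominus> (t 0) \<otimes> a \<in> PIdl a" unfolding cgenideal_def using tR by blast
    ultimately show ?thesis using c(2) tR by simp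
  qed
  have pure: "t \<in> ?Z" if t: "t \<in> carrier ?F" "x \<odot>\<^bsub>?F\<^esub> t \<in> ?Z" for t
    using x_cancel[of "L t"] lin_closed[OF L t(1)] lin_smult[OF L x_closed t(1)] t by simp
  have g: "lin R ?F ?Z (ideal_mod R W) (\<lambda>t. \<phi> (t 1))"
  proof (rule linI)
    show "\<phi> (u 1) \<in> carrier (ideal_mod R W)" if "u \<in> ?Z" for u
      using lin_closed[OF \<phi>(1) Zm[OF that]] .
    show "\<phi> ((u \<oplus>\<^bsub>?F\<^esub> v) 1) = \<phi> (u 1) \<oplus>\<^bsub>ideal_mod R W\<^esub> \<phi> (v 1)" if "u \<in> ?Z" "v \<in> ?Z" for u v
      using lin_add[OF \<phi>(1) Zm[OF that(1)] Zm[OF that(2)]] by (simp add: free_mod_simps)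
    show "\<phi> ((r \<odot>\<^bsub>?F\<^esub> u) 1) = r \<odot>\<^bsub>ideal_mod R W\<^esub> \<phi> (u 1)" if "r \<in> carrier R" "u \<in> ?Z" for r u
      using lin_smult[OF \<phi>(1) that(1) Zm[OF that(2)]] by (simp add: free_mod_simps)
  qed
  obtain G where G: "lin R ?F (carrier ?F) (ideal_mod R W) G" "\<And>t. t \<in> ?Z \<Longrightarrow> G t = \<phi> (t 1)"
  proof (rule extend[OF fg_module_free_mod Z _ g])
    show "t \<in> ?Z" if "t \<in> carrier ?F" "x \<odot>\<^bsub>?F\<^esub> t \<in> ?Z" for t by (rule pure[OF that])
  qed blast
  let ?w = "\<lambda>i. G (unit_vec R i)"
  have u: "unit_vec R 0 \<in> carrier ?F" "unit_vec R 1 \<in> carrier ?F" by (simp_all add: unit_vec_closed)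
  have wW: "?w 0 \<in> W" "?w 1 \<in> W" using lin_closed[OF G(1) u(1)] lin_closed[OF G(1) u(2)] by simp_all
  obtain w' where w': "w' \<in> W" "c \<otimes> ?w 0 = a \<otimes> w'" using cW[OF wW(1)] by blast
  note wc = W_closed[OF wW(1)] W_closed[OF wW(2)] W_closed[OF w'(1)]
  have "\<phi> r = r \<otimes> (?w 1 \<ominus> w')" if r: "r \<in> m" for r
  proof -
    have rc: "r \<in> carrier R" using r m.Icarr by blast
    obtain v where v: "v \<in> carrier R" "r \<otimes> c = v \<otimes> a" using c(2)[OF rc] r unfolding cgenideal_def by blast
    let ?t = "(\<ominus> v) \<odot>\<^bsub>?F\<^esub> unit_vec R 0 \<oplus>\<^bsub>?F\<^esub> r \<odot>\<^bsub>?F\<^esub> unit_vec R 1"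
    have t: "?t \<in> carrier ?F" "?t 0 = \<ominus> v" "?t 1 = r"
      using u v rc FS.P.M.add.m_closed FS.P.smult_closed by (auto simp: free_mod_simps unit_vec_def)
    have "L ?t = \<zero>" unfolding L_def t(2,3) v(2) using v ac by (simp add: l_minus l_neg)
    then have "\<phi> r = G ?t" using G(2)[of ?t] t by simp
    also have "\<dots> = (\<ominus> v) \<otimes> ?w 0 \<oplus> r \<otimes> ?w 1"
      using lin_add[OF G(1)] lin_smult[OF G(1)] u v rc FS.P.smult_closed by simp
    finally have \<phi>r: "\<phi> r = (\<ominus> v) \<otimes> ?w 0 \<oplus> r \<otimes> ?w 1" .
    \<comment> \<open>Multiplied by a, the term v w_0 becomes rc w_0 = ar w'. Cancelling a turns it
      into a multiple of r, so that \<phi>(r) = r(w_1 - w').\<close>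
    have "a \<otimes> (v \<otimes> ?w 0) = (v \<otimes> a) \<otimes> ?w 0" using ac v(1) wc by (simp add: m_ac)
    also have "\<dots> = r \<otimes> (c \<otimes> ?w 0)" using v(2)[symmetric] rc c(1) wc by (simp add: m_assoc)
    also have "\<dots> = a \<otimes> (r \<otimes> w')" using w'(2) rc ac wc by (simp add: m_lcomm)
    finally have "v \<otimes> ?w 0 = r \<otimes> w'" using nzd_cancel[OF a(2)] v(1) rc wc by simp
    then show ?thesis using \<phi>r v(1) rc wc by (simp add: l_minus a_minus_def r_distr r_minus a_comm)
  qed
  moreover have "?w 1 \<ominus> w' \<in> W"
    using RM.submodule_minus[OF W_submodule wW(2) w'(1)] by simp
  ultimately show False using \<phi>(2) by blast
qed

end

section \<open>The dual Hom(P, W) and biduality\<close>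

lemma Hom_mod_simps [simp]:
  "carrier (Hom_mod R M N) = mod_hom R M N \<inter> extensional (carrier M)"
  "zero (Hom_mod R M N) = (\<lambda>x\<in>carrier M. \<zero>\<^bsub>N\<^esub>)"
  "add (Hom_mod R M N) = (\<lambda>f g. \<lambda>x\<in>carrier M. f x \<oplus>\<^bsub>N\<^esub> g x)"
  "smult (Hom_mod R M N) = (\<lambda>a f. \<lambda>x\<in>carrier M. a \<odot>\<^bsub>N\<^esub> f x)"
  by (simp_all add: Hom_mod_def)

lemma Hom_mod_iff: "f \<in> carrier (Hom_mod R M N) \<longleftrightarrow> lin R M (carrier M) N f \<and> f \<in> extensional (carrier M)"
  by (simp add: mod_hom_iff_lin)

context plain_module
begin

lemma restrict_lin:
  assumes f: "lin R M (carrier M) N f"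
  shows "restrict f (carrier M) \<in> carrier (Hom_mod R M N)"
  unfolding Hom_mod_iff by (auto intro: lin_cong[OF f carrier_is_submodule module_axioms])

end

context module_pair
begin

lemma Hom_add_closed:
  assumes "f \<in> carrier (Hom_mod R P E)" "g \<in> carrier (Hom_mod R P E)"
  shows "f \<oplus>\<^bsub>Hom_mod R P E\<^esub> g \<in> carrier (Hom_mod R P E)"
  using P.restrict_lin[OF lin_add_fun[of "carrier P" f g]] assms by (simp add: mod_hom_iff_lin)

lemma Hom_smult_closed:
  assumes "c \<in> carrier R" "f \<in> carrier (Hom_mod R P E)"
  shows "c \<odot>\<^bsub>Hom_mod R P E\<^esub> f \<in> carrier (Hom_mod R P E)"
  using P.restrict_lin[OF lin_smult_fun[of "carrier P" f c]] assms by (simp add: mod_hom_iff_lin)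

end

context canonical_ideal_resolved
begin

text \<open>Linearity gives f(a)w = f(aw) = a f(w), so f is multiplication by f(a)/a and f(a)W lies
  in aW; \<open>mult_W_into_aW\<close> puts the fraction into R.\<close>

lemma endomorphism_is_multiplication:
  assumes a: "a \<in> W" "a \<in> nonzerodivisors R" and f: "lin R (self_mod R) W (ideal_mod R W) f"
  shows "\<exists>r\<in>carrier R. \<forall>w\<in>W. f w = r \<otimes> w"
proof -
  have ac: "a \<in> carrier R" using a W_closed by blast
  have fc: "f w \<in> W" "f w \<in> carrier R" if "w \<in> W" for w
    using lin_closed[OF f that] W_closed by simp_all
  have comm: "f a \<otimes> w = a \<otimes> f w" if w: "w \<in> W" for w
  proof -
    have "w \<otimes> f a = f (w \<otimes> a)" using lin_smult[OF f W_closed[OF w] a(1)] by simp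
    also have "\<dots> = f (a \<otimes> w)" using ac W_closed[OF w] by (simp add: m_comm)
    also have "\<dots> = a \<otimes> f w" using lin_smult[OF f ac w] by simp
    finally show ?thesis using fc(2)[OF a(1)] W_closed[OF w] by (simp add: m_comm)
  qed
  obtain r where r: "r \<in> carrier R" "f a = a \<otimes> r"
    using mult_W_into_aW[OF a fc(2)[OF a(1)]] comm fc(1) by blast
  have "f w = r \<otimes> w" if w: "w \<in> W" for w
  proof (rule nzd_cancel[OF a(2)])
    show "a \<otimes> f w = a \<otimes> (r \<otimes> w)" using comm[OF w] r ac W_closed[OF w] by (simp add: m_assoc)
  qed (use fc r W_closed[OF w] w in auto)
  then show ?thesis using r by blast
qed

text \<open>Biduality: with generators \<open>p\<^sub>0, \<dots>, p\<^sub>n\<^sub>-\<^sub>1\<close> of \<open>P\<close>, \<open>f \<mapsto> (f p\<^sub>i)\<^sub>i\<close> embeds \<open>Hom(P, W)\<close> into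
  \<open>W\<^sup>n\<close> with torsion-free cokernel, so \<open>\<Theta>\<close> extends to \<open>W\<^sup>n\<close>, where it is given by ring elements.\<close>

lemma dual_evaluation:
  fixes P :: "('a, 'b) module"
  assumes P: "fg_module R P" and a: "a \<in> W" "a \<in> nonzerodivisors R"
    and \<Theta>: "lin R (Hom_mod R P (ideal_mod R W)) (carrier (Hom_mod R P (ideal_mod R W))) (ideal_mod R W) \<Theta>"
  shows "\<exists>z\<in>carrier P. \<forall>f\<in>carrier (Hom_mod R P (ideal_mod R W)). \<Theta> f = f z"
proof -
  let ?D = "Hom_mod R P (ideal_mod R W)"
  have Pm: "module R P" using P by (simp add: fg_module_def)
  interpret PW: module_pair R P "ideal_mod R W"
    by (rule module_pairI[OF Pm WM.module_axioms])
  obtain n p where p: "\<And>i. i < (n::nat) \<Longrightarrow> p i \<in> carrier P"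
    and gen: "\<And>y. y \<in> carrier P \<Longrightarrow> \<exists>t\<in>carrier (free_mod R n). y = lincomb P t p n"
    using PW.P.fg_module_lincomb[OF P] by metis
  let ?F = "free_mod R n"
  interpret FW: module_pair R ?F "ideal_mod R W"
    by (rule module_pairI[OF free_mod_module WM.module_axioms])
  have flin: "lin R P (carrier P) (ideal_mod R W) f" and fext: "f \<in> extensional (carrier P)" if "f \<in> carrier ?D" for f
    using that by (simp_all add: mod_hom_iff_lin)
  have fc: "f q \<in> W" if "f \<in> carrier ?D" "q \<in> carrier P" for f q
    using lin_closed[OF flin[OF that(1)] that(2)] by simp
  have flc: "f (lincomb P t p n) = lincomb (ideal_mod R W) t (\<lambda>i. f (p i)) n"
    if "f \<in> carrier ?D" "t \<in> carrier ?F" for f t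
    by (rule PW.lin_lincomb[OF flin[OF that(1)] PW.P.carrier_is_submodule])
      (use that(2) p in \<open>auto simp: free_mod_simps\<close>)
  \<comment> \<open>W^n has to be used in place of R^n: the image of Hom(P, W) is pure in W^n,
    whereas in R^n a tuple t with xt in the image need not have entries in W.\<close>
  define VW where "VW = {t \<in> carrier ?F. \<forall>i. t i \<in> W}"
  have W0: "\<zero> \<in> W" using RM.submodule_zero[OF W_submodule] by simp
  have VW: "submodule VW R ?F"
    by (rule FW.P.submoduleI')
      (use W0 RM.submoduleE(4,5)[OF W_submodule] in \<open>auto simp: VW_def free_mod_simps\<close>)
  define V where "V = sub_mod ?F VW"
  have fgV: "fg_module R V" unfolding V_def by (rule fg_module_sub_mod[OF fg_module_free_mod VW])
  then have Vm: "module R V" by (simp add: fg_module_def)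
  interpret VM: module_pair R V "ideal_mod R W"
    by (rule module_pairI[OF Vm WM.module_axioms])
  have V [simp]: "carrier V = VW" "add V = add ?F" "smult V = smult ?F" "zero V = zero ?F"
    by (simp_all add: V_def)
  define G where "G t v \<longleftrightarrow> (\<exists>f\<in>carrier ?D. (\<forall>i<n. f (p i) = t i) \<and> v = \<Theta> f)" for t v
  define Z where "Z = {t \<in> VW. \<exists>v. G t v}"
  have Gadd: "G (t \<oplus>\<^bsub>?F\<^esub> t') (v \<oplus> v')" if G: "G t v" "G t' v'" for t t' v v'
  proof -
    obtain f f' where f: "f \<in> carrier ?D" "f' \<in> carrier ?D" "\<And>i. i < n \<Longrightarrow> f (p i) = t i"
      "\<And>i. i < n \<Longrightarrow> f' (p i) = t' i" "v = \<Theta> f" "v' = \<Theta> f'"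
      using G unfolding G_def by blast
    have "\<Theta> (f \<oplus>\<^bsub>?D\<^esub> f') = v \<oplus> v'" using lin_add[OF \<Theta> f(1,2)] f by simp
    moreover have "(f \<oplus>\<^bsub>?D\<^esub> f') (p i) = (t \<oplus>\<^bsub>?F\<^esub> t') i" if "i < n" for i
      using that p f by (simp add: free_mod_simps)
    ultimately show ?thesis unfolding G_def
      using PW.Hom_add_closed[OF f(1,2)] by (intro bexI[of _ "f \<oplus>\<^bsub>?D\<^esub> f'"]) auto
  qed
  have Gsmult: "G (c \<odot>\<^bsub>?F\<^esub> t) (c \<otimes> v)" if G: "G t v" and c: "c \<in> carrier R" for t v c
  proof -
    obtain f where f: "f \<in> carrier ?D" "\<And>i. i < n \<Longrightarrow> f (p i) = t i" "v = \<Theta> f"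
      using G unfolding G_def by blast
    have "\<Theta> (c \<odot>\<^bsub>?D\<^esub> f) = c \<otimes> v" using lin_smult[OF \<Theta> c f(1)] f by simp
    moreover have "(c \<odot>\<^bsub>?D\<^esub> f) (p i) = (c \<odot>\<^bsub>?F\<^esub> t) i" if "i < n" for i
      using that p f by (simp add: free_mod_simps)
    ultimately show ?thesis unfolding G_def
      using PW.Hom_smult_closed[OF c f(1)] by (intro bexI[of _ "c \<odot>\<^bsub>?D\<^esub> f"]) auto
  qed
  have zeroD: "(\<lambda>q\<in>carrier P. \<zero>) \<in> carrier ?D"
    using PW.P.restrict_lin[OF PW.lin_zero_fun] by simp
  have G0: "G \<zero>\<^bsub>?F\<^esub> (\<Theta> (\<lambda>q\<in>carrier P. \<zero>))"
    unfolding G_def by (rule bexI[OF _ zeroD]) (use p in \<open>simp add: free_mod_simps\<close>)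
  have Z: "submodule Z R V"
  proof (rule VM.P.submoduleI')
    show "\<zero>\<^bsub>V\<^esub> \<in> Z" using G0 FW.P.submodule_zero[OF VW] unfolding Z_def by auto
    show "u \<oplus>\<^bsub>V\<^esub> v \<in> Z" if "u \<in> Z" "v \<in> Z" for u v
      using that Gadd FW.P.submoduleE(5)[OF VW] unfolding Z_def V by blast
    show "r \<odot>\<^bsub>V\<^esub> u \<in> Z" if "r \<in> carrier R" "u \<in> Z" for r u
      using that Gsmult FW.P.submoduleE(4)[OF VW] unfolding Z_def V by blast
  qed (auto simp: Z_def)
  \<comment> \<open>If xt comes from a form f, each relation among the p_i holds for the t_i after
    multiplication by x, hence holds for them; so p_i \<mapsto> t_i is itself a form.\<close>
  have pure: "t \<in> Z" if t: "t \<in> VW" "x \<odot>\<^bsub>V\<^esub> t \<in> Z" for t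
  proof -
    obtain f where f: "f \<in> carrier ?D" "\<And>i. i < n \<Longrightarrow> f (p i) = x \<otimes> t i"
      using t(2) unfolding Z_def G_def V by (auto simp: free_mod_simps)
    have tW: "t i \<in> W" for i using t(1) by (simp add: VW_def)
    obtain h where h: "lin R P (carrier P) (ideal_mod R W) h"
      "\<And>s. s \<in> carrier ?F \<Longrightarrow> h (lincomb P s p n) = lincomb (ideal_mod R W) s t n"
    proof (rule lin_of_lincomb[OF Pm WM.module_axioms, of n p t])
      fix s assume s: "s \<in> carrier ?F" "lincomb P s p n = \<zero>\<^bsub>P\<^esub>"
      have sR: "\<And>i. s i \<in> carrier R" using s(1) by (simp add: free_mod_simps)
      have "\<zero> = f (lincomb P s p n)" using PW.lin_zero[OF flin[OF f(1)] PW.P.carrier_is_submodule] s(2) by simp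
      also have "\<dots> = lincomb (ideal_mod R W) s (\<lambda>i. x \<odot>\<^bsub>ideal_mod R W\<^esub> t i) n"
        unfolding flc[OF f(1) s(1)] by (rule WM.lincomb_cong) (simp_all add: f(2))
      also have "\<dots> = x \<otimes> lincomb (ideal_mod R W) s t n"
        using WM.lincomb_smult_right[of n t s x] tW sR x_closed by simp
      finally show "lincomb (ideal_mod R W) s t n = \<zero>\<^bsub>ideal_mod R W\<^esub>"
        using x_cancel[of "lincomb (ideal_mod R W) s t n"] WM.lincomb_closed[of n s t] tW sR W_closed by simp
    qed (use p gen tW in auto)
    have "restrict h (carrier P) (p i) = t i" if "i < n" for i
    proof -
      have "h (p i) = h (lincomb P (unit_vec R i) p n)" using PW.P.lincomb_unit_vec[of n p i] p that by simp
      also have "\<dots> = t i" using h(2)[OF unit_vec_closed[OF that]] WM.lincomb_unit_vec[of n t i] tW that by simp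
      finally show ?thesis using p that by simp
    qed
    then have "G t (\<Theta> (restrict h (carrier P)))"
      unfolding G_def using PW.P.restrict_lin[OF h(1)] by blast
    then show ?thesis using t(1) unfolding Z_def by blast
  qed
  obtain g where g: "lin R V Z (ideal_mod R W) g" "\<And>t v. t \<in> Z \<Longrightarrow> G t v \<longleftrightarrow> g t = v"
  proof (rule VM.lin_of_graph[OF Z, of G])
    show "v \<in> carrier (ideal_mod R W)" if "G t v" for t v
      using that lin_closed[OF \<Theta>] unfolding G_def by auto
    show "v = \<zero>\<^bsub>ideal_mod R W\<^esub>" if Gv: "G \<zero>\<^bsub>V\<^esub> v" for v
    proof -
      obtain f where f: "f \<in> carrier ?D" "\<And>i. i < n \<Longrightarrow> f (p i) = \<zero>" "v = \<Theta> f"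
        using Gv unfolding G_def V by (auto simp: free_mod_simps)
      have "f q = \<zero>" if q: "q \<in> carrier P" for q
      proof -
        obtain t where t: "t \<in> carrier ?F" "q = lincomb P t p n" using gen[OF q] by blast
        have "f q = lincomb (ideal_mod R W) t (\<lambda>i. \<zero> \<odot>\<^bsub>ideal_mod R W\<^esub> \<zero>) n"
          unfolding t(2) flc[OF f(1) t(1)] by (rule WM.lincomb_cong) (simp_all add: f(2))
        also have "\<dots> = \<zero> \<odot>\<^bsub>ideal_mod R W\<^esub> lincomb (ideal_mod R W) t (\<lambda>i. \<zero>) n"
          by (rule WM.lincomb_smult_right) (use t(1) W0 in \<open>auto simp: free_mod_simps\<close>)
        also have "\<dots> = \<zero>"
          using WM.lincomb_closed[of n t "\<lambda>i. \<zero>"] t(1) W0 W_closed by (simp add: free_mod_simps)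
        finally show ?thesis .
      qed
      \<comment> \<open>Being zero on P and extensional, f equals its multiple by 0, which by
        linearity gives \<Theta>(f) = 0.\<close>
      then have "\<zero> \<odot>\<^bsub>?D\<^esub> f = f" using fext[OF f(1)] by (auto simp: extensional_def fun_eq_iff)
      then have "\<Theta> f = \<zero> \<otimes> \<Theta> f" using lin_smult[OF \<Theta> zero_closed f(1)] by simp
      then show ?thesis using f(3) lin_closed[OF \<Theta> f(1)] W_closed by simp
    qed
    show "\<exists>v. G t v" if "t \<in> Z" for t using that unfolding Z_def by blast
    show "G (t \<oplus>\<^bsub>V\<^esub> t') (v \<oplus>\<^bsub>ideal_mod R W\<^esub> v')" if "G t v" "G t' v'" for t v t' v'
      using Gadd[OF that] by simp
    show "G (c \<odot>\<^bsub>V\<^esub> t) (c \<odot>\<^bsub>ideal_mod R W\<^esub> v)" if "c \<in> carrier R" "G t v" for c t v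
      using Gsmult[OF that(2,1)] by simp
  qed blast
  obtain K where K: "lin R V (carrier V) (ideal_mod R W) K" "\<And>t. t \<in> Z \<Longrightarrow> K t = g t"
  proof (rule extend[OF fgV Z _ g(1)])
    show "t \<in> Z" if "t \<in> carrier V" "x \<odot>\<^bsub>V\<^esub> t \<in> Z" for t by (rule pure) (use that in auto)
  qed blast
  define e where "e i w = (\<lambda>j. if j = i then w else \<zero>)" for i :: nat and w
  have eV: "e i w \<in> VW" if "i < n" "w \<in> W" for i w
    using that W0 W_closed by (auto simp: e_def VW_def free_mod_simps)
  have "\<exists>r\<in>carrier R. \<forall>w\<in>W. K (e i w) = r \<otimes> w" if i: "i < n" for i
  proof (rule endomorphism_is_multiplication[OF a])
    show "lin R (self_mod R) W (ideal_mod R W) (\<lambda>w. K (e i w))"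
    proof (rule linI)
      show "K (e i w) \<in> carrier (ideal_mod R W)" if "w \<in> W" for w
        using lin_closed[OF K(1)] eV[OF i that] by simp
      show "K (e i (w \<oplus>\<^bsub>self_mod R\<^esub> w')) = K (e i w) \<oplus>\<^bsub>ideal_mod R W\<^esub> K (e i w')" if w: "w \<in> W" "w' \<in> W" for w w'
      proof -
        have "e i (w \<oplus> w') = e i w \<oplus>\<^bsub>V\<^esub> e i w'" by (auto simp: e_def free_mod_simps)
        then show ?thesis using lin_add[OF K(1), of "e i w" "e i w'"] eV[OF i] w by simp
      qed
      show "K (e i (c \<odot>\<^bsub>self_mod R\<^esub> w)) = c \<odot>\<^bsub>ideal_mod R W\<^esub> K (e i w)" if w: "c \<in> carrier R" "w \<in> W" for c w
      proof -
        have "e i (c \<otimes> w) = c \<odot>\<^bsub>V\<^esub> e i w" using w by (auto simp: e_def free_mod_simps)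
        then show ?thesis using lin_smult[OF K(1), of c "e i w"] eV[OF i] w by simp
      qed
    qed
  qed
  then obtain r where r: "\<And>i. i < n \<Longrightarrow> r i \<in> carrier R" "\<And>i w. i < n \<Longrightarrow> w \<in> W \<Longrightarrow> K (e i w) = r i \<otimes> w"
    by metis
  have Klc: "K (\<lambda>i. if i < k then t i else \<zero>) = lincomb (ideal_mod R W) r t k" if t: "t \<in> VW" and "k \<le> n" for t k
    using \<open>k \<le> n\<close>
  proof (induction k)
    case 0
    have "(\<lambda>i. \<zero>) = \<zero>\<^bsub>V\<^esub>" by (simp add: free_mod_simps)
    then show ?case using VM.lin_zero[OF K(1) VM.P.carrier_is_submodule] by simp
  next
    case (Suc k)
    have tW: "t i \<in> W" "t i \<in> carrier R" for i using t W_closed by (auto simp: VW_def)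
    have "(\<lambda>i. if i < k then t i else \<zero>) \<in> VW" using Suc.prems tW W0 by (auto simp: VW_def free_mod_simps)
    moreover have "(\<lambda>i. if i < Suc k then t i else \<zero>) = (\<lambda>i. if i < k then t i else \<zero>) \<oplus>\<^bsub>V\<^esub> e k (t k)"
      using tW by (auto simp: e_def free_mod_simps fun_eq_iff less_Suc_eq)
    ultimately show ?case
      using lin_add[OF K(1), of "\<lambda>i. if i < k then t i else \<zero>" "e k (t k)"] eV[of k "t k"] Suc r(2)[of k "t k"] tW
      by simp
  qed
  \<comment> \<open>The multipliers r_i of the extension are the coordinates of the required
    element, since the sum of the r_i f(p_i) is f of the sum of the r_i p_i.\<close>
  let ?z = "lincomb P r p n"
  have zc: "?z \<in> carrier P" by (rule PW.P.lincomb_closed) (use r(1) p in auto)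
  have "\<Theta> f = f ?z" if f: "f \<in> carrier ?D" for f
  proof -
    let ?t = "\<lambda>i. if i < n then f (p i) else \<zero>"
    have t: "?t \<in> VW" using fc[OF f] p W0 W_closed by (auto simp: VW_def free_mod_simps)
    have "G ?t (\<Theta> f)" unfolding G_def by (rule bexI[OF _ f]) auto
    moreover from this have tZ: "?t \<in> Z" using t unfolding Z_def by blast
    ultimately have "\<Theta> f = K ?t" using iffD1[OF g(2)[OF tZ]] K(2)[OF tZ] by metis
    also have "\<dots> = K (\<lambda>i. if i < n then ?t i else \<zero>)" by (rule arg_cong[of _ _ K]) auto
    also have "\<dots> = lincomb (ideal_mod R W) r ?t n" by (rule Klc[OF t order_refl])
    also have "\<dots> = lincomb (ideal_mod R W) r (\<lambda>i. f (p i)) n" by (rule WM.lincomb_cong) auto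
    also have "\<dots> = f ?z"
      by (rule PW.lin_lincomb[OF flin[OF f] PW.P.carrier_is_submodule, symmetric]) (use r(1) p in auto)
    finally show ?thesis .
  qed
  then show ?thesis using zc by blast
qed

text \<open>The hypothesis \<open>WP \<subseteq> aP\<close> makes multiplication by \<open>a\<close> a bijection from \<open>Hom(P, R)\<close> onto
  \<open>Hom(P, W)\<close>, which transfers biduality from \<open>W\<close> to \<open>R\<close>.\<close>

lemma reflexive_if_W_stable:
  fixes P :: "('a, 'b) module"
  assumes P: "fg_module R P" and tf: "\<And>p. p \<in> carrier P \<Longrightarrow> x \<odot>\<^bsub>P\<^esub> p = \<zero>\<^bsub>P\<^esub> \<Longrightarrow> p = \<zero>\<^bsub>P\<^esub>"
    and a: "a \<in> W" "a \<in> nonzerodivisors R"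
    and stable: "\<And>w z. w \<in> W \<Longrightarrow> z \<in> carrier P \<Longrightarrow> \<exists>z'\<in>carrier P. w \<odot>\<^bsub>P\<^esub> z = a \<odot>\<^bsub>P\<^esub> z'"
  shows "reflexive_mod R P"
proof -
  let ?D = "Hom_mod R P (ideal_mod R W)"
  have Pm: "module R P" using P by (simp add: fg_module_def)
  interpret PW: module_pair R P "ideal_mod R W"
    by (rule module_pairI[OF Pm WM.module_axioms])
  interpret PR: module_pair R P "self_mod R"
    by (rule module_pairI[OF Pm module_self_mod])
  have ac: "a \<in> carrier R" using a W_closed by blast
  note cancel = nzd_cancel[OF a(2)]
  have duallin: "lin R P (carrier P) (self_mod R) \<psi>" and dualext: "\<psi> \<in> extensional (carrier P)"
    if "\<psi> \<in> carrier (dual_mod R P)" for \<psi>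
    using that unfolding dual_mod_def by (simp_all add: mod_hom_iff_lin)
  have dualI: "restrict \<psi> (carrier P) \<in> carrier (dual_mod R P)" if "lin R P (carrier P) (self_mod R) \<psi>" for \<psi>
    using PW.P.restrict_lin[OF that] unfolding dual_mod_def .
  have dc: "\<psi> q \<in> carrier R" if "\<psi> \<in> carrier (dual_mod R P)" "q \<in> carrier P" for \<psi> q
    using lin_closed[OF duallin[OF that(1)] that(2)] by simp
  have Dlin: "lin R P (carrier P) (ideal_mod R W) f" and Dext: "f \<in> extensional (carrier P)" if "f \<in> carrier ?D" for f
    using that by (simp_all add: mod_hom_iff_lin)
  define up where "up \<psi> = (\<lambda>q\<in>carrier P. a \<otimes> \<psi> q)" for \<psi> :: "'b \<Rightarrow> 'a"
  have up: "up \<psi> \<in> carrier ?D" if \<psi>: "\<psi> \<in> carrier (dual_mod R P)" for \<psi>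
    unfolding up_def
  proof (rule PW.P.restrict_lin, rule linI)
    show "a \<otimes> \<psi> u \<in> carrier (ideal_mod R W)" if "u \<in> carrier P" for u
      using ideal.I_r_closed[OF W a(1) dc[OF \<psi> that]] by simp
    show "a \<otimes> \<psi> (u \<oplus>\<^bsub>P\<^esub> v) = a \<otimes> \<psi> u \<oplus>\<^bsub>ideal_mod R W\<^esub> a \<otimes> \<psi> v" if "u \<in> carrier P" "v \<in> carrier P" for u v
      using lin_add[OF duallin[OF \<psi>] that] dc[OF \<psi>] that ac by (simp add: r_distr)
    show "a \<otimes> \<psi> (r \<odot>\<^bsub>P\<^esub> u) = r \<odot>\<^bsub>ideal_mod R W\<^esub> (a \<otimes> \<psi> u)" if "r \<in> carrier R" "u \<in> carrier P" for r u
      using lin_smult[OF duallin[OF \<psi>] that] dc[OF \<psi>] that ac by (simp add: m_lcomm)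
  qed
  have "\<exists>\<psi>\<in>carrier (dual_mod R P). up \<psi> = f" if f: "f \<in> carrier ?D" for f
  proof -
    have fc: "f q \<in> W" "f q \<in> carrier R" if "q \<in> carrier P" for q
      using lin_closed[OF Dlin[OF f] that] W_closed by simp_all
    have "\<exists>r\<in>carrier R. f q = a \<otimes> r" if q: "q \<in> carrier P" for q
    proof (rule mult_W_into_aW[OF a fc(2)[OF q]])
      fix w assume w: "w \<in> W"
      obtain q' where q': "q' \<in> carrier P" "w \<odot>\<^bsub>P\<^esub> q = a \<odot>\<^bsub>P\<^esub> q'" using stable[OF w q] by blast
      have "f q \<otimes> w = a \<otimes> f q'"
        using lin_smult[OF Dlin[OF f] W_closed[OF w] q] lin_smult[OF Dlin[OF f] ac q'(1)] q'(2)
          fc(2)[OF q] W_closed[OF w] by (simp add: m_comm)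
      then show "\<exists>w'\<in>W. f q \<otimes> w = a \<otimes> w'" using fc(1)[OF q'(1)] by blast
    qed
    then obtain \<psi> where \<psi>: "\<And>q. q \<in> carrier P \<Longrightarrow> \<psi> q \<in> carrier R" "\<And>q. q \<in> carrier P \<Longrightarrow> f q = a \<otimes> \<psi> q"
      by metis
    have "lin R P (carrier P) (self_mod R) \<psi>"
    proof (rule linI)
      show "\<psi> (u \<oplus>\<^bsub>P\<^esub> v) = \<psi> u \<oplus>\<^bsub>self_mod R\<^esub> \<psi> v" if "u \<in> carrier P" "v \<in> carrier P" for u v
        using cancel[of "\<psi> (u \<oplus>\<^bsub>P\<^esub> v)" "\<psi> u \<oplus> \<psi> v"] lin_add[OF Dlin[OF f] that] that \<psi> ac by (simp add: r_distr)
      show "\<psi> (r \<odot>\<^bsub>P\<^esub> u) = r \<odot>\<^bsub>self_mod R\<^esub> \<psi> u" if "r \<in> carrier R" "u \<in> carrier P" for r u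
        using cancel[of "\<psi> (r \<odot>\<^bsub>P\<^esub> u)" "r \<otimes> \<psi> u"] lin_smult[OF Dlin[OF f] that] that \<psi> ac by (simp add: m_lcomm)
    qed (use \<psi> in simp)
    moreover have "up (restrict \<psi> (carrier P)) = f"
      unfolding up_def using \<psi>(2) Dext[OF f] by (auto simp: extensional_def fun_eq_iff)
    ultimately show ?thesis using dualI by blast
  qed
  then obtain down where down: "\<And>f. f \<in> carrier ?D \<Longrightarrow> down f \<in> carrier (dual_mod R P)"
    "\<And>f. f \<in> carrier ?D \<Longrightarrow> up (down f) = f" by metis
  have up_inj: "\<psi> = \<psi>'" if "\<psi> \<in> carrier (dual_mod R P)" "\<psi>' \<in> carrier (dual_mod R P)"
    "\<And>q. q \<in> carrier P \<Longrightarrow> a \<otimes> \<psi> q = a \<otimes> \<psi>' q" for \<psi> \<psi>'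
  proof (rule extensionalityI[OF dualext[OF that(1)] dualext[OF that(2)]])
    show "\<psi> q = \<psi>' q" if q: "q \<in> carrier P" for q
      by (rule cancel) (use q dc that \<open>\<And>q. q \<in> carrier P \<Longrightarrow> a \<otimes> \<psi> q = a \<otimes> \<psi>' q\<close>
        \<open>\<psi> \<in> carrier (dual_mod R P)\<close> \<open>\<psi>' \<in> carrier (dual_mod R P)\<close> in auto)
  qed
  have down_val: "a \<otimes> down f q = f q" if "f \<in> carrier ?D" "q \<in> carrier P" for f q
    using fun_cong[OF down(2)[OF that(1)], of q] that(2) unfolding up_def by simp
  let ?B = "bidual_map R P"
  have Bval: "?B z = (\<lambda>\<phi>\<in>carrier (dual_mod R P). \<phi> z)" if "z \<in> carrier P" for z
    using that unfolding bidual_map_def by simp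
  have dd: "carrier (dual_mod R (dual_mod R P)) =
    {\<Theta>. lin R (dual_mod R P) (carrier (dual_mod R P)) (self_mod R) \<Theta> \<and> \<Theta> \<in> extensional (carrier (dual_mod R P))}"
    unfolding dual_mod_def[of R "dual_mod R P"] by (auto simp: mod_hom_iff_lin)
  have dual_ops: "add (dual_mod R P) = (\<lambda>f g. \<lambda>q\<in>carrier P. f q \<oplus> g q)"
    "smult (dual_mod R P) = (\<lambda>r f. \<lambda>q\<in>carrier P. r \<otimes> f q)"
    "\<And>f g. f \<in> carrier (dual_mod R P) \<Longrightarrow> g \<in> carrier (dual_mod R P) \<Longrightarrow> f \<oplus>\<^bsub>dual_mod R P\<^esub> g \<in> carrier (dual_mod R P)"
    "\<And>r f. r \<in> carrier R \<Longrightarrow> f \<in> carrier (dual_mod R P) \<Longrightarrow> r \<odot>\<^bsub>dual_mod R P\<^esub> f \<in> carrier (dual_mod R P)"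
    using PR.Hom_add_closed PR.Hom_smult_closed unfolding dual_mod_def by (auto simp: mod_hom_iff_lin)
  have Bcar: "?B z \<in> carrier (dual_mod R (dual_mod R P))" if z: "z \<in> carrier P" for z
    unfolding dd Bval[OF z]
  proof (intro CollectI conjI linI)
    show "restrict (\<lambda>\<phi>. \<phi> z) (carrier (dual_mod R P)) \<in> extensional (carrier (dual_mod R P))" by simp
  next
    fix f g assume "f \<in> carrier (dual_mod R P)" "g \<in> carrier (dual_mod R P)"
    then show "(\<lambda>\<phi>\<in>carrier (dual_mod R P). \<phi> z) (f \<oplus>\<^bsub>dual_mod R P\<^esub> g) =
      (\<lambda>\<phi>\<in>carrier (dual_mod R P). \<phi> z) f \<oplus>\<^bsub>self_mod R\<^esub> (\<lambda>\<phi>\<in>carrier (dual_mod R P). \<phi> z) g"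
      using dual_ops(3)[of f g] z by (simp add: dual_ops(1))
  next
    fix r f assume "r \<in> carrier R" "f \<in> carrier (dual_mod R P)"
    then show "(\<lambda>\<phi>\<in>carrier (dual_mod R P). \<phi> z) (r \<odot>\<^bsub>dual_mod R P\<^esub> f) =
      r \<odot>\<^bsub>self_mod R\<^esub> (\<lambda>\<phi>\<in>carrier (dual_mod R P). \<phi> z) f"
      using dual_ops(4)[of r f] z by (simp add: dual_ops(2))
  qed (use dc z in auto)
  have hom: "?B \<in> mod_hom R P (dual_mod R (dual_mod R P))"
  proof -
    have "?B (u \<oplus>\<^bsub>P\<^esub> v) = ?B u \<oplus>\<^bsub>dual_mod R (dual_mod R P)\<^esub> ?B v" if "u \<in> carrier P" "v \<in> carrier P" for u v
      using that lin_add[OF duallin] unfolding dual_mod_def[of R "dual_mod R P"]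
      by (auto simp: Bval fun_eq_iff)
    moreover have "?B (r \<odot>\<^bsub>P\<^esub> u) = r \<odot>\<^bsub>dual_mod R (dual_mod R P)\<^esub> ?B u" if "r \<in> carrier R" "u \<in> carrier P" for r u
      using that lin_smult[OF duallin] unfolding dual_mod_def[of R "dual_mod R P"]
      by (auto simp: Bval fun_eq_iff)
    ultimately show ?thesis unfolding mod_hom_def using Bcar by blast
  qed
  have inj: "inj_on ?B (carrier P)"
  proof (rule inj_onI)
    fix u v assume uv: "u \<in> carrier P" "v \<in> carrier P" "?B u = ?B v"
    \<comment> \<open>Forms into W separate the points of P, and each of them is a times a form into
      R.\<close>
    have "u \<ominus>\<^bsub>P\<^esub> v = \<zero>\<^bsub>P\<^esub>"
    proof (rule dual_separates[OF P tf])
      fix f assume f: "lin R P (carrier P) (ideal_mod R W) f"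
      let ?f = "restrict f (carrier P)"
      have fD: "?f \<in> carrier ?D" by (rule PW.P.restrict_lin[OF f])
      have "down ?f u = down ?f v"
        using fun_cong[OF uv(3), of "down ?f"] down(1)[OF fD] uv(1,2) by (simp add: Bval)
      then have "f u = f v" using down_val[OF fD] uv(1,2) by (metis restrict_apply')
      moreover have "f v \<in> carrier R" using lin_W_closed[OF f uv(2)] .
      moreover have "f (v \<oplus>\<^bsub>P\<^esub> (u \<ominus>\<^bsub>P\<^esub> v)) = f v \<oplus> f (u \<ominus>\<^bsub>P\<^esub> v)"
        using lin_add[OF f uv(2), of "u \<ominus>\<^bsub>P\<^esub> v"] uv by simp
      moreover have "v \<oplus>\<^bsub>P\<^esub> (u \<ominus>\<^bsub>P\<^esub> v) = u"
        using uv by (simp add: a_minus_def PW.P.M.a_ac PW.P.M.r_neg PW.P.M.r_neg1 PW.P.M.r_neg2)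
      moreover have "f (u \<ominus>\<^bsub>P\<^esub> v) \<in> carrier R" using lin_W_closed[OF f] uv by simp
      ultimately show "f (u \<ominus>\<^bsub>P\<^esub> v) = \<zero>" by (metis add.r_cancel_one' add.m_comm)
    qed (use uv in auto)
    then have "\<ominus>\<^bsub>P\<^esub> (\<ominus>\<^bsub>P\<^esub> v) = u"
      using uv by (intro PW.P.M.minus_equality) (simp_all add: a_minus_def)
    then show "u = v" using uv by simp
  qed
  have surj: "\<exists>z\<in>carrier P. ?B z = \<Theta>" if \<Theta>: "\<Theta> \<in> carrier (dual_mod R (dual_mod R P))" for \<Theta>
  proof -
    have \<Theta>lin: "lin R (dual_mod R P) (carrier (dual_mod R P)) (self_mod R) \<Theta>"
      and \<Theta>ext: "\<Theta> \<in> extensional (carrier (dual_mod R P))"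
      using \<Theta> unfolding dd by auto
    have \<Theta>c: "\<Theta> \<psi> \<in> carrier R" if "\<psi> \<in> carrier (dual_mod R P)" for \<psi>
      using lin_closed[OF \<Theta>lin that] by simp
    \<comment> \<open>\<Theta> is carried to Hom(P, W) along f \<mapsto> f/a and multiplied by a.
      The element z representing this map also represents \<Theta>, since a can be
      cancelled.\<close>
    have "lin R ?D (carrier ?D) (ideal_mod R W) (\<lambda>f. a \<otimes> \<Theta> (down f))"
    proof (rule linI)
      show "a \<otimes> \<Theta> (down f) \<in> carrier (ideal_mod R W)" if "f \<in> carrier ?D" for f
        using ideal.I_r_closed[OF W a(1) \<Theta>c[OF down(1)[OF that]]] by simp
      fix f g assume f: "f \<in> carrier ?D" and g: "g \<in> carrier ?D"
      have "down (f \<oplus>\<^bsub>?D\<^esub> g) = down f \<oplus>\<^bsub>dual_mod R P\<^esub> down g"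
      proof (rule up_inj)
        fix q assume q: "q \<in> carrier P"
        have "a \<otimes> down (f \<oplus>\<^bsub>?D\<^esub> g) q = (f \<oplus>\<^bsub>?D\<^esub> g) q"
          by (rule down_val[OF PW.Hom_add_closed[OF f g] q])
        also have "\<dots> = a \<otimes> down f q \<oplus> a \<otimes> down g q"
          using q down_val[OF f q] down_val[OF g q] by simp
        finally show "a \<otimes> down (f \<oplus>\<^bsub>?D\<^esub> g) q = a \<otimes> (down f \<oplus>\<^bsub>dual_mod R P\<^esub> down g) q"
          using q ac dc[OF down(1)[OF f] q] dc[OF down(1)[OF g] q] by (simp add: dual_ops(1) r_distr)
      qed (use down(1) PW.Hom_add_closed[OF f g] dual_ops(3) f g in blast)+
      then show "a \<otimes> \<Theta> (down (f \<oplus>\<^bsub>?D\<^esub> g)) = a \<otimes> \<Theta> (down f) \<oplus>\<^bsub>ideal_mod R W\<^esub> a \<otimes> \<Theta> (down g)"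
        using lin_add[OF \<Theta>lin down(1)[OF f] down(1)[OF g]] \<Theta>c[OF down(1)[OF f]] \<Theta>c[OF down(1)[OF g]] ac
        by (simp add: r_distr)
    next
      fix c f assume c: "c \<in> carrier R" and f: "f \<in> carrier ?D"
      have "down (c \<odot>\<^bsub>?D\<^esub> f) = c \<odot>\<^bsub>dual_mod R P\<^esub> down f"
      proof (rule up_inj)
        fix q assume q: "q \<in> carrier P"
        have "a \<otimes> down (c \<odot>\<^bsub>?D\<^esub> f) q = (c \<odot>\<^bsub>?D\<^esub> f) q"
          by (rule down_val[OF PW.Hom_smult_closed[OF c f] q])
        also have "\<dots> = c \<otimes> (a \<otimes> down f q)"
          using q down_val[OF f q] by simp
        finally show "a \<otimes> down (c \<odot>\<^bsub>?D\<^esub> f) q = a \<otimes> (c \<odot>\<^bsub>dual_mod R P\<^esub> down f) q"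
          using q ac c dc[OF down(1)[OF f] q] by (simp add: dual_ops(2) m_lcomm)
      qed (use down(1) PW.Hom_smult_closed[OF c f] dual_ops(4) c f in blast)+
      then show "a \<otimes> \<Theta> (down (c \<odot>\<^bsub>?D\<^esub> f)) = c \<odot>\<^bsub>ideal_mod R W\<^esub> (a \<otimes> \<Theta> (down f))"
        using lin_smult[OF \<Theta>lin c down(1)[OF f]] \<Theta>c[OF down(1)[OF f]] ac c by (simp add: m_lcomm)
    qed
    from dual_evaluation[OF P a this]
    obtain z where z: "z \<in> carrier P" "\<And>f. f \<in> carrier ?D \<Longrightarrow> a \<otimes> \<Theta> (down f) = f z" by blast
    have "\<Theta> \<psi> = \<psi> z" if \<psi>: "\<psi> \<in> carrier (dual_mod R P)" for \<psi>
    proof (rule cancel[OF \<Theta>c[OF \<psi>] dc[OF \<psi> z(1)]])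
      have "down (up \<psi>) = \<psi>"
        by (rule up_inj[OF down(1)[OF up[OF \<psi>]] \<psi>]) (use down_val[OF up[OF \<psi>]] in \<open>simp add: up_def\<close>)
      then show "a \<otimes> \<Theta> \<psi> = a \<otimes> \<psi> z" using z(2)[OF up[OF \<psi>]] z(1) by (simp add: up_def)
    qed
    then have "?B z = \<Theta>" using \<Theta>ext z(1) by (auto simp: Bval extensional_def fun_eq_iff)
    then show ?thesis using z(1) by blast
  qed
  have "bij_betw ?B (carrier P) (carrier (dual_mod R (dual_mod R P)))"
    unfolding bij_betw_def using inj surj Bcar by blast
  then show ?thesis unfolding reflexive_mod_def mod_iso_def using Pm hom by blast
qed

end

section \<open>Depth and the residue field\<close>

text \<open>This identifies the submodule against which the first entry of a regular sequence is
  tested.\<close>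

lemma (in plain_module) ideal_times_Idl_empty: "ideal_times R (Idl {}) M = {\<zero>\<^bsub>M\<^esub>}"
proof -
  have Z: "submodule {\<zero>\<^bsub>M\<^esub>} R M" by (rule submoduleI') auto
  have I: "Idl {} \<subseteq> {\<zero>}" by (rule R.genideal_minimal[OF R.zeroideal]) simp
  have sub: "{a \<odot>\<^bsub>M\<^esub> y | a y. a \<in> Idl {} \<and> y \<in> carrier M} \<subseteq> {\<zero>\<^bsub>M\<^esub>}" using I by auto
  have "mod_span R M {a \<odot>\<^bsub>M\<^esub> y | a y. a \<in> Idl {} \<and> y \<in> carrier M} \<subseteq> {\<zero>\<^bsub>M\<^esub>}"
    by (rule mod_span_minimal[OF Z sub])
  moreover have "submodule (mod_span R M {a \<odot>\<^bsub>M\<^esub> y | a y. a \<in> Idl {} \<and> y \<in> carrier M}) R M"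
    by (rule mod_span_submodule, rule subset_trans[OF sub]) simp
  ultimately show ?thesis unfolding ideal_times_def using submodule_zero by blast
qed

text \<open>If only the empty sequence were regular, the supremum would be at most 0. The first
  entry of a nonempty regular sequence acts injectively on M.\<close>

lemma (in plain_module) depth_one_regular:
  assumes "depth R m M = 1"
  shows "\<exists>y\<in>m. y \<in> carrier R \<and> (\<forall>z\<in>carrier M. y \<odot>\<^bsub>M\<^esub> z = \<zero>\<^bsub>M\<^esub> \<longrightarrow> z = \<zero>\<^bsub>M\<^esub>)"
proof -
  have "\<exists>xs. set xs \<subseteq> m \<and> regular_sequence R M xs \<and> xs \<noteq> []"
  proof (rule ccontr)
    assume "\<not> ?thesis"
    then have "depth R m M \<le> 0" unfolding depth_def by (intro SUP_least) (auto simp: zero_enat_def)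
    then show False using assms by simp
  qed
  then obtain xs where xs: "set xs \<subseteq> m" "regular_sequence R M xs" "xs \<noteq> []" by blast
  have len: "0 < length xs" using xs(3) by simp
  have "set xs \<subseteq> carrier R" using xs(2) unfolding regular_sequence_def by blast
  then have "xs ! 0 \<in> m" "xs ! 0 \<in> carrier R" using xs(1) nth_mem[OF len] by blast+
  moreover have "xs ! 0 \<odot>\<^bsub>M\<^esub> z = \<zero>\<^bsub>M\<^esub> \<longrightarrow> z = \<zero>\<^bsub>M\<^esub>" if "z \<in> carrier M" for z
  proof -
    have "\<forall>i<length xs. \<forall>y\<in>carrier M. xs ! i \<odot>\<^bsub>M\<^esub> y \<in> ideal_times R (Idl (set (take i xs))) M \<longrightarrow>
        y \<in> ideal_times R (Idl (set (take i xs))) M"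
      using xs(2) unfolding regular_sequence_def by blast
    from this[rule_format, OF len that] show ?thesis by (simp add: ideal_times_Idl_empty)
  qed
  ultimately show ?thesis by blast
qed

context local_dim_one
begin

text \<open>Depth yields some y in m that is regular on M but depends on M. A power of y is a
  multiple of x, so the fixed x acts injectively as well.\<close>

lemma MCM_torsion_free:
  fixes M :: "('a, 'b) module"
  assumes M: "MCM R m M" and x: "x \<in> m" "x \<in> nonzerodivisors R"
    and z: "z \<in> carrier M" "x \<odot>\<^bsub>M\<^esub> z = \<zero>\<^bsub>M\<^esub>"
  shows "z = \<zero>\<^bsub>M\<^esub>"
proof (cases "carrier M = {\<zero>\<^bsub>M\<^esub>}")
  case True
  then show ?thesis using z by simp
next
  case False
  interpret M: plain_module R M
    using M by (intro plain_moduleI) (simp add: MCM_def fg_module_def)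
  have "depth R m M = 1" using M False dim by (simp add: MCM_def)
  from M.depth_one_regular[OF this] obtain y where y: "y \<in> m" "y \<in> carrier R"
    "\<And>z. z \<in> carrier M \<Longrightarrow> y \<odot>\<^bsub>M\<^esub> z = \<zero>\<^bsub>M\<^esub> \<Longrightarrow> z = \<zero>\<^bsub>M\<^esub>" by blast
  have yn: "y [^] (n::nat) \<odot>\<^bsub>M\<^esub> u = \<zero>\<^bsub>M\<^esub> \<Longrightarrow> u \<in> carrier M \<Longrightarrow> u = \<zero>\<^bsub>M\<^esub>" for n u
  proof (induction n arbitrary: u)
    case (Suc n)
    then have "y [^] n \<odot>\<^bsub>M\<^esub> (y \<odot>\<^bsub>M\<^esub> u) = \<zero>\<^bsub>M\<^esub>" using y(2) by (simp add: M.smult_assoc1)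
    then have "y \<odot>\<^bsub>M\<^esub> u = \<zero>\<^bsub>M\<^esub>" using Suc y(2) by blast
    then show ?case using y(3) Suc(3) by blast
  qed simp
  obtain n :: nat where "y [^] n \<in> PIdl x" by (rule power_in_PIdl[OF x y(1)])
  then obtain r where r: "r \<in> carrier R" "y [^] n = r \<otimes> x" unfolding cgenideal_def by blast
  have "x \<in> carrier R" using x m.Icarr by blast
  then have "y [^] n \<odot>\<^bsub>M\<^esub> z = \<zero>\<^bsub>M\<^esub>" using r z by (simp add: M.smult_assoc1)
  then show ?thesis using yn z by blast
qed

lemma a_r_coset_self_mod: "J +>\<^bsub>self_mod R\<^esub> r = J +> r"
  by (simp add: a_r_coset_def')

lemma residue_carrier: "carrier (residue_mod R m) = {m +> r | r. r \<in> carrier R}"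
  by (simp add: residue_mod_def quot_mod_def a_r_coset_self_mod)

lemma residue_zero: "\<zero>\<^bsub>residue_mod R m\<^esub> = m +> \<zero>"
proof -
  have "m +> \<zero> = m" using m.Icarr by (auto simp: a_r_coset_def')
  then show ?thesis by (simp add: residue_mod_def quot_mod_def)
qed

lemma residue_add:
  "r \<in> carrier R \<Longrightarrow> s \<in> carrier R \<Longrightarrow> (m +> r) \<oplus>\<^bsub>residue_mod R m\<^esub> (m +> s) = m +> (r \<oplus> s)"
  using m.a_rcos_sum[of r s] by (simp add: residue_mod_def quot_mod_def set_add_def')

lemma coset_eq_iff:
  "r \<in> carrier R \<Longrightarrow> s \<in> carrier R \<Longrightarrow> m +> r = m +> s \<longleftrightarrow> r \<ominus> s \<in> m"
  using quotient_eq_iff_same_a_r_cos[OF m.ideal_axioms] by blast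

lemma coset_memD:
  assumes "s \<in> m +> r" "r \<in> carrier R" shows "s \<in> carrier R" "m +> s = m +> r"
proof -
  obtain h where h: "h \<in> m" "s = h \<oplus> r" using assms(1) by (auto simp: a_r_coset_def')
  then have hc: "h \<in> carrier R" using m.Icarr by blast
  show sc: "s \<in> carrier R" using h hc assms by simp
  have "s \<ominus> r = h" using h(2) hc assms(2) by (simp add: a_minus_def a_assoc r_neg)
  then show "m +> s = m +> r" using coset_eq_iff[OF sc assms(2)] h(1) by simp
qed

lemma coset_self: "r \<in> carrier R \<Longrightarrow> r \<in> m +> r"
  using m.zero_closed by (force simp: a_r_coset_def')

lemma residue_smult:
  assumes a: "a \<in> carrier R" and r: "r \<in> carrier R"
  shows "a \<odot>\<^bsub>residue_mod R m\<^esub> (m +> r) = m +> (a \<otimes> r)"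
proof -
  have "m +> (a \<otimes> s) = m +> (a \<otimes> r)" if "s \<in> m +> r" for s
  proof -
    note s = coset_memD[OF that r]
    have "a \<otimes> s \<ominus> a \<otimes> r = a \<otimes> (s \<ominus> r)" using a r s(1) by (simp add: a_minus_def r_distr r_minus)
    also have "\<dots> \<in> m" using m.I_l_closed[OF _ a] coset_eq_iff[OF s(1) r] s(2) by blast
    finally show ?thesis using coset_eq_iff a r s(1) by simp
  qed
  then have "(\<Union>s\<in>m +> r. m +> (a \<otimes> s)) = m +> (a \<otimes> r)" using coset_self[OF r] by blast
  then show ?thesis by (simp add: residue_mod_def quot_mod_def a_r_coset_self_mod)
qed

lemma residue_module: "module R (residue_mod R m)"
proof -
  let ?K = "residue_mod R m"
  have rep: "\<exists>r\<in>carrier R. X = m +> r" if "X \<in> carrier ?K" for X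
    using that unfolding residue_carrier by blast
  have car: "m +> r \<in> carrier ?K" if "r \<in> carrier R" for r
    using that unfolding residue_carrier by blast
  have "abelian_group ?K"
  proof (rule abelian_groupI)
    show "\<zero>\<^bsub>?K\<^esub> \<in> carrier ?K" unfolding residue_zero by (rule car) simp
    fix X assume "X \<in> carrier ?K"
    then obtain r where r: "r \<in> carrier R" "X = m +> r" using rep by blast
    show "\<zero>\<^bsub>?K\<^esub> \<oplus>\<^bsub>?K\<^esub> X = X" using r by (simp add: residue_add residue_zero)
    have "(m +> \<ominus> r) \<oplus>\<^bsub>?K\<^esub> X = \<zero>\<^bsub>?K\<^esub>" using r by (simp add: residue_add residue_zero l_neg)
    then show "\<exists>Y\<in>carrier ?K. Y \<oplus>\<^bsub>?K\<^esub> X = \<zero>\<^bsub>?K\<^esub>" using car[of "\<ominus> r"] r(1) by blast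
    fix Y assume "Y \<in> carrier ?K"
    then obtain s where s: "s \<in> carrier R" "Y = m +> s" using rep by blast
    show "X \<oplus>\<^bsub>?K\<^esub> Y \<in> carrier ?K" using r s car[of "r \<oplus> s"] by (simp add: residue_add)
    show "X \<oplus>\<^bsub>?K\<^esub> Y = Y \<oplus>\<^bsub>?K\<^esub> X" using r s by (simp add: residue_add a_comm[of r s])
    fix Z assume "Z \<in> carrier ?K"
    then obtain t where t: "t \<in> carrier R" "Z = m +> t" using rep by blast
    show "X \<oplus>\<^bsub>?K\<^esub> Y \<oplus>\<^bsub>?K\<^esub> Z = X \<oplus>\<^bsub>?K\<^esub> (Y \<oplus>\<^bsub>?K\<^esub> Z)" using r s t by (simp add: residue_add a_assoc)
  qed
  then show ?thesis
  proof (rule moduleI[OF cring_axioms])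
    fix a X assume a: "a \<in> carrier R" and "X \<in> carrier ?K"
    then obtain r where r: "r \<in> carrier R" "X = m +> r" using rep by blast
    show "a \<odot>\<^bsub>?K\<^esub> X \<in> carrier ?K" using a r car[of "a \<otimes> r"] by (simp add: residue_smult)
    fix b assume b: "b \<in> carrier R"
    show "(a \<oplus> b) \<odot>\<^bsub>?K\<^esub> X = a \<odot>\<^bsub>?K\<^esub> X \<oplus>\<^bsub>?K\<^esub> b \<odot>\<^bsub>?K\<^esub> X"
      using a b r by (simp add: residue_smult residue_add l_distr)
    show "(a \<otimes> b) \<odot>\<^bsub>?K\<^esub> X = a \<odot>\<^bsub>?K\<^esub> (b \<odot>\<^bsub>?K\<^esub> X)"
      using a b r by (simp add: residue_smult m_assoc)
  next
    fix a X Y assume a: "a \<in> carrier R" and "X \<in> carrier ?K" "Y \<in> carrier ?K"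
    then obtain r s where rs: "r \<in> carrier R" "X = m +> r" "s \<in> carrier R" "Y = m +> s" using rep by blast
    show "a \<odot>\<^bsub>?K\<^esub> (X \<oplus>\<^bsub>?K\<^esub> Y) = a \<odot>\<^bsub>?K\<^esub> X \<oplus>\<^bsub>?K\<^esub> a \<odot>\<^bsub>?K\<^esub> Y"
      using a rs by (simp add: residue_smult residue_add r_distr)
  next
    fix X assume "X \<in> carrier ?K"
    then obtain r where r: "r \<in> carrier R" "X = m +> r" using rep by blast
    show "\<one> \<odot>\<^bsub>?K\<^esub> X = X" using r by (simp add: residue_smult)
  qed
qed

lemma residue_nontrivial: "m +> \<one> \<noteq> m +> \<zero>"
  using coset_eq_iff[of \<one> \<zero>] one_notin_m by (simp add: a_minus_def)

end

section \<open>Ext of the residue field in elementary form\<close>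

context injectively_resolved
begin

text \<open>Evaluation at the class of 1 identifies Hom(R/m, E i) with the elements killed by m;
  with \<open>residue_lin_eqI\<close> and \<open>Hom_residue_killed\<close> it moves the computation
  of Ext to elements of the resolution.\<close>

lemma residue_lin:
  assumes e: "e \<in> carrier (E i)" "\<And>r. r \<in> m \<Longrightarrow> r \<odot>\<^bsub>E i\<^esub> e = \<zero>\<^bsub>E i\<^esub>"
  obtains u where "u \<in> carrier (Hom_mod R (residue_mod R m) (E i))" "u (m +> \<one>) = e"
proof -
  interpret KE: module_pair R "residue_mod R m" "E i"
    by (rule module_pairI[OF residue_module E.module_axioms])
  define G where "G X v \<longleftrightarrow> (\<exists>r\<in>carrier R. X = m +> r \<and> v = r \<odot>\<^bsub>E i\<^esub> e)" for X v
  obtain u where u: "lin R (residue_mod R m) (carrier (residue_mod R m)) (E i) u"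
    "\<And>X v. X \<in> carrier (residue_mod R m) \<Longrightarrow> G X v \<longleftrightarrow> u X = v"
  proof (rule KE.lin_of_graph[of "carrier (residue_mod R m)" G])
    show "submodule (carrier (residue_mod R m)) R (residue_mod R m)" by (rule KE.P.carrier_is_submodule)
    show "\<exists>v. G X v" if "X \<in> carrier (residue_mod R m)" for X using that unfolding G_def residue_carrier by blast
    show "v \<in> carrier (E i)" if "G X v" for X v using that e(1) unfolding G_def by auto
    show "G (X \<oplus>\<^bsub>residue_mod R m\<^esub> X') (v \<oplus>\<^bsub>E i\<^esub> v')" if G: "G X v" "G X' v'" for X v X' v'
    proof -
      obtain r s where rs: "r \<in> carrier R" "s \<in> carrier R" "X = m +> r" "X' = m +> s"
        "v = r \<odot>\<^bsub>E i\<^esub> e" "v' = s \<odot>\<^bsub>E i\<^esub> e" using G unfolding G_def by blast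
      show ?thesis unfolding G_def
        by (rule bexI[of _ "r \<oplus> s"]) (use rs e(1) in \<open>simp_all add: residue_add E.smult_l_distr\<close>)
    qed
    show "G (c \<odot>\<^bsub>residue_mod R m\<^esub> X) (c \<odot>\<^bsub>E i\<^esub> v)" if c: "c \<in> carrier R" and G: "G X v" for c X v
    proof -
      obtain r where r: "r \<in> carrier R" "X = m +> r" "v = r \<odot>\<^bsub>E i\<^esub> e" using G unfolding G_def by blast
      show ?thesis unfolding G_def
        by (rule bexI[of _ "c \<otimes> r"]) (use r c e(1) in \<open>simp_all add: residue_smult E.smult_assoc1\<close>)
    qed
    show "v = \<zero>\<^bsub>E i\<^esub>" if G: "G \<zero>\<^bsub>residue_mod R m\<^esub> v" for v
    proof -
      obtain r where r: "r \<in> carrier R" "m +> \<zero> = m +> r" "v = r \<odot>\<^bsub>E i\<^esub> e"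
        using G unfolding G_def residue_zero by blast
      have "r \<ominus> \<zero> \<in> m" using coset_eq_iff[OF r(1) zero_closed] r(2) by simp
      then have "r \<in> m" using r(1) by (simp add: a_minus_def)
      then show ?thesis using e(2) r(3) by simp
    qed
  qed blast
  have one: "m +> \<one> \<in> carrier (residue_mod R m)" unfolding residue_carrier by blast
  have "G (m +> \<one>) e" unfolding G_def by (rule bexI[of _ \<one>]) (use e(1) in auto)
  then have "u (m +> \<one>) = e" using u(2)[OF one] by blast
  then show ?thesis
    using that[OF KE.P.restrict_lin[OF u(1)]] one by simp
qed

lemma residue_lin_eqI:
  assumes f: "f \<in> carrier (Hom_mod R (residue_mod R m) (E i))" and g: "g \<in> carrier (Hom_mod R (residue_mod R m) (E i))"
    and eq: "f (m +> \<one>) = g (m +> \<one>)"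
  shows "f = g"
proof (rule extensionalityI[of _ "carrier (residue_mod R m)"])
  have one: "m +> \<one> \<in> carrier (residue_mod R m)" unfolding residue_carrier by blast
  have fl: "lin R (residue_mod R m) (carrier (residue_mod R m)) (E i) f"
    and gl: "lin R (residue_mod R m) (carrier (residue_mod R m)) (E i) g"
    using f g by (simp_all add: mod_hom_iff_lin)
  show "f X = g X" if X: "X \<in> carrier (residue_mod R m)" for X
  proof -
    obtain r where r: "r \<in> carrier R" "X = m +> r" using X unfolding residue_carrier by blast
    then have "X = r \<odot>\<^bsub>residue_mod R m\<^esub> (m +> \<one>)" by (simp add: residue_smult)
    then show ?thesis using lin_smult[OF fl r(1) one] lin_smult[OF gl r(1) one] eq by simp
  qed
qed (use f g in simp_all)

lemma Hom_residue_killed: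
  assumes f: "f \<in> carrier (Hom_mod R (residue_mod R m) (E i))" and r: "r \<in> m"
  shows "f (m +> \<one>) \<in> carrier (E i)" "r \<odot>\<^bsub>E i\<^esub> f (m +> \<one>) = \<zero>\<^bsub>E i\<^esub>"
proof -
  interpret KE: module_pair R "residue_mod R m" "E i"
    by (rule module_pairI[OF residue_module E.module_axioms])
  have one: "m +> \<one> \<in> carrier (residue_mod R m)" unfolding residue_carrier by blast
  have fl: "lin R (residue_mod R m) (carrier (residue_mod R m)) (E i) f"
    using f by (simp add: mod_hom_iff_lin)
  show "f (m +> \<one>) \<in> carrier (E i)" by (rule lin_closed[OF fl one])
  have rc: "r \<in> carrier R" using r m.Icarr by blast
  have "m +> r = m +> \<zero>" using coset_eq_iff[OF rc zero_closed] r rc by (simp add: a_minus_def)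
  then have "r \<odot>\<^bsub>residue_mod R m\<^esub> (m +> \<one>) = \<zero>\<^bsub>residue_mod R m\<^esub>"
    using rc by (simp add: residue_smult residue_zero)
  then show "r \<odot>\<^bsub>E i\<^esub> f (m +> \<one>) = \<zero>\<^bsub>E i\<^esub>"
    using lin_smult[OF fl rc one] KE.lin_zero[OF fl KE.P.carrier_is_submodule] by simp
qed

text \<open>R/m has two different elements, so a one-element carrier cannot be in bijection with it.
  The module structure of Ext is not touched.\<close>

lemma Ext_via_trivial:
  assumes iso: "f \<in> mod_iso R (Ext_via R (residue_mod R m) E d t) (residue_mod R m)"
    and triv: "\<And>X Y. X \<in> carrier (Ext_via R (residue_mod R m) E d t) \<Longrightarrow>
      Y \<in> carrier (Ext_via R (residue_mod R m) E d t) \<Longrightarrow> X = Y"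
  shows False
proof -
  have bij: "f ` carrier (Ext_via R (residue_mod R m) E d t) = carrier (residue_mod R m)"
    using iso unfolding mod_iso_def bij_betw_def by blast
  have "m +> \<one> \<in> carrier (residue_mod R m)" "m +> \<zero> \<in> carrier (residue_mod R m)"
    unfolding residue_carrier by blast+
  then obtain X Y where XY: "X \<in> carrier (Ext_via R (residue_mod R m) E d t)" "f X = m +> \<one>"
      "Y \<in> carrier (Ext_via R (residue_mod R m) E d t)" "f Y = m +> \<zero>"
    unfolding bij[symmetric] by (elim imageE) auto
  then have "X = Y" using triv by blast
  then show False using XY(2,4) residue_nontrivial by simp
qed

lemma a_r_coset_sub_mod: "B +>\<^bsub>sub_mod H C\<^esub> f = {h \<oplus>\<^bsub>H\<^esub> f | h. h \<in> B}"
  by (auto simp: a_r_coset_def')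

text \<open>Guards against the zero module, which counts as maximal Cohen-Macaulay and has depth 0:
  for it Ext^0(R/m, W) has only one element.\<close>

lemma W_nonzero:
  assumes iso: "f \<in> mod_iso R (Ext_via R (residue_mod R m) E d 0) (residue_mod R m)"
  shows "W \<noteq> {\<zero>}"
proof
  assume W0: "W = {\<zero>}"
  have "h = h'" if h: "h \<in> carrier (Hom_mod R (residue_mod R m) (E 0))" "\<forall>X\<in>carrier (residue_mod R m). d 0 (h X) = \<zero>\<^bsub>E 1\<^esub>"
    and h': "h' \<in> carrier (Hom_mod R (residue_mod R m) (E 0))" "\<forall>X\<in>carrier (residue_mod R m). d 0 (h' X) = \<zero>\<^bsub>E 1\<^esub>" for h h'
  proof -
    have one: "m +> \<one> \<in> carrier (residue_mod R m)" unfolding residue_carrier by blast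
    have "h (m +> \<one>) \<in> \<epsilon> ` W" "h' (m +> \<one>) \<in> \<epsilon> ` W"
      using eps_exact Hom_residue_killed(1)[OF h(1) x(1)] Hom_residue_killed(1)[OF h'(1) x(1)] h(2) h'(2) one by blast+
    then have "h (m +> \<one>) = h' (m +> \<one>)" using W0 by simp
    then show ?thesis by (rule residue_lin_eqI[OF h(1) h'(1)])
  qed
  then show False
    by (intro Ext_via_trivial[OF iso]) (auto simp: Ext_via_def quot_mod_def simp del: Hom_mod_simps)
qed

text \<open>The connecting map from Hom(m, W) onto Ext^1(R/m, W) kills the multiplications by
  elements of W; if there were no other maps, Ext^1 would be trivial.\<close>

lemma not_multiplication_if_Ext1:
  assumes iso: "f \<in> mod_iso R (Ext_via R (residue_mod R m) E d 1) (residue_mod R m)"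
  shows "\<exists>\<phi>. lin R (self_mod R) m (ideal_mod R W) \<phi> \<and> \<not> (\<exists>c\<in>W. \<forall>r\<in>m. \<phi> r = r \<otimes> c)"
proof (rule ccontr)
  assume "\<not> ?thesis"
  then have mult: "\<exists>c\<in>W. \<forall>r\<in>m. \<phi> r = r \<otimes> c" if "lin R (self_mod R) m (ideal_mod R W) \<phi>" for \<phi>
    using that by blast
  let ?K = "residue_mod R m"
  interpret KE: module_pair R ?K "E i" for i
    by (rule module_pairI[OF residue_module E.module_axioms])
  have one: "m +> \<one> \<in> carrier ?K" unfolding residue_carrier by blast
  have mS: "submodule m R (self_mod R)" by (simp add: submodule_self_mod_iff m.ideal_axioms)
  let ?H = "\<lambda>i. Hom_mod R ?K (E i)"
  define \<delta> where "\<delta> h = (\<lambda>X\<in>carrier ?K. d 0 (h X))" for h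
  let ?C = "{h \<in> carrier (?H 1). \<forall>X\<in>carrier ?K. d 1 (h X) = \<zero>\<^bsub>E (Suc 1)\<^esub>}"
  have Hl: "lin R ?K (carrier ?K) (E i) h" if "h \<in> carrier (?H i)" for h i
    using that by (simp add: mod_hom_iff_lin)
  have \<delta>H: "\<delta> h \<in> carrier (?H 1)" if "h \<in> carrier (?H 0)" for h
    unfolding \<delta>_def using KE.P.restrict_lin[OF lin_comp[OF Hl[OF that] d_lin lin_closed[OF Hl[OF that]]]] by simp
  have \<delta>add: "\<delta> (h \<oplus>\<^bsub>?H 0\<^esub> h') = \<delta> h \<oplus>\<^bsub>?H 1\<^esub> \<delta> h'" if "h \<in> carrier (?H 0)" "h' \<in> carrier (?H 0)" for h h'
    unfolding \<delta>_def using lin_add[OF d_lin[of 0]] lin_closed[OF Hl[OF that(1)]] lin_closed[OF Hl[OF that(2)]]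
    by (auto simp: fun_eq_iff)
  have coboundary: "\<exists>u\<in>carrier (?H 0). h = \<delta> u" if h: "h \<in> ?C" for h
  proof -
    let ?c = "h (m +> \<one>)"
    have hH: "h \<in> carrier (?H 1)" using h by blast
    have c: "?c \<in> carrier (E 1)" "\<And>r. r \<in> m \<Longrightarrow> r \<odot>\<^bsub>E 1\<^esub> ?c = \<zero>\<^bsub>E 1\<^esub>"
      using Hom_residue_killed[OF hH] x(1) by blast+
    have "d 1 ?c = \<zero>\<^bsub>E 2\<^esub>" using h one by (simp add: numeral_2_eq_2 del: Hom_mod_simps)
    then obtain e where e: "e \<in> carrier (E 0)" "d 0 e = ?c"
      using d_exact[of ?c 0] c(1) by (auto simp: numeral_2_eq_2)
    have rel: "lin R (self_mod R) m (E 0) (\<lambda>r. r \<odot>\<^bsub>E 0\<^esub> e)"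
      by (rule linI) (use e m.Icarr in \<open>auto simp: E.smult_l_distr E.smult_assoc1\<close>)
    have drel: "d 0 (r \<odot>\<^bsub>E 0\<^esub> e) = \<zero>\<^bsub>E 1\<^esub>" if "r \<in> m" for r
      using lin_smult[OF d_lin m.Icarr[OF that] e(1)] e(2) c(2)[OF that] by simp
    \<comment> \<open>The class of c is traced back along the connecting map: e lifts c, and r
      \<mapsto> re sends m into the kernel of d. If the resulting map to W is multiplication by w,
      then e - \<epsilon>(w) still lifts c and is killed by m, so c comes from Hom(R/m,
      \<open>E 0\<close>).\<close>
    obtain \<phi> where \<phi>: "lin R (self_mod R) m (ideal_mod R W) \<phi>" "\<And>r. r \<in> m \<Longrightarrow> \<epsilon> (\<phi> r) = r \<odot>\<^bsub>E 0\<^esub> e"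
      using eps_factor[OF module_self_mod mS rel drel] by metis
    obtain w where w: "w \<in> W" "\<And>r. r \<in> m \<Longrightarrow> \<phi> r = r \<otimes> w" using mult[OF \<phi>(1)] by blast
    have ew: "\<epsilon> w \<in> carrier (E 0)" "d 0 (\<epsilon> w) = \<zero>\<^bsub>E 1\<^esub>"
      using lin_closed[OF eps_lin w(1)] eps_exact[of "\<epsilon> w"] w(1) by simp_all
    let ?e = "e \<ominus>\<^bsub>E 0\<^esub> \<epsilon> w"
    have "r \<odot>\<^bsub>E 0\<^esub> ?e = \<zero>\<^bsub>E 0\<^esub>" if r: "r \<in> m" for r
    proof -
      have "r \<odot>\<^bsub>E 0\<^esub> e = r \<odot>\<^bsub>E 0\<^esub> \<epsilon> w"
        using \<phi>(2)[OF r] w(2)[OF r] lin_smult[OF eps_lin m.Icarr[OF r] w(1)] by simp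
      then show ?thesis using e(1) ew(1) m.Icarr[OF r]
        by (simp add: a_minus_def E.smult_r_distr E.smult_r_minus E.M.r_neg)
    qed
    then obtain u where u: "u \<in> carrier (?H 0)" "u (m +> \<one>) = ?e"
      using residue_lin[of ?e 0] e(1) ew(1) by auto
    have "d 0 ?e = ?c"
      using EE.lin_minus[OF d_lin E.carrier_is_submodule e(1) ew(1)] e(2) ew(2) c(1) by (simp add: a_minus_def)
    then have "h = \<delta> u"
      by (intro residue_lin_eqI[OF hH \<delta>H[OF u(1)]]) (use u(2) one in \<open>simp add: \<delta>_def\<close>)
    then show ?thesis using u(1) by blast
  qed
  let ?B = "\<delta> ` carrier (?H 0)"
  \<comment> \<open>Every cocycle is a coboundary, so all cosets in the definition of Ext
    coincide.\<close>
  have coset: "?B +>\<^bsub>sub_mod (?H 1) ?C\<^esub> h = ?B" if h: "h \<in> ?C" for h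
  proof -
    obtain u where u: "u \<in> carrier (?H 0)" "h = \<delta> u" using coboundary[OF h] by blast
    let ?u' = "(\<ominus> \<one>) \<odot>\<^bsub>?H 0\<^esub> u"
    have u': "?u' \<in> carrier (?H 0)" by (rule KE.Hom_smult_closed) (use u in auto)
    have cancel: "(v \<oplus>\<^bsub>?H 0\<^esub> ?u') \<oplus>\<^bsub>?H 0\<^esub> u = v" if v: "v \<in> carrier (?H 0)" for v
    proof (rule residue_lin_eqI[OF KE.Hom_add_closed[OF KE.Hom_add_closed[OF v u'] u(1)] v])
      show "((v \<oplus>\<^bsub>?H 0\<^esub> ?u') \<oplus>\<^bsub>?H 0\<^esub> u) (m +> \<one>) = v (m +> \<one>)"
        using one Hom_residue_killed(1)[OF v x(1)] Hom_residue_killed(1)[OF u(1) x(1)]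
        by (simp add: E.smult_l_minus E.M.a_assoc E.M.l_neg)
    qed
    show ?thesis
    proof
      show "?B +>\<^bsub>sub_mod (?H 1) ?C\<^esub> h \<subseteq> ?B"
      proof
        fix y assume "y \<in> ?B +>\<^bsub>sub_mod (?H 1) ?C\<^esub> h"
        then obtain v where v: "v \<in> carrier (?H 0)" "y = \<delta> v \<oplus>\<^bsub>?H 1\<^esub> \<delta> u"
          unfolding a_r_coset_sub_mod u(2) by blast
        then have "y = \<delta> (v \<oplus>\<^bsub>?H 0\<^esub> u)" using \<delta>add[OF v(1) u(1)] by simp
        then show "y \<in> ?B" using KE.Hom_add_closed[OF v(1) u(1)] by blast
      qed
      show "?B \<subseteq> ?B +>\<^bsub>sub_mod (?H 1) ?C\<^esub> h"
      proof
        fix y assume "y \<in> ?B"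
        then obtain v where v: "v \<in> carrier (?H 0)" "y = \<delta> v" by blast
        have "y = \<delta> (v \<oplus>\<^bsub>?H 0\<^esub> ?u') \<oplus>\<^bsub>?H 1\<^esub> h"
          using \<delta>add[OF KE.Hom_add_closed[OF v(1) u'] u(1)] cancel[OF v(1)] u(2) v(2) by simp
        then show "y \<in> ?B +>\<^bsub>sub_mod (?H 1) ?C\<^esub> h"
          unfolding a_r_coset_sub_mod using KE.Hom_add_closed[OF v(1) u'] by blast
      qed
    qed
  qed
  have "carrier (Ext_via R ?K E d 1) = {?B +>\<^bsub>sub_mod (?H 1) ?C\<^esub> h | h. h \<in> ?C}"
    unfolding Ext_via_def quot_mod_def \<delta>_def by (simp del: Hom_mod_simps)
  then have "X = ?B" if "X \<in> carrier (Ext_via R ?K E d 1)" for X using that coset by blast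
  then show False using Ext_via_trivial[OF iso] by blast
qed

end

section \<open>The total ring of fractions\<close>

text \<open>The operations on fractions are unions over all representatives; once the result is
  independent of the representatives, such a union collapses to a single class.\<close>

lemma UN_pairs_const:
  assumes "\<And>a s b t. (a, s) \<in> X \<Longrightarrow> (b, t) \<in> Y \<Longrightarrow> F a s b t = C" "(a0, s0) \<in> X" "(b0, t0) \<in> Y"
  shows "(\<Union>(a, s)\<in>X. \<Union>(b, t)\<in>Y. F a s b t) = C"
proof (intro equalityI subsetI)
  fix z assume "z \<in> (\<Union>(a, s)\<in>X. \<Union>(b, t)\<in>Y. F a s b t)"
  then obtain a s b t where "(a, s) \<in> X" "(b, t) \<in> Y" "z \<in> F a s b t" by blast
  then show "z \<in> C" using assms(1) by blast
next
  fix z assume "z \<in> C"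
  then have "z \<in> F a0 s0 b0 t0" using assms by blast
  then show "z \<in> (\<Union>(a, s)\<in>X. \<Union>(b, t)\<in>Y. F a s b t)" using assms(2,3) by blast
qed

context plain_cring
begin

lemma frac_self: "a \<in> carrier R \<Longrightarrow> s \<in> nonzerodivisors R \<Longrightarrow> (a, s) \<in> frac R a s"
  by (simp add: frac_def)

lemma frac_memD:
  assumes "(b, t) \<in> frac R a s"
  shows "b \<in> carrier R" "t \<in> nonzerodivisors R" "a \<otimes> t = b \<otimes> s"
  using assms by (simp_all add: frac_def)

lemma frac_eqI:
  assumes a: "a \<in> carrier R" and b: "b \<in> carrier R" and s: "s \<in> nonzerodivisors R" and t: "t \<in> nonzerodivisors R"
    and eq: "a \<otimes> t = b \<otimes> s"
  shows "frac R a s = frac R b t"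
proof -
  have *: "frac R a s \<subseteq> frac R b t"
    if a: "a \<in> carrier R" and b: "b \<in> carrier R" and s: "s \<in> nonzerodivisors R" and t: "t \<in> nonzerodivisors R"
    and eq: "a \<otimes> t = b \<otimes> s" for a b s t
  proof -
    have "b \<otimes> u = c \<otimes> t" if c: "c \<in> carrier R" and u: "u \<in> nonzerodivisors R" and cu: "a \<otimes> u = c \<otimes> s" for c u
    proof (rule nzd_cancel[OF s])
      note cl = a b c nzd_closed[OF s] nzd_closed[OF t] nzd_closed[OF u]
      have "s \<otimes> (b \<otimes> u) = (b \<otimes> s) \<otimes> u" using cl by (simp add: m_ac)
      also have "\<dots> = (a \<otimes> u) \<otimes> t" using cl by (simp add: eq[symmetric] m_ac)
      also have "\<dots> = s \<otimes> (c \<otimes> t)" using cl by (simp add: cu m_ac)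
      finally show "s \<otimes> (b \<otimes> u) = s \<otimes> (c \<otimes> t)" .
    qed (use b c t u nzd_closed in auto)
    then show ?thesis unfolding frac_def by auto
  qed
  show ?thesis using *[OF a b s t eq] *[OF b a t s eq[symmetric]] by blast
qed

lemma frac_eqD:
  assumes "frac R a s = frac R b t" "b \<in> carrier R" "t \<in> nonzerodivisors R"
  shows "a \<otimes> t = b \<otimes> s"
  using frac_self[OF assms(2,3)] assms(1) by (auto dest: frac_memD)

lemma frac_mult:
  assumes a: "a \<in> carrier R" and b: "b \<in> carrier R" and s: "s \<in> nonzerodivisors R" and t: "t \<in> nonzerodivisors R"
  shows "frac R a s \<otimes>\<^bsub>total_fractions R\<^esub> frac R b t = frac R (a \<otimes> b) (s \<otimes> t)"
proof -
  have "frac R (a' \<otimes> b') (s' \<otimes> t') = frac R (a \<otimes> b) (s \<otimes> t)"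
    if "(a', s') \<in> frac R a s" "(b', t') \<in> frac R b t" for a' s' b' t'
  proof (rule frac_eqI)
    note f = frac_memD[OF that(1)] frac_memD[OF that(2)]
    note cl = a b f(1,4) nzd_closed[OF s] nzd_closed[OF t] nzd_closed[OF f(2)] nzd_closed[OF f(5)]
    have "a' \<otimes> b' \<otimes> (s \<otimes> t) = (a' \<otimes> s) \<otimes> (b' \<otimes> t)" using cl by (simp add: m_ac)
    also have "\<dots> = (a \<otimes> s') \<otimes> (b \<otimes> t')" using f by simp
    also have "\<dots> = a \<otimes> b \<otimes> (s' \<otimes> t')" using cl by (simp add: m_ac)
    finally show "a' \<otimes> b' \<otimes> (s \<otimes> t) = a \<otimes> b \<otimes> (s' \<otimes> t')" .
  qed (use a b s t frac_memD[OF that(1)] frac_memD[OF that(2)] nzd_mult in auto)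
  then show ?thesis unfolding total_fractions_def ring_record_simps monoid.simps
    by (intro UN_pairs_const[OF _ frac_self[OF a s] frac_self[OF b t]])
qed

lemma frac_add:
  assumes a: "a \<in> carrier R" and b: "b \<in> carrier R" and s: "s \<in> nonzerodivisors R" and t: "t \<in> nonzerodivisors R"
  shows "frac R a s \<oplus>\<^bsub>total_fractions R\<^esub> frac R b t = frac R (a \<otimes> t \<oplus> b \<otimes> s) (s \<otimes> t)"
proof -
  have "frac R (a' \<otimes> t' \<oplus> b' \<otimes> s') (s' \<otimes> t') = frac R (a \<otimes> t \<oplus> b \<otimes> s) (s \<otimes> t)"
    if "(a', s') \<in> frac R a s" "(b', t') \<in> frac R b t" for a' s' b' t'
  proof (rule frac_eqI)
    note f = frac_memD[OF that(1)] frac_memD[OF that(2)]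
    note cl = a b f(1,4) nzd_closed[OF s] nzd_closed[OF t] nzd_closed[OF f(2)] nzd_closed[OF f(5)]
    have "(a' \<otimes> t' \<oplus> b' \<otimes> s') \<otimes> (s \<otimes> t) = (a' \<otimes> s) \<otimes> (t' \<otimes> t) \<oplus> (b' \<otimes> t) \<otimes> (s' \<otimes> s)"
      using cl by (simp add: l_distr r_distr m_ac)
    also have "\<dots> = (a \<otimes> s') \<otimes> (t' \<otimes> t) \<oplus> (b \<otimes> t') \<otimes> (s' \<otimes> s)" using f by simp
    also have "\<dots> = (a \<otimes> t \<oplus> b \<otimes> s) \<otimes> (s' \<otimes> t')" using cl by (simp add: l_distr r_distr m_ac)
    finally show "(a' \<otimes> t' \<oplus> b' \<otimes> s') \<otimes> (s \<otimes> t) = (a \<otimes> t \<oplus> b \<otimes> s) \<otimes> (s' \<otimes> t')" .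
  qed (use a b s t frac_memD[OF that(1)] frac_memD[OF that(2)] nzd_mult nzd_closed in auto)
  then show ?thesis unfolding total_fractions_def ring_record_simps monoid.simps
    by (intro UN_pairs_const[OF _ frac_self[OF a s] frac_self[OF b t]])
qed

lemma frac_mult_to_frac:
  "a \<in> carrier R \<Longrightarrow> s \<in> nonzerodivisors R \<Longrightarrow> b \<in> carrier R \<Longrightarrow>
    frac R a s \<otimes>\<^bsub>total_fractions R\<^esub> to_frac R b = frac R (a \<otimes> b) s"
  unfolding to_frac_def by (simp add: frac_mult nzd_one nzd_closed)

lemma to_frac_mult_frac:
  "a \<in> carrier R \<Longrightarrow> s \<in> nonzerodivisors R \<Longrightarrow> b \<in> carrier R \<Longrightarrow>
    to_frac R b \<otimes>\<^bsub>total_fractions R\<^esub> frac R a s = frac R (b \<otimes> a) s"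
  unfolding to_frac_def by (simp add: frac_mult nzd_one nzd_closed)

lemma frac_eq_to_frac_iff:
  assumes "a \<in> carrier R" "s \<in> nonzerodivisors R" "b \<in> carrier R"
  shows "frac R a s = to_frac R b \<longleftrightarrow> a = s \<otimes> b"
proof
  assume "frac R a s = to_frac R b"
  then have "a \<otimes> \<one> = b \<otimes> s" unfolding to_frac_def by (rule frac_eqD) (simp_all add: assms nzd_one)
  then show "a = s \<otimes> b" using assms nzd_closed by (simp add: m_comm)
next
  assume "a = s \<otimes> b"
  then show "frac R a s = to_frac R b" unfolding to_frac_def
    by (intro frac_eqI) (use assms nzd_one nzd_closed in \<open>auto simp: m_comm\<close>)
qed

end

section \<open>Almost Gorenstein rings\<close>

locale almost_Gorenstein_resolved = canonical_ideal_resolved R m x W \<epsilon> E d N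
  for R :: "'a ring" (structure) and m x and W :: "'a set" and \<epsilon> :: "'a \<Rightarrow> 'e" and E d N +
  fixes a :: 'a
  assumes a: "a \<in> W" "a \<in> nonzerodivisors R"
    and mW: "\<And>r w. r \<in> m \<Longrightarrow> w \<in> W \<Longrightarrow> \<exists>r'\<in>carrier R. r \<otimes> w = a \<otimes> r'"
begin

lemma a_carrier: "a \<in> carrier R"
  using a W_closed by blast

lemma MCM_stable_reflexive:
  fixes M :: "('a, 'b) module"
  assumes M: "MCM R m M"
    and stable: "\<And>w z. w \<in> W \<Longrightarrow> z \<in> carrier M \<Longrightarrow> \<exists>z'\<in>carrier M. w \<odot>\<^bsub>M\<^esub> z = a \<odot>\<^bsub>M\<^esub> z'"
  shows "reflexive_mod R M"
  by (rule reflexive_if_W_stable[OF _ MCM_torsion_free[OF M x] a stable]) (use M in \<open>simp_all add: MCM_def\<close>)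

text \<open>For a product iz the factor w/a is absorbed by i, so W(IM) lies in a(IM).
  Torsion-freeness and finite generation are inherited from M.\<close>

lemma ideal_times_reflexive:
  fixes M :: "('a, 'b) module"
  assumes M: "MCM R m M" and I: "ideal I R"
    and stable: "\<And>w i. w \<in> W \<Longrightarrow> i \<in> I \<Longrightarrow> \<exists>i'\<in>I. w \<otimes> i = a \<otimes> i'"
  shows "reflexive_mod R (sub_mod M (ideal_times R I M))"
proof -
  have fg: "fg_module R M" using M by (simp add: MCM_def)
  interpret M: plain_module R M using fg by (intro plain_moduleI) (simp add: fg_module_def)
  let ?X = "{i \<odot>\<^bsub>M\<^esub> z | i z. i \<in> I \<and> z \<in> carrier M}"
  let ?N = "ideal_times R I M"
  have Ic: "i \<in> carrier R" if "i \<in> I" for i using ideal.Icarr[OF I that] .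
  have X: "?X \<subseteq> carrier M" using Ic by auto
  have N: "submodule ?N R M" unfolding ideal_times_def by (rule M.mod_span_submodule[OF X])
  note Nc = M.submoduleE(1)[OF N, THEN subsetD]
  have XN: "?X \<subseteq> ?N" unfolding ideal_times_def by (rule mod_span_superset)
  \<comment> \<open>The elements of IM that W maps into a(IM). As these form a submodule, it
    suffices to check the generators iz.\<close>
  let ?T = "{z \<in> ?N. \<forall>w\<in>W. \<exists>z'\<in>?N. w \<odot>\<^bsub>M\<^esub> z = a \<odot>\<^bsub>M\<^esub> z'}"
  have T: "submodule ?T R M"
  proof (rule M.submoduleI')
    show "?T \<subseteq> carrier M" using Nc by blast
    have "w \<odot>\<^bsub>M\<^esub> \<zero>\<^bsub>M\<^esub> = a \<odot>\<^bsub>M\<^esub> \<zero>\<^bsub>M\<^esub>" if "w \<in> W" for w using W_closed[OF that] a_carrier by simp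
    then show "\<zero>\<^bsub>M\<^esub> \<in> ?T" using M.submodule_zero[OF N] by blast
    show "u \<oplus>\<^bsub>M\<^esub> v \<in> ?T" if u: "u \<in> ?T" and v: "v \<in> ?T" for u v
    proof -
      have "\<exists>z'\<in>?N. w \<odot>\<^bsub>M\<^esub> (u \<oplus>\<^bsub>M\<^esub> v) = a \<odot>\<^bsub>M\<^esub> z'" if w: "w \<in> W" for w
      proof -
        obtain u' v' where *: "u' \<in> ?N" "w \<odot>\<^bsub>M\<^esub> u = a \<odot>\<^bsub>M\<^esub> u'" "v' \<in> ?N" "w \<odot>\<^bsub>M\<^esub> v = a \<odot>\<^bsub>M\<^esub> v'"
          using u v w by blast
        have uv: "u \<in> carrier M" "v \<in> carrier M" using u v Nc by blast+
        have "w \<odot>\<^bsub>M\<^esub> (u \<oplus>\<^bsub>M\<^esub> v) = a \<odot>\<^bsub>M\<^esub> (u' \<oplus>\<^bsub>M\<^esub> v')"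
          using uv * Nc[OF *(1)] Nc[OF *(3)] W_closed[OF w] a_carrier by (simp add: M.smult_r_distr)
        then show ?thesis using M.submoduleE(5)[OF N *(1,3)] by blast
      qed
      then show ?thesis using u v M.submoduleE(5)[OF N] by blast
    qed
    show "r \<odot>\<^bsub>M\<^esub> u \<in> ?T" if r: "r \<in> carrier R" and u: "u \<in> ?T" for r u
    proof -
      have "\<exists>z'\<in>?N. w \<odot>\<^bsub>M\<^esub> (r \<odot>\<^bsub>M\<^esub> u) = a \<odot>\<^bsub>M\<^esub> z'" if w: "w \<in> W" for w
      proof -
        obtain u' where *: "u' \<in> ?N" "w \<odot>\<^bsub>M\<^esub> u = a \<odot>\<^bsub>M\<^esub> u'" using u w by blast
        have uc: "u \<in> carrier M" using u Nc by blast
        have "w \<odot>\<^bsub>M\<^esub> (r \<odot>\<^bsub>M\<^esub> u) = r \<odot>\<^bsub>M\<^esub> (w \<odot>\<^bsub>M\<^esub> u)"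
          using uc r W_closed[OF w] by (simp add: M.smult_assoc1[symmetric] m_comm)
        also have "\<dots> = a \<odot>\<^bsub>M\<^esub> (r \<odot>\<^bsub>M\<^esub> u')"
          using * r Nc[OF *(1)] a_carrier by (simp add: M.smult_assoc1[symmetric] m_comm)
        finally show ?thesis using M.submoduleE(4)[OF N r *(1)] by blast
      qed
      then show ?thesis using u r M.submoduleE(4)[OF N] by blast
    qed
  qed
  have "?X \<subseteq> ?T"
  proof
    fix y assume y: "y \<in> ?X"
    then obtain i z where iz: "y = i \<odot>\<^bsub>M\<^esub> z" "i \<in> I" "z \<in> carrier M" by blast
    have "\<exists>z'\<in>?N. w \<odot>\<^bsub>M\<^esub> y = a \<odot>\<^bsub>M\<^esub> z'" if w: "w \<in> W" for w
    proof -
      obtain i' where i': "i' \<in> I" "w \<otimes> i = a \<otimes> i'" using stable[OF w iz(2)] by blast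
      have "w \<odot>\<^bsub>M\<^esub> y = a \<odot>\<^bsub>M\<^esub> (i' \<odot>\<^bsub>M\<^esub> z)"
        using iz i' Ic W_closed[OF w] a_carrier by (simp add: M.smult_assoc1[symmetric])
      moreover have "i' \<odot>\<^bsub>M\<^esub> z \<in> ?N" using XN i'(1) iz(3) by blast
      ultimately show ?thesis by blast
    qed
    then show "y \<in> ?T" using y XN by blast
  qed
  then have NT: "?N \<subseteq> ?T" unfolding ideal_times_def[of R I M] by (rule mod_span_minimal[OF T[unfolded ideal_times_def]])
  show ?thesis
  proof (rule reflexive_if_W_stable[OF fg_module_sub_mod[OF fg N] _ a])
    show "p = \<zero>\<^bsub>sub_mod M ?N\<^esub>" if "p \<in> carrier (sub_mod M ?N)" "x \<odot>\<^bsub>sub_mod M ?N\<^esub> p = \<zero>\<^bsub>sub_mod M ?N\<^esub>" for p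
      using MCM_torsion_free[OF M x, of p] Nc that by simp
    show "\<exists>z'\<in>carrier (sub_mod M ?N). w \<odot>\<^bsub>sub_mod M ?N\<^esub> z = a \<odot>\<^bsub>sub_mod M ?N\<^esub> z'"
      if "w \<in> W" "z \<in> carrier (sub_mod M ?N)" for w z
      using NT that by auto
  qed
qed

lemma stable_ideal_reflexive:
  assumes J: "ideal J R" and stable: "\<And>w j. w \<in> W \<Longrightarrow> j \<in> J \<Longrightarrow> \<exists>j'\<in>J. w \<otimes> j = a \<otimes> j'"
  shows "reflexive_mod R (ideal_mod R J)"
proof (rule reflexive_if_W_stable[OF _ _ a])
  show "fg_module R (ideal_mod R J)" unfolding ideal_mod_def
    by (rule fg_module_sub_mod[OF fg_module_self_mod]) (simp add: submodule_self_mod_iff J)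
  show "p = \<zero>\<^bsub>ideal_mod R J\<^esub>" if "p \<in> carrier (ideal_mod R J)" "x \<odot>\<^bsub>ideal_mod R J\<^esub> p = \<zero>\<^bsub>ideal_mod R J\<^esub>" for p
    using that x_cancel[of p] ideal.Icarr[OF J] by simp
qed (use stable in auto)

text \<open>The last factor of I^(k+1) = I^k I absorbs w/a; n \<ge> 1 guarantees that this factor is
  present.\<close>

lemma ideal_power_reflexive:
  assumes I: "ideal I R" and n: "n \<ge> 1"
    and stable: "\<And>w i. w \<in> W \<Longrightarrow> i \<in> I \<Longrightarrow> \<exists>i'\<in>I. w \<otimes> i = a \<otimes> i'"
  shows "reflexive_mod R (ideal_mod R (ideal_power R I n))"
proof -
  have pow: "ideal_power R I (Suc k) = ideal_prod R (ideal_power R I k) I" for k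
    by (simp add: ideals_set_def nat_pow_def)
  have idl: "ideal (ideal_power R I k) R" for k
  proof (induction k)
    case 0
    have "ideal_power R I 0 = carrier R" by (simp add: ideals_set_def nat_pow_def)
    then show ?case using oneideal by simp
  next
    case (Suc k)
    then show ?case unfolding pow by (rule ideal_prod_is_ideal[OF _ I])
  qed
  obtain k where k: "n = Suc k" using n by (cases n) auto
  have *: "\<exists>j'\<in>ideal_prod R (ideal_power R I k) I. w \<otimes> j = a \<otimes> j'"
    if w: "w \<in> W" and j: "j \<in> ideal_prod R (ideal_power R I k) I" for w j
    using j
  proof (induction rule: ideal_prod.induct)
    case (prod u i)
    then have c: "u \<in> carrier R" "i \<in> carrier R" using ideal.Icarr[OF idl] ideal.Icarr[OF I] by blast+
    obtain i' where i': "i' \<in> I" "w \<otimes> i = a \<otimes> i'" using stable[OF w prod(2)] by blast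
    have "w \<otimes> (u \<otimes> i) = u \<otimes> (w \<otimes> i)" using c W_closed[OF w] by (simp add: m_lcomm)
    also have "\<dots> = a \<otimes> (u \<otimes> i')" using i' c ideal.Icarr[OF I i'(1)] a_carrier by (simp add: m_lcomm)
    finally show ?case using ideal_prod.prod[OF prod(1) i'(1)] by blast
  next
    case (sum s t)
    have IP: "ideal (ideal_prod R (ideal_power R I k) I) R" by (rule ideal_prod_is_ideal[OF idl I])
    obtain s' t' where *: "s' \<in> ideal_prod R (ideal_power R I k) I" "w \<otimes> s = a \<otimes> s'"
      "t' \<in> ideal_prod R (ideal_power R I k) I" "w \<otimes> t = a \<otimes> t'"
      using sum by blast
    note c = ideal.Icarr[OF IP sum(1)] ideal.Icarr[OF IP sum(2)] ideal.Icarr[OF IP *(1)] ideal.Icarr[OF IP *(3)]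
    have "w \<otimes> (s \<oplus> t) = a \<otimes> (s' \<oplus> t')" using c * W_closed[OF w] a_carrier by (simp add: r_distr)
    then show ?case using ideal_prod.sum[OF *(1,3)] by blast
  qed
  show ?thesis unfolding k pow
    by (rule stable_ideal_reflexive[OF ideal_prod_is_ideal[OF idl I]]) (rule *)
qed

text \<open>If \<open>w \<in> W\<close> and \<open>\<phi> : M \<rightarrow> R\<close> has image in \<open>m\<close>, then \<open>(w/a)\<phi>\<close> is again a map to \<open>R\<close>.\<close>

lemma trace_ideal_stable:
  assumes J: "trace_ideal TYPE('n) R I" and I: "ideal I R" "I \<noteq> carrier R"
    and w: "w \<in> W" and i: "i \<in> I"
  shows "\<exists>i'\<in>I. w \<otimes> i = a \<otimes> i'"
proof -
  obtain M :: "('a, 'n) module" where M: "fg_module R M" "I = trace_of R M"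
    using J unfolding trace_ideal_def by blast
  interpret MR: module_pair R M "self_mod R"
    by (rule module_pairI[OF _ module_self_mod]) (use M in \<open>simp add: fg_module_def\<close>)
  have dl: "lin R M (carrier M) (self_mod R) \<phi>" if "\<phi> \<in> carrier (dual_mod R M)" for \<phi>
    using that unfolding dual_mod_def by (simp add: mod_hom_iff_lin)
  have Im: "I \<subseteq> m" by (rule proper_subset_m[OF I])
  have single: "\<phi> y \<in> I" if \<phi>: "\<phi> \<in> carrier (dual_mod R M)" and y: "y \<in> carrier M" for \<phi> y
  proof -
    \<comment> \<open>A single value is a sum with one term, so all values of forms on M lie in I,
      and hence in m because I is proper.\<close>
    have "(\<Oplus>i\<in>{..<1::nat}. \<phi> y) \<in> I"
      unfolding M(2) trace_of_def mem_Collect_eq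
      by (rule exI[of _ 1], rule exI[of _ "\<lambda>_. \<phi>"], rule exI[of _ "\<lambda>_. y"]) (use \<phi> y in simp)
    moreover have "{..<1::nat} = {0}" by auto
    ultimately show ?thesis using lin_closed[OF dl[OF \<phi>] y] by simp
  qed
  have "\<exists>\<phi>'\<in>carrier (dual_mod R M). \<forall>y\<in>carrier M. w \<otimes> \<phi> y = a \<otimes> \<phi>' y" if \<phi>: "\<phi> \<in> carrier (dual_mod R M)" for \<phi>
  proof -
    have \<phi>c: "\<phi> y \<in> carrier R" if "y \<in> carrier M" for y using lin_closed[OF dl[OF \<phi>] that] by simp
    have "\<exists>r\<in>carrier R. w \<otimes> \<phi> y = a \<otimes> r" if y: "y \<in> carrier M" for y
      using mW[of "\<phi> y" w] single[OF \<phi> y] Im w W_closed[OF w] \<phi>c[OF y] by (auto simp: m_comm)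
    then obtain \<psi> where \<psi>: "\<And>y. y \<in> carrier M \<Longrightarrow> \<psi> y \<in> carrier R" "\<And>y. y \<in> carrier M \<Longrightarrow> w \<otimes> \<phi> y = a \<otimes> \<psi> y"
      by metis
    note wc = W_closed[OF w]
    have "lin R M (carrier M) (self_mod R) \<psi>"
    proof (rule linI)
      show "\<psi> (u \<oplus>\<^bsub>M\<^esub> v) = \<psi> u \<oplus>\<^bsub>self_mod R\<^esub> \<psi> v" if uv: "u \<in> carrier M" "v \<in> carrier M" for u v
      proof -
        have "a \<otimes> \<psi> (u \<oplus>\<^bsub>M\<^esub> v) = w \<otimes> \<phi> (u \<oplus>\<^bsub>M\<^esub> v)" using \<psi>(2)[of "u \<oplus>\<^bsub>M\<^esub> v"] uv by simp
        also have "\<dots> = a \<otimes> (\<psi> u \<oplus> \<psi> v)"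
          using lin_add[OF dl[OF \<phi>] uv] \<phi>c uv \<psi> wc a_carrier by (simp add: r_distr)
        finally show ?thesis using nzd_cancel[OF a(2)] \<psi>(1) uv by simp
      qed
      show "\<psi> (r \<odot>\<^bsub>M\<^esub> u) = r \<odot>\<^bsub>self_mod R\<^esub> \<psi> u" if ru: "r \<in> carrier R" "u \<in> carrier M" for r u
      proof -
        have "a \<otimes> \<psi> (r \<odot>\<^bsub>M\<^esub> u) = w \<otimes> \<phi> (r \<odot>\<^bsub>M\<^esub> u)" using \<psi>(2)[of "r \<odot>\<^bsub>M\<^esub> u"] ru by simp
        also have "\<dots> = r \<otimes> (w \<otimes> \<phi> u)" using lin_smult[OF dl[OF \<phi>] ru] \<phi>c ru wc by (simp add: m_lcomm)
        also have "\<dots> = a \<otimes> (r \<otimes> \<psi> u)" using \<psi> ru a_carrier by (simp add: m_lcomm)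
        finally show ?thesis using nzd_cancel[OF a(2)] \<psi>(1) ru by simp
      qed
    qed (use \<psi> in simp)
    then have "restrict \<psi> (carrier M) \<in> carrier (dual_mod R M)"
      unfolding dual_mod_def by (rule MR.P.restrict_lin)
    then show ?thesis by (rule bexI[rotated]) (use \<psi>(2) in simp)
  qed
  then obtain up where up: "\<And>\<phi>. \<phi> \<in> carrier (dual_mod R M) \<Longrightarrow> up \<phi> \<in> carrier (dual_mod R M)"
    "\<And>\<phi> y. \<phi> \<in> carrier (dual_mod R M) \<Longrightarrow> y \<in> carrier M \<Longrightarrow> w \<otimes> \<phi> y = a \<otimes> up \<phi> y" by metis
  obtain n :: nat and \<phi> y where n: "i = (\<Oplus>j\<in>{..<n}. \<phi> j (y j))"
    and \<phi>y: "\<And>j. j < n \<Longrightarrow> \<phi> j \<in> carrier (dual_mod R M)" "\<And>j. j < n \<Longrightarrow> y j \<in> carrier M"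
    using i unfolding M(2) trace_of_def by blast
  have c: "\<phi> j (y j) \<in> carrier R" "up (\<phi> j) (y j) \<in> carrier R" if "j < n" for j
    using lin_closed[OF dl[OF \<phi>y(1)[OF that]] \<phi>y(2)[OF that]]
      lin_closed[OF dl[OF up(1)[OF \<phi>y(1)[OF that]]] \<phi>y(2)[OF that]] by simp_all
  \<comment> \<open>Division by a is performed in each form separately, which exhibits the quotient
    again as a sum of values of forms.\<close>
  have "w \<otimes> i = (\<Oplus>j\<in>{..<n}. w \<otimes> \<phi> j (y j))"
    unfolding n by (rule finsum_rdistr) (use c W_closed[OF w] in auto)
  also have "\<dots> = (\<Oplus>j\<in>{..<n}. a \<otimes> up (\<phi> j) (y j))"
    by (rule finsum_cong') (use c \<phi>y up(2) a_carrier in auto)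
  also have "\<dots> = a \<otimes> (\<Oplus>j\<in>{..<n}. up (\<phi> j) (y j))"
    by (rule finsum_rdistr[symmetric]) (use c a_carrier in auto)
  finally have "w \<otimes> i = a \<otimes> (\<Oplus>j\<in>{..<n}. up (\<phi> j) (y j))" .
  moreover have "(\<Oplus>j\<in>{..<n}. up (\<phi> j) (y j)) \<in> I"
    unfolding M(2) trace_of_def mem_Collect_eq
    by (rule exI[of _ n], rule exI[of _ "\<lambda>j. up (\<phi> j)"], rule exI[of _ y]) (use \<phi>y up(1) in simp)
  ultimately show ?thesis by blast
qed

text \<open>A map \<open>f : S \<rightarrow> R\<close> is multiplication by \<open>f 1\<close>, which lies in \<open>m\<close> as \<open>S \<noteq> R\<close>.  So \<open>f \<mapsto> w f(1) / a\<close>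
  is a linear form on \<open>S\<^sup>*\<close>, and reflexivity of \<open>S\<close> turns it into an element of \<open>S\<close>, namely \<open>w/a\<close>.\<close>

lemma frac_in_End_ideal:
  assumes I: "regular_ideal R I" and S: "S = End_ideal R I"
    and refl: "reflexive_mod R (restrict_scalars (to_frac R) (self_mod S))"
    and RS: "to_frac R ` carrier R \<subset> carrier S" and w: "w \<in> W"
  shows "frac R w a \<in> carrier S"
proof -
  let ?Q = "total_fractions R"
  define SR where "SR = restrict_scalars (to_frac R) (self_mod S)"
  have Scar: "carrier S = {q \<in> carrier ?Q. \<forall>x\<in>I. q \<otimes>\<^bsub>?Q\<^esub> to_frac R x \<in> to_frac R ` I}"
    and Sops: "mult S = mult ?Q" "add S = add ?Q"
    unfolding S End_ideal_def by simp_all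
  have SRs [simp]: "carrier SR = carrier S" "add SR = add ?Q" "\<And>r s. r \<odot>\<^bsub>SR\<^esub> s = to_frac R r \<otimes>\<^bsub>?Q\<^esub> s"
    unfolding SR_def restrict_scalars_def by (simp_all add: Sops)
  have SRm: "module R SR" using refl unfolding reflexive_mod_def SR_def by blast
  interpret SR: module_pair R SR "self_mod R"
    by (rule module_pairI[OF SRm module_self_mod])
  have Iid: "ideal I R" using I by (simp add: regular_ideal_def)
  have Ic: "i \<in> carrier R" if "i \<in> I" for i using ideal.Icarr[OF Iid that] .
  have rep: "\<exists>b t. b \<in> carrier R \<and> t \<in> nonzerodivisors R \<and> s = frac R b t" if "s \<in> carrier S" for s
    using that unfolding Scar total_fractions_def by auto
  have one: "to_frac R \<one> \<in> carrier S" using RS by blast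
  have RSc: "to_frac R r \<in> carrier S" if "r \<in> carrier R" for r using RS that by blast
  have dl: "lin R SR (carrier SR) (self_mod R) f" if "f \<in> carrier (dual_mod R SR)" for f
    using that unfolding dual_mod_def by (simp add: mod_hom_iff_lin)
  have fc: "f s \<in> carrier R" if "f \<in> carrier (dual_mod R SR)" "s \<in> carrier S" for f s
    using lin_closed[OF dl[OF that(1)], of s] that(2) by simp
  \<comment> \<open>The identity f(s) = s f(1) for s = b/t, cleared of the denominator: it follows
    from t s = b 1 in S.\<close>
  have fval: "t \<otimes> f (frac R b t) = b \<otimes> f (to_frac R \<one>)"
    if f: "f \<in> carrier (dual_mod R SR)" and b: "b \<in> carrier R" "t \<in> nonzerodivisors R" and s: "frac R b t \<in> carrier S" for f b t
  proof -
    have tc: "t \<in> carrier R" using b by (simp add: nzd_closed)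
    have "frac R (t \<otimes> b) t = to_frac R b" using b tc by (simp add: frac_eq_to_frac_iff)
    then have "t \<odot>\<^bsub>SR\<^esub> frac R b t = to_frac R b" using b tc by (simp add: to_frac_mult_frac)
    also have "to_frac R b = b \<odot>\<^bsub>SR\<^esub> to_frac R \<one>"
      using b by (simp add: to_frac_def to_frac_mult_frac[unfolded to_frac_def] nzd_one)
    finally have "f (t \<odot>\<^bsub>SR\<^esub> frac R b t) = f (b \<odot>\<^bsub>SR\<^esub> to_frac R \<one>)" by simp
    then show ?thesis
      using lin_smult[OF dl[OF f] tc, of "frac R b t"] lin_smult[OF dl[OF f] b(1), of "to_frac R \<one>"] s one by simp
  qed
  \<comment> \<open>If f(1) were a unit, every s = f(s)/f(1) would lie in R.\<close>
  have f1m: "f (to_frac R \<one>) \<in> m" if f: "f \<in> carrier (dual_mod R SR)" for f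
  proof (rule ccontr)
    assume "f (to_frac R \<one>) \<notin> m"
    then have "f (to_frac R \<one>) \<in> Units R" using Units_if_notin_m fc[OF f one] by blast
    then obtain v where v: "v \<in> carrier R" "f (to_frac R \<one>) \<otimes> v = \<one>" by (auto simp: Units_def)
    have "s \<in> to_frac R ` carrier R" if s: "s \<in> carrier S" for s
    proof -
      obtain b t where bt: "b \<in> carrier R" "t \<in> nonzerodivisors R" "s = frac R b t" using rep[OF s] by blast
      have "b = b \<otimes> f (to_frac R \<one>) \<otimes> v" using bt v fc[OF f one] by (simp add: m_assoc)
      also have "\<dots> = t \<otimes> (f s \<otimes> v)"
        using fval[OF f bt(1,2)] s bt v fc[OF f s] nzd_closed by (simp add: m_assoc[symmetric])
      finally have "s = to_frac R (f s \<otimes> v)"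
        using bt fc[OF f s] v frac_eq_to_frac_iff[of b t "f s \<otimes> v"] by simp
      then show ?thesis using fc[OF f s] v by blast
    qed
    then show False using RS by blast
  qed
  note wc = W_closed[OF w]
  have "\<exists>r\<in>carrier R. f (to_frac R \<one>) \<otimes> w = a \<otimes> r" if "f \<in> carrier (dual_mod R SR)" for f
    by (rule mW[OF f1m[OF that] w])
  then obtain \<theta> where \<theta>: "\<And>f. f \<in> carrier (dual_mod R SR) \<Longrightarrow> \<theta> f \<in> carrier R"
    "\<And>f. f \<in> carrier (dual_mod R SR) \<Longrightarrow> f (to_frac R \<one>) \<otimes> w = a \<otimes> \<theta> f" by metis
  let ?\<Theta> = "restrict \<theta> (carrier (dual_mod R SR))"
  have dual_ops: "add (dual_mod R SR) = (\<lambda>f g. \<lambda>q\<in>carrier S. f q \<oplus> g q)"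
    "smult (dual_mod R SR) = (\<lambda>r f. \<lambda>q\<in>carrier S. r \<otimes> f q)"
    "\<And>f g. f \<in> carrier (dual_mod R SR) \<Longrightarrow> g \<in> carrier (dual_mod R SR) \<Longrightarrow> f \<oplus>\<^bsub>dual_mod R SR\<^esub> g \<in> carrier (dual_mod R SR)"
    "\<And>r f. r \<in> carrier R \<Longrightarrow> f \<in> carrier (dual_mod R SR) \<Longrightarrow> r \<odot>\<^bsub>dual_mod R SR\<^esub> f \<in> carrier (dual_mod R SR)"
    using SR.Hom_add_closed SR.Hom_smult_closed unfolding dual_mod_def by (auto simp: mod_hom_iff_lin)
  have "lin R (dual_mod R SR) (carrier (dual_mod R SR)) (self_mod R) ?\<Theta>"
  proof (rule linI)
    fix f g assume f: "f \<in> carrier (dual_mod R SR)" and g: "g \<in> carrier (dual_mod R SR)"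
    note fg = dual_ops(3)[OF f g]
    have "a \<otimes> \<theta> (f \<oplus>\<^bsub>dual_mod R SR\<^esub> g) = (f \<oplus>\<^bsub>dual_mod R SR\<^esub> g) (to_frac R \<one>) \<otimes> w"
      using \<theta>(2)[OF fg] by simp
    also have "\<dots> = f (to_frac R \<one>) \<otimes> w \<oplus> g (to_frac R \<one>) \<otimes> w"
      using one fc[OF f one] fc[OF g one] wc by (simp add: dual_ops(1) l_distr)
    also have "\<dots> = a \<otimes> (\<theta> f \<oplus> \<theta> g)" using \<theta> f g a_carrier by (simp add: r_distr)
    finally have "\<theta> (f \<oplus>\<^bsub>dual_mod R SR\<^esub> g) = \<theta> f \<oplus> \<theta> g" using nzd_cancel[OF a(2)] \<theta>(1) f g fg by simp
    then show "?\<Theta> (f \<oplus>\<^bsub>dual_mod R SR\<^esub> g) = ?\<Theta> f \<oplus>\<^bsub>self_mod R\<^esub> ?\<Theta> g" using f g fg by simp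
  next
    fix r f assume r: "r \<in> carrier R" and f: "f \<in> carrier (dual_mod R SR)"
    note rf = dual_ops(4)[OF r f]
    have "a \<otimes> \<theta> (r \<odot>\<^bsub>dual_mod R SR\<^esub> f) = (r \<odot>\<^bsub>dual_mod R SR\<^esub> f) (to_frac R \<one>) \<otimes> w"
      using \<theta>(2)[OF rf] by simp
    also have "\<dots> = r \<otimes> (f (to_frac R \<one>) \<otimes> w)"
      using one r fc[OF f one] wc by (simp add: dual_ops(2) m_assoc)
    also have "\<dots> = a \<otimes> (r \<otimes> \<theta> f)" using \<theta> f r a_carrier by (simp add: m_lcomm)
    finally have "\<theta> (r \<odot>\<^bsub>dual_mod R SR\<^esub> f) = r \<otimes> \<theta> f" using nzd_cancel[OF a(2)] \<theta>(1) f r rf by simp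
    then show "?\<Theta> (r \<odot>\<^bsub>dual_mod R SR\<^esub> f) = r \<odot>\<^bsub>self_mod R\<^esub> ?\<Theta> f" using f rf by simp
  qed (use \<theta> in simp)
  then have "?\<Theta> \<in> carrier (dual_mod R (dual_mod R SR))"
    unfolding dual_mod_def[of R "dual_mod R SR"] Hom_mod_iff by simp
  moreover have "bidual_map R SR ` carrier SR = carrier (dual_mod R (dual_mod R SR))"
    using refl unfolding reflexive_mod_def mod_iso_def bij_betw_def SR_def by blast
  ultimately obtain s0 where s0: "s0 \<in> carrier S" "bidual_map R SR s0 = ?\<Theta>" by (metis SRs(1) imageE)
  have s0val: "f s0 = \<theta> f" if f: "f \<in> carrier (dual_mod R SR)" for f
    using fun_cong[OF s0(2), of f] f s0(1) unfolding bidual_map_def by simp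
  obtain b t where bt: "b \<in> carrier R" "t \<in> nonzerodivisors R" "s0 = frac R b t" using rep[OF s0(1)] by blast
  \<comment> \<open>A regular element c of I supplies one explicit form on S, namely s \<mapsto> sc,
    which has values in R because S multiplies I into itself. Evaluation at this form suffices to
    identify s0.\<close>
  obtain c where c: "c \<in> I" "c \<in> nonzerodivisors R" using I unfolding regular_ideal_def by blast
  have cc: "c \<in> carrier R" by (rule Ic[OF c(1)])
  have "\<exists>r\<in>carrier R. s \<otimes>\<^bsub>?Q\<^esub> to_frac R c = to_frac R r" if "s \<in> carrier S" for s
    using that c(1) Ic unfolding Scar by blast
  then obtain g where g: "\<And>s. s \<in> carrier S \<Longrightarrow> g s \<in> carrier R"
    "\<And>s. s \<in> carrier S \<Longrightarrow> s \<otimes>\<^bsub>?Q\<^esub> to_frac R c = to_frac R (g s)" by metis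
  have gval: "b \<otimes> c = t \<otimes> g (frac R b t)"
    if "b \<in> carrier R" "t \<in> nonzerodivisors R" "frac R b t \<in> carrier S" for b t
    using g(2)[OF that(3)] frac_mult_to_frac[OF that(1,2) cc] frac_eq_to_frac_iff[of "b \<otimes> c" t "g (frac R b t)"]
      that g(1) cc by simp
  have glin: "lin R SR (carrier SR) (self_mod R) g"
  proof (rule linI)
    show "g u \<in> carrier (self_mod R)" if "u \<in> carrier SR" for u using g(1) that by simp
    show "g (u \<oplus>\<^bsub>SR\<^esub> v) = g u \<oplus>\<^bsub>self_mod R\<^esub> g v" if uv: "u \<in> carrier SR" "v \<in> carrier SR" for u v
    proof -
      obtain b t b' t' where *: "b \<in> carrier R" "t \<in> nonzerodivisors R" "u = frac R b t"
        "b' \<in> carrier R" "t' \<in> nonzerodivisors R" "v = frac R b' t'" using rep uv by (metis SRs(1))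
      note tc = nzd_closed[OF *(2)] nzd_closed[OF *(5)]
      have sum: "u \<oplus>\<^bsub>SR\<^esub> v = frac R (b \<otimes> t' \<oplus> b' \<otimes> t) (t \<otimes> t')" using * by (simp add: frac_add)
      have uvS: "u \<oplus>\<^bsub>SR\<^esub> v \<in> carrier S" using SR.P.M.add.m_closed[OF uv] by simp
      have uS: "u \<in> carrier S" "v \<in> carrier S" using uv by simp_all
      have "(t \<otimes> t') \<otimes> g (u \<oplus>\<^bsub>SR\<^esub> v) = (b \<otimes> t' \<oplus> b' \<otimes> t) \<otimes> c"
      proof -
        have "b \<otimes> t' \<oplus> b' \<otimes> t \<in> carrier R" using * tc by simp
        from gval[OF this nzd_mult[OF *(2,5)]] show ?thesis using uvS unfolding sum by simp
      qed
      also have "\<dots> = t' \<otimes> (b \<otimes> c) \<oplus> t \<otimes> (b' \<otimes> c)" using * tc cc by (simp add: l_distr r_distr m_ac)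
      also have "\<dots> = (t \<otimes> t') \<otimes> (g u \<oplus> g v)"
        using gval[OF *(1,2)] gval[OF *(4,5)] uS g(1)[OF uS(1)] g(1)[OF uS(2)] * tc by (simp add: r_distr m_ac)
      finally show ?thesis
        using nzd_cancel[OF nzd_mult[OF *(2,5)]] g(1)[OF uvS] g(1)[OF uS(1)] g(1)[OF uS(2)] by simp
    qed
    show "g (r \<odot>\<^bsub>SR\<^esub> u) = r \<odot>\<^bsub>self_mod R\<^esub> g u" if r: "r \<in> carrier R" and u: "u \<in> carrier SR" for r u
    proof -
      have uS: "u \<in> carrier S" using u by simp
      obtain b t where *: "b \<in> carrier R" "t \<in> nonzerodivisors R" "u = frac R b t" using rep[OF uS] by blast
      note tc = nzd_closed[OF *(2)]
      have ru: "r \<odot>\<^bsub>SR\<^esub> u = frac R (r \<otimes> b) t" using * r by (simp add: to_frac_mult_frac)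
      have ruS: "r \<odot>\<^bsub>SR\<^esub> u \<in> carrier S" using SR.P.smult_closed[OF r u] by simp
      have "t \<otimes> g (r \<odot>\<^bsub>SR\<^esub> u) = (r \<otimes> b) \<otimes> c"
        using gval[OF m_closed[OF r *(1)] *(2)] ruS unfolding ru by simp
      also have "\<dots> = r \<otimes> (b \<otimes> c)" using r * cc by (simp add: m_assoc)
      also have "\<dots> = t \<otimes> (r \<otimes> g u)" using gval[OF *(1,2)] uS g(1)[OF uS] * r tc by (simp add: m_lcomm)
      finally show ?thesis using nzd_cancel[OF *(2)] g(1)[OF ruS] g(1)[OF uS] r by simp
    qed
  qed
  let ?g = "restrict g (carrier S)"
  have gD: "?g \<in> carrier (dual_mod R SR)"
    using SR.P.restrict_lin[OF glin] unfolding dual_mod_def by simp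
  \<comment> \<open>The form g takes the value c at 1, so cw = a g(s0), while g(s0) is s0 c.
    Cancelling c gives s0 = w/a.\<close>
  have "g (to_frac R \<one>) = c"
    using gval[OF one_closed nzd_one] one g(1)[OF one] cc unfolding to_frac_def by simp
  then have e1: "c \<otimes> w = a \<otimes> g s0" using \<theta>(2)[OF gD] s0val[OF gD] one s0(1) by simp
  have e2: "b \<otimes> c = t \<otimes> g s0" using gval[OF bt(1,2)] s0(1) bt(3) by simp
  note cl = cc wc a_carrier bt(1) nzd_closed[OF bt(2)] g(1)[OF s0(1)]
  have "c \<otimes> (w \<otimes> t) = t \<otimes> (c \<otimes> w)" using cl by (simp add: m_ac)
  also have "\<dots> = a \<otimes> (b \<otimes> c)" unfolding e1 e2 using cl by (simp add: m_lcomm)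
  also have "\<dots> = c \<otimes> (b \<otimes> a)" using cl by (simp add: m_ac)
  finally have "w \<otimes> t = b \<otimes> a" using nzd_cancel[OF c(2)] cl by simp
  then have "frac R w a = s0" unfolding bt(3) by (intro frac_eqI) (use cl a bt in auto)
  then show ?thesis using s0(1) by simp
qed

lemma End_ideal_stable:
  assumes I: "ideal I R" and fr: "frac R w a \<in> carrier (End_ideal R I)" and w: "w \<in> W" and i: "i \<in> I"
  shows "\<exists>i'\<in>I. w \<otimes> i = a \<otimes> i'"
proof -
  have ic: "i \<in> carrier R" by (rule ideal.Icarr[OF I i])
  have "frac R w a \<otimes>\<^bsub>total_fractions R\<^esub> to_frac R i \<in> to_frac R ` I"
    using fr i unfolding End_ideal_def by simp
  then obtain i' where i': "i' \<in> I" "frac R (w \<otimes> i) a = to_frac R i'"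
    using frac_mult_to_frac[OF W_closed[OF w] a(2) ic] by auto
  then show ?thesis
    using frac_eq_to_frac_iff[of "w \<otimes> i" a i'] W_closed[OF w] a(2) ic ideal.Icarr[OF I i'(1)] by auto
qed

text \<open>On an S-module w acts as a times w/a, and w/a belongs to S; so the stability condition
  holds with z' = (w/a)z.\<close>

lemma CM_over_reflexive:
  fixes M :: "(('a \<times> 'a) set, 'b) module"
  assumes S: "S = End_ideal R I" and M: "CM_over R m S M" and RS: "to_frac R ` carrier R \<subset> carrier S"
    and fr: "\<And>w. w \<in> W \<Longrightarrow> frac R w a \<in> carrier S"
  shows "reflexive_mod R (restrict_scalars (to_frac R) M)"
proof (rule MCM_stable_reflexive)
  show "MCM R m (restrict_scalars (to_frac R) M)" using M by (simp add: CM_over_def)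
  have "module S M" using M by (simp add: CM_over_def fg_module_def)
  then interpret M: module S M .
  fix w z assume w: "w \<in> W" and "z \<in> carrier (restrict_scalars (to_frac R) M)"
  then have z: "z \<in> carrier M" by (simp add: restrict_scalars_def)
  have "to_frac R w = frac R (a \<otimes> w) a"
    using frac_eq_to_frac_iff[of "a \<otimes> w" a w] W_closed[OF w] a a_carrier by simp
  also have "\<dots> = to_frac R a \<otimes>\<^bsub>S\<^esub> frac R w a"
    unfolding S End_ideal_def using to_frac_mult_frac[OF W_closed[OF w] a(2) a_carrier] by simp
  finally have "to_frac R w \<odot>\<^bsub>M\<^esub> z = to_frac R a \<odot>\<^bsub>M\<^esub> (frac R w a \<odot>\<^bsub>M\<^esub> z)"
    using M.smult_assoc1[of "to_frac R a" "frac R w a" z] fr[OF w] z RS a_carrier by auto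
  moreover have "frac R w a \<odot>\<^bsub>M\<^esub> z \<in> carrier M" using fr[OF w] z by simp
  ultimately show "\<exists>z'\<in>carrier (restrict_scalars (to_frac R) M).
      w \<odot>\<^bsub>restrict_scalars (to_frac R) M\<^esub> z = a \<odot>\<^bsub>restrict_scalars (to_frac R) M\<^esub> z'"
    by (auto simp: restrict_scalars_def)
qed

end

text \<open>The element x comes from depth R = 1. The Ext condition on a canonical module sits in
  degree depth W, so depth W = 1 must be known before it becomes a statement on Ext^1; the
  alternative W = 0 is excluded through Ext^0.\<close>

lemma almost_Gorenstein_resolved_exists:
  fixes R :: "'a ring"
  assumes CM: "CM_local R m" and dim: "krull_dim R = 1" and AG: "almost_Gorenstein TYPE('e) R m"
  obtains x W \<epsilon> E d N a where "almost_Gorenstein_resolved R m x W (\<epsilon> :: 'a \<Rightarrow> 'e) E d N a"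
proof -
  have loc: "cring R" "noetherian_ring R" "maximalideal m R" "\<And>n. maximalideal n R \<Longrightarrow> n = m"
    using CM unfolding CM_local_def noetherian_local_def by blast+
  interpret local_dim_one R m
    by (intro local_dim_one.intro noetherian_cring.intro plain_cring.intro local_dim_one_axioms.intro) (fact loc dim)+
  interpret S: plain_module R "self_mod R" by (rule plain_moduleI, rule module_self_mod)
  have "depth R m (self_mod R) = 1" using CM dim by (simp add: CM_local_def)
  from S.depth_one_regular[OF this] obtain x where x: "x \<in> m" "x \<in> nonzerodivisors R"
    by (auto simp: nonzerodivisors_def)
  obtain W a where W: "canonical_ideal TYPE('e) R m W" and aW: "principal_reduction R W a"
    and mW: "m \<subseteq> {r \<in> carrier R. \<forall>w\<in>W. r \<otimes>\<^bsub>R\<^esub> w \<in> PIdl\<^bsub>R\<^esub> a}"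
    using AG unfolding almost_Gorenstein_def by blast
  have WI: "ideal W R" and MCM: "MCM R m (ideal_mod R W)"
    using W unfolding canonical_ideal_def canonical_module_def by blast+
  obtain \<epsilon> :: "'a \<Rightarrow> 'e" and E d N f where res: "injective_resolution R (ideal_mod R W) \<epsilon> E d"
    and fin: "\<forall>i>N. carrier (E i) = {\<zero>\<^bsub>E i\<^esub>}"
    and f: "f \<in> mod_iso R (Ext_via R (residue_mod R m) E d (the_enat (depth R m (ideal_mod R W)))) (residue_mod R m)"
    using W unfolding canonical_ideal_def canonical_module_def by blast
  interpret injectively_resolved R m x W \<epsilon> E d N
  proof (intro injectively_resolved.intro local_dim_one_axioms injectively_resolved_axioms.intro)
    show "carrier (E i) = {\<zero>\<^bsub>E i\<^esub>}" if "N < i" for i using fin that by blast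
  qed (fact x WI res)+
  have Wm: "MCM R m (ideal_mod R W)" by (rule MCM)
  \<comment> \<open>For W = 0 any sequence in m satisfies (xs)W = W, so not even the empty sequence
    is regular, and the supremum of the empty set is 0.\<close>
  have depth0: "depth R m (ideal_mod R W) = 0" if W0: "W = {\<zero>\<^bsub>R\<^esub>}"
  proof -
    have "ideal_times R (Idl\<^bsub>R\<^esub> (set xs)) (ideal_mod R W) = carrier (ideal_mod R W)" if "set xs \<subseteq> m" for xs
    proof -
      have "ideal (Idl\<^bsub>R\<^esub> (set xs)) R" by (rule genideal_ideal) (use that m.Icarr in blast)
      then have "{r \<odot>\<^bsub>ideal_mod R W\<^esub> y | r y. r \<in> Idl\<^bsub>R\<^esub> (set xs) \<and> y \<in> carrier (ideal_mod R W)} \<subseteq> carrier (ideal_mod R W)"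
        using ideal.Icarr W0 by fastforce
      from WM.mod_span_submodule[OF this] show ?thesis
        unfolding ideal_times_def using WM.submoduleE(1) WM.submodule_zero W0 by fastforce
    qed
    then have "{xs. set xs \<subseteq> m \<and> regular_sequence R (ideal_mod R W) xs} = {}"
      unfolding regular_sequence_def by blast
    then show ?thesis unfolding depth_def by (simp only: image_empty Sup_empty bot_enat_def)
  qed
  have "W \<noteq> {\<zero>\<^bsub>R\<^esub>}"
  proof
    assume W0: "W = {\<zero>\<^bsub>R\<^esub>}"
    have "f \<in> mod_iso R (Ext_via R (residue_mod R m) E d 0) (residue_mod R m)"
      using f unfolding depth0[OF W0] by (simp add: zero_enat_def)
    then show False using W_nonzero W0 by blast
  qed
  then have "depth R m (ideal_mod R W) = 1" using MCM dim by (simp add: MCM_def)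
  then have f1: "f \<in> mod_iso R (Ext_via R (residue_mod R m) E d 1) (residue_mod R m)"
    using f by (simp add: one_enat_def)
  interpret canonical_ideal_resolved R m x W \<epsilon> E d N
    by unfold_locales (rule not_multiplication_if_Ext1[OF f1])
  have a: "a \<in> W" using aW by (simp add: principal_reduction_def)
  have mW': "\<exists>r'\<in>carrier R. r \<otimes>\<^bsub>R\<^esub> w = a \<otimes>\<^bsub>R\<^esub> r'" if "r \<in> m" "w \<in> W" for r w
  proof -
    have "r \<otimes>\<^bsub>R\<^esub> w \<in> PIdl\<^bsub>R\<^esub> a" using mW that by blast
    then show ?thesis unfolding cgenideal_def using m_comm W_closed[OF a] by auto
  qed
  \<comment> \<open>If ay = 0, then x(yw) = y(xw) is a multiple of ay for every w, so yW = 0 and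
    faithfulness of W gives y = 0.\<close>
  have "a \<in> nonzerodivisors R"
  proof -
    have "y = \<zero>\<^bsub>R\<^esub>" if y: "y \<in> carrier R" "a \<otimes>\<^bsub>R\<^esub> y = \<zero>\<^bsub>R\<^esub>" for y
    proof (rule W_faithful[OF y(1)])
      fix w assume w: "w \<in> W"
      obtain r where r: "r \<in> carrier R" "x \<otimes>\<^bsub>R\<^esub> w = a \<otimes>\<^bsub>R\<^esub> r" using mW'[OF x(1) w] by blast
      have "x \<otimes>\<^bsub>R\<^esub> (y \<otimes>\<^bsub>R\<^esub> w) = y \<otimes>\<^bsub>R\<^esub> (x \<otimes>\<^bsub>R\<^esub> w)" using y x_closed W_closed[OF w] by (simp add: m_lcomm)
      also have "\<dots> = (a \<otimes>\<^bsub>R\<^esub> y) \<otimes>\<^bsub>R\<^esub> r" using r y(1) W_closed[OF a] by (simp add: m_ac)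
      also have "\<dots> = \<zero>\<^bsub>R\<^esub>" using y(2) r(1) by simp
      finally show "y \<otimes>\<^bsub>R\<^esub> w = \<zero>\<^bsub>R\<^esub>" using x_cancel y(1) W_closed[OF w] by simp
    qed
    then show ?thesis using W_closed[OF a] by (simp add: nonzerodivisors_def)
  qed
  then have "almost_Gorenstein_resolved R m x W \<epsilon> E d N a"
    using a mW' by unfold_locales
  then show ?thesis by (rule that)
qed

theorem proposition7p3:
  fixes R :: "'a ring" and m I :: "'a set" and S :: "('a \<times> 'a) set ring"
  assumes "CM_local R m" and "krull_dim R = 1"
    and "almost_Gorenstein TYPE('e) R m"
    and "regular_ideal R I"
    and "S = End_ideal R I"
  shows
    "(reflexive_mod R (restrict_scalars (to_frac R) (self_mod S)) \<and>
      to_frac R ` carrier R \<subset> carrier S \<longrightarrow>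
        (\<forall>M :: (('a \<times> 'a) set, 'b) module.
           CM_over R m S M \<longrightarrow> reflexive_mod R (restrict_scalars (to_frac R) M)) \<and>
        (\<forall>M :: ('a, 'c) module.
           MCM R m M \<longrightarrow> reflexive_mod R (sub_mod M (ideal_times R I M))) \<and>
        (\<forall>n\<ge>1. reflexive_mod R (ideal_mod R (ideal_power R I n)))) \<and>
     (trace_ideal TYPE('n) R I \<and> I \<noteq> carrier R \<longrightarrow>
        (\<forall>M :: ('a, 'c) module.
           MCM R m M \<longrightarrow> reflexive_mod R (sub_mod M (ideal_times R I M))) \<and>
        reflexive_mod R (ideal_mod R I) \<and>
        (\<forall>n\<ge>1. reflexive_mod R (ideal_mod R (ideal_power R I n))))"
proof -
  obtain x W \<epsilon> E d N a where "almost_Gorenstein_resolved R m x W (\<epsilon> :: 'a \<Rightarrow> 'e) E d N a"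
    by (rule almost_Gorenstein_resolved_exists[OF assms(1-3)])
  then interpret almost_Gorenstein_resolved R m x W \<epsilon> E d N a .
  have I: "ideal I R" using assms(4) by (simp add: regular_ideal_def)
  show ?thesis
  proof (intro conjI impI; elim conjE)
    assume refl: "reflexive_mod R (restrict_scalars (to_frac R) (self_mod S))"
      and RS: "to_frac R ` carrier R \<subset> carrier S"
    have fr: "frac R w a \<in> carrier S" if "w \<in> W" for w
      by (rule frac_in_End_ideal[OF assms(4,5) refl RS that])
    have stable: "\<exists>i'\<in>I. w \<otimes>\<^bsub>R\<^esub> i = a \<otimes>\<^bsub>R\<^esub> i'" if "w \<in> W" "i \<in> I" for w i
      by (rule End_ideal_stable[OF I _ that]) (use fr[OF that(1)] assms(5) in simp)
    show "\<forall>M :: (('a \<times> 'a) set, 'b) module.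
        CM_over R m S M \<longrightarrow> reflexive_mod R (restrict_scalars (to_frac R) M)"
      using CM_over_reflexive[OF assms(5) _ RS fr] by blast
    show "\<forall>M :: ('a, 'c) module. MCM R m M \<longrightarrow> reflexive_mod R (sub_mod M (ideal_times R I M))"
      using ideal_times_reflexive[OF _ I stable] by blast
    show "\<forall>n\<ge>1. reflexive_mod R (ideal_mod R (ideal_power R I n))"
      using ideal_power_reflexive[OF I _ stable] by blast
  next
    assume tr: "trace_ideal TYPE('n) R I" "I \<noteq> carrier R"
    have stable: "\<exists>i'\<in>I. w \<otimes>\<^bsub>R\<^esub> i = a \<otimes>\<^bsub>R\<^esub> i'" if "w \<in> W" "i \<in> I" for w i
      by (rule trace_ideal_stable[OF tr(1) I tr(2) that])
    show "\<forall>M :: ('a, 'c) module. MCM R m M \<longrightarrow> reflexive_mod R (sub_mod M (ideal_times R I M))"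
      using ideal_times_reflexive[OF _ I stable] by blast
    show "reflexive_mod R (ideal_mod R I)"
      by (rule stable_ideal_reflexive[OF I stable])
    show "\<forall>n\<ge>1. reflexive_mod R (ideal_mod R (ideal_power R I n))"
      using ideal_power_reflexive[OF I _ stable] by blast
  qed
qed

end
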